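(* Let $\alpha\in[0,1)$ and $p\in[0,1]$. Put $c:=\frac{(1-\alpha)^2}{2\alpha}>0$ if $\alpha\in(0,1)$ and $c:=\infty$ if $\alpha=0$. Let $X=(X_m)_{m\in\mathbb{Z}}$ be the rung process $X_m=\mathbf{1}_{\{z_m\in T\}}$ of the weighted random spanning tree $T$ of the simple ladder graph under $\mathbf{P}^c$ (with $X\equiv 1$ if $c=\infty$), let $(Y_m)_{m\in\mathbb{Z}}$ be i.i.d. Bernoulli random variables with parameter $p$, independent of $X$, and let $\tilde X_m:=X_mY_m$. (i) The process $X$ is determinantal with matrix $A_{k,l}=\widehat f(l-k)$, $k,l\in\mathbb{Z}$, where $$\widehat f(k)=\frac{1-\alpha}{1+\alpha}\,\alpha^{|k|}\quad\text{for all }k\in\mathbb{Z}\qquad\text{and}\qquad f(x)=\frac{c}{c+1-\cos(2\pi x)}.$$ In particular, $X$ is a renewal process with renewal distribution $$\mathbf{P}\big[\inf\{k\ge1:X_k=1\}=m\,\big|\,X_0=1\big]=(1-\alpha)^2\,m\,\alpha^{m-1},\qquad m\in\{1,2,\dots\}.$$ (ii) The thinned process $\tilde X$ is determinantal with matrix $\tilde A=pA$ and Fourier transform $$\tilde f(x)=\frac{pc}{c+1-\cos(2\pi x)}.$$ (iii) Every stationary (Hermitian) determinantal point process on $\mathbb{Z}$ that is also a renewal process has the distribution of $\tilde X$ for some $\alpha\in[0,1)$ and $p\in[0,1]$.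
   Context: Simple ladder graph $G^L=(V^L,E^L)$: $V^L=\{0,1\}\times\mathbb{Z}$, $E^L=\{z_m,h_{0,m},h_{1,m}:m\in\mathbb{Z}\}$ with $z_m=\{(0,m),(1,m)\}$ (rungs) and $h_{i,m}=\{(i,m-1),(i,m)\}$. For $m\le n$, $G^L_{m,n}$ is the subgraph induced by $\{0,1\}\times\{m,\dots,n\}$. Edge weights for $c\in(0,\infty)$: each $z_m$ has weight $c$, each $h_{i,m}$ has weight $1$. The weight of a spanning tree is the product of the weights of its edges. $\mathbf{P}^c_n$ is the probability measure on spanning trees of $G^L_{-n,n}$ giving each tree probability proportional to its weight, and $\mathbf{P}^c=\lim_{n\to\infty}\mathbf{P}^c_n$ (the limit exists, in the sense of convergence of probabilities of events depending on finitely many edges, and is concentrated on spanning trees of $G^L$). $T$ denotes the random spanning tree under $\mathbf{P}^c$. For $c=\infty$ set $X\equiv 1$. A $\{0,1\}^{\mathbb{Z}}$-valued process $X$ is a (Hermitian) determinantal point process with matrix $A$ (a Hermitian matrix indexed by $\mathbb{Z}$) if $\mathbf{P}[X_s=1\text{ for all }s\in S]=\det((A_{ij})_{i,j\in S})$ for all finite $S\subset\mathbb{Z}$. If $A_{k,l}=A_{0,l-k}$ for all $k,l$, its Fourier transform is the (a.e. unique) measurable $f:[0,1]\to[0,1]$ with $A_{0,k}=\widehat f(k):=\int_0^1 f(x)e^{-2\pi i kx}\,dx$ for all $k\in\mathbb{Z}$. A stationary process $X$ is a renewal process if it is regenerative of order 1: for all measurable $B\subset\{0,1\}^{\{-1,-2,\dots\}}$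 and $C\subset\{0,1\}^{\{1,2,\dots\}}$, $\mathbf{P}[X|_{\{1,2,\dots\}}\in C\mid X|_{\{-1,-2,\dots\}}\in B,\ X_0=1]=\mathbf{P}[X|_{\{1,2,\dots\}}\in C\mid X_0=1]$ (whenever the conditioning events have positive probability). Conventions for $\alpha=0$, $c=\infty$: $0^0=1$, so $A=I$ is the identity matrix, $f\equiv1$ and $\tilde f\equiv p$. *)

theory Defs
  imports "HOL-Probability.Probability" "Jordan_Normal_Form.Determinant"
begin

section \<open>Spanning trees of simple undirected graphs\<close>

text \<open>Edges are two-element sets of vertices. The tree notions of the AFP entry on digraphs
  are not used: there, acyclicity refers to directed cycles.\<close>

type_synonym 'v edge = "'v set"

definition connected_graph :: "'v set \<Rightarrow> 'v edge set \<Rightarrow> bool" where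
  "connected_graph V F \<longleftrightarrow> (\<forall>u\<in>V. \<forall>v\<in>V. (u, v) \<in> {(x, y). x \<in> V \<and> y \<in> V \<and> {x, y} \<in> F}\<^sup>*)"

definition graph_cycle :: "'v edge set \<Rightarrow> 'v list \<Rightarrow> bool" where
  "graph_cycle F vs \<longleftrightarrow> 3 \<le> length vs \<and> distinct vs \<and>
     (\<forall>i<length vs. {vs ! i, vs ! (Suc i mod length vs)} \<in> F)"

definition spanning_trees :: "'v set \<Rightarrow> 'v edge set \<Rightarrow> 'v edge set set" where
  "spanning_trees V E = {F. F \<subseteq> E \<and> connected_graph V F \<and> (\<nexists>vs. graph_cycle F vs)}"


section \<open>The weighted uniform spanning tree of the ladder\<close>

type_synonym ladder_vertex = "nat \<times> int"

definition ladder_vertices :: "ladder_vertex set" where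
  "ladder_vertices = {0, 1} \<times> UNIV"

definition rung :: "int \<Rightarrow> ladder_vertex edge" where
  "rung m = {(0, m), (1, m)}"

definition rail :: "nat \<Rightarrow> int \<Rightarrow> ladder_vertex edge" where
  "rail i m = {(i, m - 1), (i, m)}"

definition ladder_edges :: "ladder_vertex edge set" where
  "ladder_edges = range rung \<union> (\<Union>i\<in>{0, 1}. range (rail i))"

definition ladder_vertices_between :: "int \<Rightarrow> int \<Rightarrow> ladder_vertex set" where
  "ladder_vertices_between m n = {0, 1} \<times> {m..n}"

definition ladder_edges_between :: "int \<Rightarrow> int \<Rightarrow> ladder_vertex edge set" where
  "ladder_edges_between m n = {e \<in> ladder_edges. e \<subseteq> ladder_vertices_between m n}"

definition ladder_edge_weight :: "real \<Rightarrow> ladder_vertex edge \<Rightarrow> real" where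
  "ladder_edge_weight c e = (if e \<in> range rung then c else 1)"

definition tree_weight :: "real \<Rightarrow> ladder_vertex edge set \<Rightarrow> real" where
  "tree_weight c F = (\<Prod>e\<in>F. ladder_edge_weight c e)"

definition ladder_tree_measure_fin :: "real \<Rightarrow> nat \<Rightarrow> ladder_vertex edge set measure" where
  "ladder_tree_measure_fin c n =
     (let \<T> = spanning_trees (ladder_vertices_between (- int n) (int n))
                  (ladder_edges_between (- int n) (int n))
      in point_measure \<T> (\<lambda>F. ennreal (tree_weight c F / (\<Sum>F'\<in>\<T>. tree_weight c F'))))"

definition edge_sets_algebra :: "ladder_vertex edge set measure" where
  "edge_sets_algebra = sigma (Pow ladder_edges) ((\<lambda>e. {F \<in> Pow ladder_edges. e \<in> F}) ` ladder_edges)"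

text \<open>The events depending on finitely many edges are those of the form
  \<open>{F. F \<inter> D \<in> B}\<close> with \<open>D\<close> a finite set of edges. They determine a probability measure on
  the product \<open>\<sigma>\<close>-algebra, so there is at most one limit.\<close>

definition is_ladder_tree_limit :: "real \<Rightarrow> ladder_vertex edge set measure \<Rightarrow> bool" where
  "is_ladder_tree_limit c P \<longleftrightarrow> prob_space P \<and>
     space P = space edge_sets_algebra \<and> sets P = sets edge_sets_algebra \<and>
     (\<forall>D B. finite D \<and> D \<subseteq> ladder_edges \<longrightarrow>
        (\<lambda>n. \<P>(F in ladder_tree_measure_fin c n. F \<inter> D \<in> B))
          \<longlonglongrightarrow> \<P>(F in P. F \<inter> D \<in> B))"

definition ladder_tree_measure :: "real \<Rightarrow> ladder_vertex edge set measure" where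
  "ladder_tree_measure c = (THE P. is_ladder_tree_limit c P)"


section \<open>Processes with values in \<open>{0, 1}\<close> indexed by the integers\<close>

text \<open>The value 1 is rendered as \<^term>\<open>True\<close>.\<close>

abbreviation seq_algebra :: "int set \<Rightarrow> (int \<Rightarrow> bool) measure" where
  "seq_algebra I \<equiv> PiM I (\<lambda>_. count_space UNIV)"

definition binary_process :: "'a measure \<Rightarrow> (int \<Rightarrow> 'a \<Rightarrow> bool) \<Rightarrow> bool" where
  "binary_process M X \<longleftrightarrow> prob_space M \<and> (\<forall>m. X m \<in> measurable M (count_space UNIV))"

definition process_law :: "'a measure \<Rightarrow> (int \<Rightarrow> 'a \<Rightarrow> bool) \<Rightarrow> (int \<Rightarrow> bool) measure" where
  "process_law M X = distr M (seq_algebra UNIV) (\<lambda>\<omega> m. X m \<omega>)"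

definition stationary_process :: "'a measure \<Rightarrow> (int \<Rightarrow> 'a \<Rightarrow> bool) \<Rightarrow> bool" where
  "stationary_process M X \<longleftrightarrow> binary_process M X \<and>
     (\<forall>k. process_law M (\<lambda>m. X (m + k)) = process_law M X)"

definition principal_minor :: "(int \<Rightarrow> int \<Rightarrow> complex) \<Rightarrow> int set \<Rightarrow> complex" where
  "principal_minor A S = (let s = sorted_list_of_set S in
     Determinant.det (Matrix.mat (card S) (card S) (\<lambda>(i, j). A (s ! i) (s ! j))))"

definition determinantal_process ::
    "'a measure \<Rightarrow> (int \<Rightarrow> 'a \<Rightarrow> bool) \<Rightarrow> (int \<Rightarrow> int \<Rightarrow> complex) \<Rightarrow> bool" where
  "determinantal_process M X A \<longleftrightarrow> binary_process M X \<and> (\<forall>k l. A l k = cnj (A k l)) \<and>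
     (\<forall>S. finite S \<longrightarrow> complex_of_real \<P>(\<omega> in M. \<forall>s\<in>S. X s \<omega>) = principal_minor A S)"

definition fourier_coeff :: "(real \<Rightarrow> real) \<Rightarrow> int \<Rightarrow> complex" where
  "fourier_coeff f k = (CLINT x:{0..1}|lborel.
     complex_of_real (f x) * exp (- (2 * complex_of_real pi * \<i> * of_int k * complex_of_real x)))"

definition fourier_transform_of :: "(int \<Rightarrow> int \<Rightarrow> complex) \<Rightarrow> (real \<Rightarrow> real) \<Rightarrow> bool" where
  "fourier_transform_of A f \<longleftrightarrow> (\<forall>k l. A k l = A 0 (l - k)) \<and>
     f \<in> borel_measurable (restrict_space borel {0..1}) \<and> f ` {0..1} \<subseteq> {0..1} \<and>
     (\<forall>k. A 0 k = fourier_coeff f k)"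

text \<open>Regenerative of order 1: given a renewal at 0, the strict past and the strict future
  are independent.\<close>

definition renewal_process :: "'a measure \<Rightarrow> (int \<Rightarrow> 'a \<Rightarrow> bool) \<Rightarrow> bool" where
  "renewal_process M X \<longleftrightarrow> stationary_process M X \<and>
     (\<forall>B\<in>sets (seq_algebra {..-1}). \<forall>C\<in>sets (seq_algebra {1..}).
        \<P>(\<omega> in M. (\<lambda>m\<in>{..-1}. X m \<omega>) \<in> B \<and> X 0 \<omega>) > 0 \<longrightarrow>
        \<P>(\<omega> in M. (\<lambda>m\<in>{1..}. X m \<omega>) \<in> C \<bar> (\<lambda>m\<in>{..-1}. X m \<omega>) \<in> B \<and> X 0 \<omega>) =
        \<P>(\<omega> in M. (\<lambda>m\<in>{1..}. X m \<omega>) \<in> C \<bar> X 0 \<omega>))"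

text \<open>The infimum is taken in the extended naturals, so that it is \<open>\<infinity>\<close> if there is no
  further renewal.\<close>

definition next_renewal :: "(int \<Rightarrow> 'a \<Rightarrow> bool) \<Rightarrow> 'a \<Rightarrow> enat" where
  "next_renewal X \<omega> = (INF k\<in>{k::nat. 1 \<le> k \<and> X (int k) \<omega>}. enat k)"


section \<open>The rung process and its thinning\<close>

text \<open>For \<open>\<alpha> = 0\<close> the conductance is infinite and every rung is present; \<open>ladder_conductance\<close>
  is meaningful for \<open>\<alpha> > 0\<close> only.\<close>

definition ladder_conductance :: "real \<Rightarrow> real" where
  "ladder_conductance \<alpha> = (1 - \<alpha>)\<^sup>2 / (2 * \<alpha>)"

definition rung_process :: "real \<Rightarrow> ('a \<Rightarrow> ladder_vertex edge set) \<Rightarrow> int \<Rightarrow> 'a \<Rightarrow> bool" where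
  "rung_process \<alpha> T m \<omega> \<longleftrightarrow> (if \<alpha> = 0 then True else rung m \<in> T \<omega>)"

definition thinned_process ::
    "(int \<Rightarrow> 'a \<Rightarrow> bool) \<Rightarrow> (int \<Rightarrow> 'a \<Rightarrow> bool) \<Rightarrow> int \<Rightarrow> 'a \<Rightarrow> bool" where
  "thinned_process X Y m \<omega> \<longleftrightarrow> X m \<omega> \<and> Y m \<omega>"

definition thinned_ladder_model ::
    "real \<Rightarrow> real \<Rightarrow> 'a measure \<Rightarrow> ('a \<Rightarrow> ladder_vertex edge set) \<Rightarrow> (int \<Rightarrow> 'a \<Rightarrow> bool) \<Rightarrow> bool" where
  "thinned_ladder_model \<alpha> p M T Y \<longleftrightarrow> prob_space M \<and>
     (\<alpha> > 0 \<longrightarrow> T \<in> measurable M edge_sets_algebra \<and>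
        distr M edge_sets_algebra T = ladder_tree_measure (ladder_conductance \<alpha>)) \<and>
     prob_space.indep_vars M (\<lambda>_. count_space UNIV) Y UNIV \<and>
     (\<forall>m. distr M (count_space UNIV) (Y m) = measure_pmf (bernoulli_pmf p)) \<and>
     prob_space.indep_var M
       (seq_algebra UNIV) (\<lambda>\<omega> m. rung_process \<alpha> T m \<omega>) (seq_algebra UNIV) (\<lambda>\<omega> m. Y m \<omega>)"

definition ladder_symbol :: "real \<Rightarrow> real \<Rightarrow> real" where
  "ladder_symbol \<alpha> x = (if \<alpha> = 0 then 1
     else let c = ladder_conductance \<alpha> in c / (c + 1 - cos (2 * pi * x)))"

definition thinned_ladder_symbol :: "real \<Rightarrow> real \<Rightarrow> real \<Rightarrow> real" where
  "thinned_ladder_symbol \<alpha> p x = (if \<alpha> = 0 then p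
     else let c = ladder_conductance \<alpha> in p * c / (c + 1 - cos (2 * pi * x)))"

end

theory Submission
  imports Defs "HOL-Computational_Algebra.Formal_Power_Series"
begin

text \<open>Why the theorem holds. Cutting the ladder after a column leaves, on the left, either a spanning
  tree or a spanning forest of two trees that separate the two vertices of that column. Appending a
  column acts linearly on the total weights of these two classes (\<open>spanning_trees_extension\<close>,
  \<open>tree_sums_extend\<close>), so weighted sums over the spanning trees of a finite ladder are entries of
  products of \<open>2 \<times> 2\<close> transfer matrices, one for each column. A column without prescribed edges has
  a matrix of determinant 1 and trace \<open>2 + 2 * c = \<alpha> + 1 / \<alpha>\<close>; this is where the relation between
  \<open>c\<close> and \<open>\<alpha>\<close> comes from. As the eigenvalue \<open>1 / \<alpha>\<close> dominates \<open>\<alpha>\<close>, ratios of such sums converge when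
  the ladder grows in both directions (\<open>tendsto_tree_sum_ratio\<close>). The limits of the probabilities of
  cylinder events are consistent, so Kolmogorov's theorem provides the limit measure
  (\<open>ladder_tree_limit_exists\<close>).

  Requiring a rung to be present turns the matrix of its column into one of rank one, which forgets
  everything but a scalar. Therefore the probability that all rungs over a finite set are present
  is a product over the gaps of the set (\<open>measure_rungs\<close>): it is \<open>\<rho>\<close> times the product of \<open>u m\<close> over the
  gaps \<open>m\<close>, where \<open>\<rho> = (1 - \<alpha>) / (1 + \<alpha>)\<close> and \<open>u m = \<rho> * (1 - \<alpha> ^ (2 * m))\<close>. This one formula yields
  all claims about the rung process. First, a process with such a product formula is a renewal
  process (\<open>renewal_if_product_formula\<close>). Second, the products are the principal minors of the matrix
  with entries \<open>\<rho> * \<alpha> ^ \<bar>l - k\<bar>\<close>, by elimination of the last row (\<open>principal_minor_geometric\<close>). Third,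
  the renewal equation determines the distribution of the next renewal from \<open>u\<close>
  (\<open>first_renewal_recurrence\<close>, \<open>next_renewal_distribution\<close>). The Fourier coefficients of the symbol
  satisfy, away from the index 0, the recurrence with characteristic roots \<open>\<alpha>\<close> and \<open>1 / \<alpha>\<close>; being
  bounded, they are the entries of this matrix (\<open>fourier_coeff_ladder_symbol\<close>). Independent thinning
  multiplies the probability of finding all points of \<open>S\<close> by \<open>p ^ card S\<close>, which on the determinantal
  side is multiplication of the matrix by \<open>p\<close>.

  For the converse, let a determinantal renewal process have density \<open>\<rho> > 0\<close> and matrix \<open>A\<close>. Comparing
  the renewal product formula with the minors of order two and three gives
  \<open>\<rho> * A i k = A i j * A j k\<close> for \<open>i < j < k\<close>, so that \<open>\<bar>A i k\<bar> = \<rho> * \<alpha> ^ (k - i)\<close> for some \<open>\<alpha> \<ge> 0\<close>, and the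
  renewal probabilities are \<open>\<rho> * (1 - \<alpha> ^ (2 * m))\<close>, as for the thinned rung process. The case
  \<open>\<alpha> \<ge> 1\<close> is impossible: for \<open>\<alpha> > 1\<close> the renewal probabilities would be negative, and for \<open>\<alpha> = 1\<close> the
  process would have infinitely many almost surely disjoint events of equal positive probability.
  The remaining constraint \<open>\<rho> \<le> (1 - \<alpha>) / (1 + \<alpha>)\<close>, which says that the process is a thinning with
  \<open>p \<le> 1\<close>, follows since first renewal probabilities are nonnegative and their recurrence would
  otherwise have no positive characteristic root (\<open>determinantal_renewal_parameters\<close>). Since events of
  the form \<open>\<forall>s\<in>S. X s\<close> are a generating \<open>\<pi>\<close>-system, equal inclusion probabilities mean equal laws
  (\<open>process_law_eqI\<close>).\<close>

section \<open>Spanning trees and ladder extensions\<close>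

definition graph_adj :: "'v set \<Rightarrow> 'v edge set \<Rightarrow> ('v \<times> 'v) set" where
  "graph_adj V F = {(x, y). x \<in> V \<and> y \<in> V \<and> {x, y} \<in> F}"

lemma graph_adj_iff [simp]: "(x, y) \<in> graph_adj V F \<longleftrightarrow> x \<in> V \<and> y \<in> V \<and> {x, y} \<in> F"
  by (simp add: graph_adj_def)

lemma connected_graph_iff:
  "connected_graph V F \<longleftrightarrow> (\<forall>u\<in>V. \<forall>v\<in>V. (u, v) \<in> (graph_adj V F)\<^sup>*)"
  by (simp add: connected_graph_def graph_adj_def)

lemma graph_adj_sym: "(x, y) \<in> (graph_adj V F)\<^sup>* \<Longrightarrow> (y, x) \<in> (graph_adj V F)\<^sup>*"
  by (rule symD[OF sym_rtrancl]) (auto simp: sym_def insert_commute)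

text \<open>A walk of minimal length repeats no vertex, because the part between two visits could be cut
  out.\<close>

lemma shortest_path:
  assumes "(x, y) \<in> R\<^sup>*"
  obtains f n where "f 0 = x" "f n = y" "\<And>i. i < n \<Longrightarrow> (f i, f (Suc i)) \<in> R" "inj_on f {..n::nat}"
proof -
  have ex: "\<exists>n. (x, y) \<in> R ^^ n" using assms by (rule rtrancl_imp_relpow)
  define n where "n = (LEAST n. (x, y) \<in> R ^^ n)"
  have n: "(x, y) \<in> R ^^ n" unfolding n_def using ex by (rule LeastI_ex)
  have least: "n \<le> m" if "(x, y) \<in> R ^^ m" for m unfolding n_def using that by (rule Least_le)
  obtain f where f: "f 0 = x" "f n = y" "\<forall>i<n. (f i, f (Suc i)) \<in> R"
    using n unfolding relpow_fun_conv by blast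
  have neq: "f i \<noteq> f j" if ij: "i < j" "j \<le> n" for i j
  proof
    assume eq: "f i = f j"
    have "(x, f i) \<in> R ^^ i" unfolding relpow_fun_conv using f ij by (intro exI[of _ f]) auto
    moreover have "(f i, y) \<in> R ^^ (n - j)" unfolding relpow_fun_conv using f ij eq
      by (intro exI[of _ "\<lambda>k. f (j + k)"]) auto
    ultimately have "(x, y) \<in> R ^^ (i + (n - j))" by (auto simp: relpow_add)
    from least[OF this] ij show False by simp
  qed
  have "inj_on f {..n}"
    using neq by (auto simp: inj_on_def) (metis linorder_neqE_nat)
  with f that show thesis by blast
qed

text \<open>Acyclicity is replaced by minimality, since connectivity behaves well under local changes
  of the graph: a connected graph has a cycle iff some edge can be dropped, because the rest of
  the cycle bypasses that edge and, conversely, a shortest bypass closes up to a cycle.\<close>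

lemma acyclic_iff_minimally_connected:
  assumes edges: "\<And>e. e \<in> F \<Longrightarrow> \<exists>x\<in>V. \<exists>y\<in>V. x \<noteq> y \<and> e = {x, y}"
    and conn: "connected_graph V F"
  shows "(\<nexists>vs. graph_cycle F vs) \<longleftrightarrow> (\<forall>e\<in>F. \<not> connected_graph V (F - {e}))"
proof
  assume acyc: "\<nexists>vs. graph_cycle F vs"
  show "\<forall>e\<in>F. \<not> connected_graph V (F - {e})"
  proof (intro ballI notI)
    fix e assume e: "e \<in> F" and c: "connected_graph V (F - {e})"
    obtain x y where xy: "x \<in> V" "y \<in> V" "x \<noteq> y" "e = {x, y}" using edges[OF e] by blast
    have "(x, y) \<in> (graph_adj V (F - {e}))\<^sup>*" using c xy unfolding connected_graph_iff by blast
    then obtain f n where f: "f 0 = x" "f n = y"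
        "\<And>i. i < n \<Longrightarrow> (f i, f (Suc i)) \<in> graph_adj V (F - {e})" "inj_on f {..n::nat}"
      by (rule shortest_path) blast
    have "n \<noteq> 0" using f(1,2) xy(3) by (intro notI) simp
    moreover have "n \<noteq> 1" using f(1,2) f(3)[of 0] xy by auto
    ultimately have n: "2 \<le> n" by simp
    have edge: "{f i, f (Suc i mod Suc n)} \<in> F" if "i < Suc n" for i
    proof (cases "i = n")
      case True
      then show ?thesis using f e xy by (simp add: insert_commute)
    next
      case False
      then show ?thesis using f(3)[of i] that by simp
    qed
    have "graph_cycle F (map f [0..<Suc n])"
      unfolding graph_cycle_def
    proof (intro conjI allI impI)
      show "distinct (map f [0..<Suc n])"
        using f(4) by (simp add: distinct_map atLeast0LessThan lessThan_Suc_atMost del: upt_Suc)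
    next
      fix i assume "i < length (map f [0..<Suc n])"
      then have "i < Suc n" by simp
      moreover have "Suc i mod Suc n < Suc n" by simp
      ultimately show "{map f [0..<Suc n] ! i, map f [0..<Suc n] ! (Suc i mod length (map f [0..<Suc n]))} \<in> F"
        using edge[of i] by (simp del: upt_Suc)
    qed (use n in simp)
    with acyc show False by blast
  qed
next
  assume min: "\<forall>e\<in>F. \<not> connected_graph V (F - {e})"
  show "\<nexists>vs. graph_cycle F vs"
  proof
    assume "\<exists>vs. graph_cycle F vs"
    then obtain vs where vs: "3 \<le> length vs" "distinct vs"
      "\<And>i. i < length vs \<Longrightarrow> {vs ! i, vs ! (Suc i mod length vs)} \<in> F"
      unfolding graph_cycle_def by blast
    define n where "n = length vs - 1"
    have len: "length vs = Suc n" "2 \<le> n" using vs(1) by (auto simp: n_def)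
    define e where "e = {vs ! n, vs ! 0}"
    have e: "e \<in> F" using vs(3)[of n] len by (simp add: e_def)
    have in_V: "vs ! i \<in> V" if "i \<le> n" for i
    proof -
      have "{vs ! i, vs ! (Suc i mod length vs)} \<in> F" using vs(3)[of i] that len by simp
      from edges[OF this] show ?thesis by (auto simp: doubleton_eq_iff)
    qed
    have bypass: "(vs ! 0, vs ! i) \<in> (graph_adj V (F - {e}))\<^sup>*" if "i \<le> n" for i
      using that
    proof (induction i)
      case (Suc i)
      have "{vs ! i, vs ! Suc i} \<in> F" using vs(3)[of i] Suc.prems len by simp
      moreover have "{vs ! i, vs ! Suc i} \<noteq> e"
        using vs(2) Suc.prems len by (auto simp: e_def doubleton_eq_iff nth_eq_iff_index_eq)
      ultimately have "(vs ! i, vs ! Suc i) \<in> graph_adj V (F - {e})"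
        using in_V Suc.prems by simp
      with Suc show ?case by (meson Suc_leD rtrancl.rtrancl_into_rtrancl)
    qed simp
    have "connected_graph V (F - {e})"
      unfolding connected_graph_iff
    proof (intro ballI)
      fix u v assume "u \<in> V" "v \<in> V"
      then have "(u, v) \<in> (graph_adj V F)\<^sup>*" using conn unfolding connected_graph_iff by blast
      then show "(u, v) \<in> (graph_adj V (F - {e}))\<^sup>*"
      proof induction
        case (step y z)
        have "(y, z) \<in> (graph_adj V (F - {e}))\<^sup>*"
        proof (cases "{y, z} = e")
          case True
          then show ?thesis using bypass[of n] graph_adj_sym[OF bypass[of n]]
            by (auto simp: e_def doubleton_eq_iff)
        next
          case False
          then show ?thesis using step(2) by auto
        qed
        with step show ?case by simp
      qed simp
    qed
    with min e show False by blast
  qed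
qed

lemma spanning_trees_eq_minimally_connected:
  assumes "\<And>e. e \<in> E \<Longrightarrow> \<exists>x\<in>V. \<exists>y\<in>V. x \<noteq> y \<and> e = {x, y}"
  shows "spanning_trees V E =
    {F. F \<subseteq> E \<and> connected_graph V F \<and> (\<forall>e\<in>F. \<not> connected_graph V (F - {e}))}"
proof -
  have "(\<nexists>vs. graph_cycle F vs) \<longleftrightarrow> (\<forall>e\<in>F. \<not> connected_graph V (F - {e}))"
    if "F \<subseteq> E" "connected_graph V F" for F
    using that assms by (intro acyclic_iff_minimally_connected) auto
  then show ?thesis unfolding spanning_trees_def by auto
qed

text \<open>The map \<open>\<phi>\<close> retracts the larger graph onto the smaller one. It sends walks to walks, and
  every new vertex is joined to its image, so connectivity passes in both directions.\<close>

lemma connected_graph_extension_iff: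
  assumes sub: "V \<subseteq> V'"
    and H: "\<And>x y. x \<in> V \<Longrightarrow> y \<in> V \<Longrightarrow> {x, y} \<in> H \<Longrightarrow> (x, y) \<in> (graph_adj V' F')\<^sup>*"
    and reach: "\<And>w. w \<in> V' \<Longrightarrow> (\<phi> w, w) \<in> (graph_adj V' F')\<^sup>*"
    and \<phi>: "\<And>w. w \<in> V' \<Longrightarrow> \<phi> w \<in> V" "\<And>w. w \<in> V \<Longrightarrow> \<phi> w = w"
    and retract: "\<And>x y. x \<in> V' \<Longrightarrow> y \<in> V' \<Longrightarrow> {x, y} \<in> F' \<Longrightarrow> (\<phi> x, \<phi> y) \<in> (graph_adj V H)\<^sup>*"
  shows "connected_graph V' F' \<longleftrightarrow> connected_graph V H"
proof
  assume c: "connected_graph V' F'"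
  have *: "(\<phi> u, \<phi> v) \<in> (graph_adj V H)\<^sup>*" if "(u, v) \<in> (graph_adj V' F')\<^sup>*" for u v
    using that
  proof induction
    case (step y z)
    then show ?case using retract[of y z] by (auto intro: rtrancl_trans)
  qed simp
  show "connected_graph V H"
    unfolding connected_graph_iff
  proof (intro ballI)
    fix u v assume "u \<in> V" "v \<in> V"
    then show "(u, v) \<in> (graph_adj V H)\<^sup>*"
      using *[of u v] c sub \<phi>(2) unfolding connected_graph_iff by (auto simp: subset_iff)
  qed
next
  assume c: "connected_graph V H"
  have *: "(u, v) \<in> (graph_adj V' F')\<^sup>*" if "(u, v) \<in> (graph_adj V H)\<^sup>*" for u v
    using that
  proof induction
    case (step y z)
    then show ?case using H[of y z] by auto
  qed simp
  show "connected_graph V' F'"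
    unfolding connected_graph_iff
  proof (intro ballI)
    fix u v assume uv: "u \<in> V'" "v \<in> V'"
    have "(\<phi> u, \<phi> v) \<in> (graph_adj V' F')\<^sup>*"
      using * c uv \<phi>(1) unfolding connected_graph_iff by blast
    with reach[OF uv(1)] reach[OF uv(2)] show "(u, v) \<in> (graph_adj V' F')\<^sup>*"
      by (meson graph_adj_sym rtrancl_trans)
  qed
qed

lemma not_connected_graph_if_cut:
  assumes "w \<in> V" "w \<in> K" "x \<in> V" "x \<notin> K"
    and "\<And>y z. y \<in> K \<Longrightarrow> z \<in> V \<Longrightarrow> {y, z} \<in> F \<Longrightarrow> z \<in> K"
  shows "\<not> connected_graph V F"
proof
  assume "connected_graph V F"
  then have "(w, x) \<in> (graph_adj V F)\<^sup>*" using assms unfolding connected_graph_iff by blast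
  then have "x \<in> K"
    by induction (use assms in auto)
  with assms show False by blast
qed

lemma subset_three_cases:
  assumes "G \<subseteq> {a, b, c}"
  shows "(G \<subseteq> {a} \<or> G \<subseteq> {b} \<or> G \<subseteq> {c}) \<or>
    G = {a, b} \<or> G = {a, c} \<or> G = {b, c} \<or> G = {a, b, c}"
  using assms by (cases "a \<in> G"; cases "b \<in> G"; cases "c \<in> G") auto

lemma doubleton_minus_member: "e \<in> {a, b} \<Longrightarrow> {a, b} - {e} \<subseteq> {a} \<or> {a, b} - {e} \<subseteq> {b}"
  by auto

text \<open>A ladder grows by a square that is glued along its last rung \<open>{p, q}\<close>. The new vertices are
  \<open>u\<close> and \<open>v\<close>, joined to \<open>p\<close> and \<open>q\<close> respectively.\<close>

locale square_extension =
  fixes V :: "'v set" and E :: "'v edge set" and p q u v :: 'v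
  assumes edges: "\<And>e. e \<in> E \<Longrightarrow> \<exists>x\<in>V. \<exists>y\<in>V. x \<noteq> y \<and> e = {x, y}"
    and pq: "p \<in> V" "q \<in> V" "p \<noteq> q" "{p, q} \<in> E"
    and uv: "u \<notin> V" "v \<notin> V" "u \<noteq> v"
begin

abbreviation "V' \<equiv> insert u (insert v V)"
abbreviation "E' \<equiv> E \<union> {{p, u}, {q, v}, {u, v}}"

lemma new_edges: "{p, u} \<notin> E" "{q, v} \<notin> E" "{u, v} \<notin> E"
  "{p, u} \<noteq> {q, v}" "{p, u} \<noteq> {u, v}" "{q, v} \<noteq> {u, v}"
  using edges[of "{p, u}"] edges[of "{q, v}"] edges[of "{u, v}"] pq uv
  by (auto simp: doubleton_eq_iff)

lemma old_edge: "F \<subseteq> E \<Longrightarrow> {x, y} \<in> F \<Longrightarrow> x \<in> V \<and> y \<in> V"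
  using edges[of "{x, y}"] by (auto simp: doubleton_eq_iff)

lemma adj_stepI: "{x, y} \<in> F \<Longrightarrow> x \<in> W \<Longrightarrow> y \<in> W \<Longrightarrow> (x, y) \<in> (graph_adj W F)\<^sup>*"
  by (rule r_into_rtrancl) simp

lemma connected_rails:
  assumes "F \<subseteq> E"
  shows "connected_graph V' (F \<union> {{p, u}, {q, v}}) \<longleftrightarrow> connected_graph V F"
proof (rule connected_graph_extension_iff[where \<phi> = "\<lambda>w. if w = u then p else if w = v then q else w"])
  fix x y assume "x \<in> V'" "y \<in> V'" "{x, y} \<in> F \<union> {{p, u}, {q, v}}"
  then show "(if x = u then p else if x = v then q else x, if y = u then p else if y = v then q else y)
      \<in> (graph_adj V F)\<^sup>*"
    using old_edge[OF assms, of x y] pq uv by (auto simp: doubleton_eq_iff intro!: adj_stepI)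
qed (use pq uv in \<open>auto intro!: adj_stepI\<close>)

lemma connected_rail_rung:
  assumes "F \<subseteq> E"
  shows "connected_graph V' (F \<union> {{p, u}, {u, v}}) \<longleftrightarrow> connected_graph V F"
proof (rule connected_graph_extension_iff[where \<phi> = "\<lambda>w. if w = u \<or> w = v then p else w"])
  fix x y assume "x \<in> V'" "y \<in> V'" "{x, y} \<in> F \<union> {{p, u}, {u, v}}"
  then show "(if x = u \<or> x = v then p else x, if y = u \<or> y = v then p else y)
      \<in> (graph_adj V F)\<^sup>*"
    using old_edge[OF assms, of x y] pq uv by (auto simp: doubleton_eq_iff intro!: adj_stepI)
next
  fix w assume "w \<in> V'"
  moreover have "(p, u) \<in> (graph_adj V' (F \<union> {{p, u}, {u, v}}))\<^sup>*"
    "(u, v) \<in> (graph_adj V' (F \<union> {{p, u}, {u, v}}))\<^sup>*"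
    using pq by (auto intro!: adj_stepI)
  ultimately show "(if w = u \<or> w = v then p else w, w) \<in> (graph_adj V' (F \<union> {{p, u}, {u, v}}))\<^sup>*"
    by (auto intro: rtrancl_trans)
qed (use pq uv in \<open>auto intro!: adj_stepI\<close>)

lemma connected_square:
  assumes "F \<subseteq> E"
  shows "connected_graph V' (F \<union> {{p, u}, {q, v}, {u, v}}) \<longleftrightarrow> connected_graph V (insert {p, q} F)"
proof (rule connected_graph_extension_iff[where \<phi> = "\<lambda>w. if w = u then p else if w = v then q else w"])
  let ?F = "F \<union> {{p, u}, {q, v}, {u, v}}"
  fix x y assume xy: "x \<in> V" "y \<in> V" "{x, y} \<in> insert {p, q} F"
  have "(p, u) \<in> (graph_adj V' ?F)\<^sup>*" "(u, v) \<in> (graph_adj V' ?F)\<^sup>*" "(q, v) \<in> (graph_adj V' ?F)\<^sup>*"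
    using pq by (auto intro!: adj_stepI)
  then have "(p, q) \<in> (graph_adj V' ?F)\<^sup>*" by (meson graph_adj_sym rtrancl_trans)
  moreover have "(q, p) \<in> (graph_adj V' ?F)\<^sup>*" by (rule graph_adj_sym) fact
  ultimately show "(x, y) \<in> (graph_adj V' ?F)\<^sup>*"
    using xy by (auto simp: doubleton_eq_iff intro!: adj_stepI)
next
  fix x y assume "x \<in> V'" "y \<in> V'" "{x, y} \<in> F \<union> {{p, u}, {q, v}, {u, v}}"
  then show "(if x = u then p else if x = v then q else x, if y = u then p else if y = v then q else y)
      \<in> (graph_adj V (insert {p, q} F))\<^sup>*"
    using old_edge[OF assms, of x y] pq uv
    by (auto simp: doubleton_eq_iff insert_commute intro!: adj_stepI)
qed (use pq uv in \<open>auto intro!: adj_stepI\<close>)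

text \<open>A single new edge leaves \<open>u\<close>, \<open>v\<close> or the pair \<open>{u, v}\<close> cut off from the rest.\<close>

lemma not_connected_one_new_edge:
  assumes "F \<subseteq> E" "G \<subseteq> {{p, u}} \<or> G \<subseteq> {{q, v}} \<or> G \<subseteq> {{u, v}}"
  shows "\<not> connected_graph V' (F \<union> G)"
proof -
  consider "G \<subseteq> {{p, u}}" | "G \<subseteq> {{q, v}}" | "G \<subseteq> {{u, v}}" using assms(2) by blast
  then show ?thesis
  proof cases
    case 1
    then show ?thesis using pq uv old_edge[OF assms(1)]
      by (intro not_connected_graph_if_cut[of v _ "{v}" p]) (auto simp: doubleton_eq_iff)
  next
    case 2
    then show ?thesis using pq uv old_edge[OF assms(1)]
      by (intro not_connected_graph_if_cut[of u _ "{u}" p]) (auto simp: doubleton_eq_iff)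
  next
    case 3
    then show ?thesis using pq uv old_edge[OF assms(1)]
      by (intro not_connected_graph_if_cut[of u _ "{u, v}" p]) (auto simp: doubleton_eq_iff)
  qed
qed

lemma extension_edges: "e \<in> E' \<Longrightarrow> \<exists>x\<in>V'. \<exists>y\<in>V'. x \<noteq> y \<and> e = {x, y}"
proof -
  assume "e \<in> E'"
  then consider "e \<in> E" | "e = {p, u}" | "e = {q, v}" | "e = {u, v}" by blast
  then show ?thesis
  proof cases
    case 1
    then obtain x y where "x \<in> V" "y \<in> V" "x \<noteq> y" "e = {x, y}" using edges by blast
    then show ?thesis by - (rule bexI[of _ x], rule bexI[of _ y], auto)
  next
    case 2
    then show ?thesis using pq uv by - (rule bexI[of _ p], rule bexI[of _ u], auto)
  next
    case 3
    then show ?thesis using pq uv by - (rule bexI[of _ q], rule bexI[of _ v], auto)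
  next
    case 4
    then show ?thesis using uv by - (rule bexI[of _ u], rule bexI[of _ v], auto)
  qed
qed

abbreviation min_connected :: "'w set \<Rightarrow> 'w edge set \<Rightarrow> bool" where
  "min_connected W F \<equiv> connected_graph W F \<and> (\<forall>e\<in>F. \<not> connected_graph W (F - {e}))"

text \<open>The new edges \<open>G\<close> do not affect which old vertices are connected, and none of them can be
  spared; so minimality is a condition on the old edges only.\<close>

lemma min_connected_attach:
  assumes F: "F \<subseteq> E" and G: "G \<inter> E = {}"
    and conn: "\<And>F. F \<subseteq> E \<Longrightarrow> connected_graph V' (F \<union> G) \<longleftrightarrow> connected_graph V F"
    and needed: "\<And>e. e \<in> G \<Longrightarrow> \<not> connected_graph V' (F \<union> (G - {e}))"
  shows "min_connected V' (F \<union> G) \<longleftrightarrow> min_connected V F"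
proof -
  have old: "connected_graph V' (F \<union> G - {e}) \<longleftrightarrow> connected_graph V (F - {e})" if "e \<in> F" for e
  proof -
    have eq: "F \<union> G - {e} = (F - {e}) \<union> G" using that F G by blast
    show ?thesis unfolding eq by (rule conn) (use F in blast)
  qed
  have new: "\<not> connected_graph V' (F \<union> G - {e})" if "e \<in> G" for e
  proof -
    have eq: "F \<union> G - {e} = F \<union> (G - {e})" using that F G by blast
    show ?thesis unfolding eq by (rule needed[OF that])
  qed
  have "(\<forall>e\<in>F \<union> G. \<not> connected_graph V' (F \<union> G - {e})) \<longleftrightarrow> (\<forall>e\<in>F. \<not> connected_graph V (F - {e}))"
    using old new by blast
  then show ?thesis unfolding conn[OF F] by (rule arg_cong)
qed

lemma min_connected_rails:
  assumes "F \<subseteq> E"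
  shows "min_connected V' (F \<union> {{p, u}, {q, v}}) \<longleftrightarrow> min_connected V F"
proof (rule min_connected_attach[OF assms _ connected_rails])
  show "{{p, u}, {q, v}} \<inter> E = {}" using new_edges by simp
  fix e assume "e \<in> {{p, u}, {q, v}}"
  then show "\<not> connected_graph V' (F \<union> ({{p, u}, {q, v}} - {e}))"
    by (intro not_connected_one_new_edge[OF assms]) (meson doubleton_minus_member)
qed

lemma min_connected_rail_rung:
  assumes "F \<subseteq> E"
  shows "min_connected V' (F \<union> {{p, u}, {u, v}}) \<longleftrightarrow> min_connected V F"
proof (rule min_connected_attach[OF assms _ connected_rail_rung])
  show "{{p, u}, {u, v}} \<inter> E = {}" using new_edges by simp
  fix e assume "e \<in> {{p, u}, {u, v}}"
  then show "\<not> connected_graph V' (F \<union> ({{p, u}, {u, v}} - {e}))"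
    by (intro not_connected_one_new_edge[OF assms]) (meson doubleton_minus_member)
qed

lemma square_extension_swap: "square_extension V E q p v u"
  using edges pq uv by unfold_locales (auto simp: insert_commute)

lemma connected_other_rail_rung:
  assumes "F \<subseteq> E"
  shows "connected_graph V' (F \<union> {{q, v}, {u, v}}) \<longleftrightarrow> connected_graph V F"
  using square_extension.connected_rail_rung[OF square_extension_swap assms]
  by (simp add: insert_commute)

lemma min_connected_other_rail_rung:
  assumes "F \<subseteq> E"
  shows "min_connected V' (F \<union> {{q, v}, {u, v}}) \<longleftrightarrow> min_connected V F"
  using square_extension.min_connected_rail_rung[OF square_extension_swap assms]
  by (simp add: insert_commute)

text \<open>Replacing an edge by a path of length three changes neither connectivity nor minimality.
  If \<open>{p, q}\<close> is already present, the path closes up to a cycle.\<close>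

lemma min_connected_square:
  assumes "F \<subseteq> E"
  shows "min_connected V' (F \<union> {{p, u}, {q, v}, {u, v}}) \<longleftrightarrow>
    {p, q} \<notin> F \<and> min_connected V (insert {p, q} F)"
proof -
  let ?S = "{{p, u}, {q, v}, {u, v}}"
  have *: "connected_graph V' (F \<union> ?S - {e}) \<longleftrightarrow> connected_graph V (insert {p, q} (F - {e}))" if "e \<in> F" for e
  proof -
    have "F \<union> ?S - {e} = (F - {e}) \<union> ?S" using that new_edges assms by auto
    then show ?thesis using connected_square[of "F - {e}"] assms by auto
  qed
  have del: "F \<union> ?S - {{p, u}} = F \<union> {{q, v}, {u, v}}" "F \<union> ?S - {{q, v}} = F \<union> {{p, u}, {u, v}}"
    "F \<union> ?S - {{u, v}} = F \<union> {{p, u}, {q, v}}"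
    using new_edges assms by auto
  have "connected_graph V' (F \<union> ?S - {{p, u}}) \<longleftrightarrow> connected_graph V F"
    "connected_graph V' (F \<union> ?S - {{q, v}}) \<longleftrightarrow> connected_graph V F"
    "connected_graph V' (F \<union> ?S - {{u, v}}) \<longleftrightarrow> connected_graph V F"
    unfolding del by (intro connected_rail_rung[OF assms] connected_rails[OF assms]
      connected_other_rail_rung[OF assms])+
  then have S: "connected_graph V' (F \<union> ?S - {e}) \<longleftrightarrow> connected_graph V F" if "e \<in> ?S" for e
    using that by (elim insertE emptyE) simp_all
  have all: "(\<forall>e\<in>F \<union> ?S. \<not> connected_graph V' (F \<union> ?S - {e})) \<longleftrightarrow>
      \<not> connected_graph V F \<and> (\<forall>e\<in>F. \<not> connected_graph V (insert {p, q} (F - {e})))"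
    using * S by blast
  show ?thesis
  proof (cases "{p, q} \<in> F")
    case True
    then show ?thesis using all connected_square[OF assms] by (simp add: insert_absorb)
  next
    case False
    then have "insert {p, q} F - {e} = insert {p, q} (F - {e})" if "e \<in> F" for e using that by auto
    moreover have "insert {p, q} F - {{p, q}} = F" using False by auto
    ultimately have "(\<forall>e\<in>insert {p, q} F. \<not> connected_graph V (insert {p, q} F - {e})) \<longleftrightarrow>
        \<not> connected_graph V F \<and> (\<forall>e\<in>F. \<not> connected_graph V (insert {p, q} (F - {e})))"
      by simp
    then show ?thesis using all connected_square[OF assms] False by simp
  qed
qed

text \<open>A spanning tree contains at least two of the three new edges. If it contains exactly two, they
  are attached to a spanning tree of the old graph. If it contains all three, they form a path that
  replaces the edge \<open>{p, q}\<close>, so that these trees correspond to the old trees through \<open>{p, q}\<close>.\<close>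

theorem spanning_trees_extension:
  "spanning_trees V' E' =
     (\<lambda>F. F \<union> {{p, u}, {q, v}}) ` spanning_trees V E \<union>
     (\<lambda>F. F \<union> {{p, u}, {u, v}}) ` spanning_trees V E \<union>
     (\<lambda>F. F \<union> {{q, v}, {u, v}}) ` spanning_trees V E \<union>
     (\<lambda>F. (F - {{p, q}}) \<union> {{p, u}, {q, v}, {u, v}}) ` {F \<in> spanning_trees V E. {p, q} \<in> F}"
  (is "?L = ?R")
proof -
  have T: "spanning_trees V E = {F. F \<subseteq> E \<and> min_connected V F}"
    using edges by (rule spanning_trees_eq_minimally_connected)
  have T': "spanning_trees V' E' = {F. F \<subseteq> E' \<and> min_connected V' F}"
    using extension_edges by (rule spanning_trees_eq_minimally_connected)
  show ?thesis
  proof (rule equalityI, rule_tac [2] Un_least[OF Un_least[OF Un_least]], rule subsetI, rule_tac [2-] image_subsetI)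
    fix F' assume F': "F' \<in> ?L"
    define F where "F = F' \<inter> E"
    define G where "G = F' \<inter> {{p, u}, {q, v}, {u, v}}"
    have FG: "F \<subseteq> E" "F' = F \<union> G" "min_connected V' (F \<union> G)"
      using F' unfolding T' F_def G_def by (auto simp: Int_Un_distrib[symmetric] Int_absorb2)
    have "G \<subseteq> {{p, u}, {q, v}, {u, v}}" by (simp add: G_def)
    then consider "G \<subseteq> {{p, u}} \<or> G \<subseteq> {{q, v}} \<or> G \<subseteq> {{u, v}}" | "G = {{p, u}, {q, v}}"
      | "G = {{p, u}, {u, v}}" | "G = {{q, v}, {u, v}}" | "G = {{p, u}, {q, v}, {u, v}}"
      using subset_three_cases[of G "{p, u}" "{q, v}" "{u, v}"] by meson
    then show "F' \<in> ?R"
    proof cases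
      case 1
      then have "\<not> connected_graph V' (F \<union> G)" by (rule not_connected_one_new_edge[OF FG(1)])
      with FG(3) show ?thesis by simp
    next
      case 2
      have "min_connected V F" using FG(3)[unfolded 2] by (rule min_connected_rails[OF FG(1), THEN iffD1])
      then have "F \<in> spanning_trees V E" using FG(1) T by simp
      then show ?thesis unfolding FG(2) 2 by blast
    next
      case 3
      have "min_connected V F" using FG(3)[unfolded 3] by (rule min_connected_rail_rung[OF FG(1), THEN iffD1])
      then have "F \<in> spanning_trees V E" using FG(1) T by simp
      then show ?thesis unfolding FG(2) 3 by blast
    next
      case 4
      have "min_connected V F" using FG(3)[unfolded 4] by (rule min_connected_other_rail_rung[OF FG(1), THEN iffD1])
      then have "F \<in> spanning_trees V E" using FG(1) T by simp
      then show ?thesis unfolding FG(2) 4 by blast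
    next
      case 5
      note sq = min_connected_square[OF FG(1), THEN iffD1, OF FG(3)[unfolded 5]]
      have "{p, q} \<notin> F" by (rule conjunct1[OF sq])
      moreover have "min_connected V (insert {p, q} F)" by (rule conjunct2[OF sq])
      ultimately have tree: "insert {p, q} F \<in> {F \<in> spanning_trees V E. {p, q} \<in> F}"
        and "insert {p, q} F - {{p, q}} = F"
        using FG(1) pq(4) T by auto
      then have "F' = (insert {p, q} F - {{p, q}}) \<union> {{p, u}, {q, v}, {u, v}}"
        unfolding FG(2) 5 by simp
      then show ?thesis using tree by (intro UnI2 image_eqI)
    qed
  next
    fix F assume "F \<in> spanning_trees V E"
    then have F: "F \<subseteq> E" "min_connected V F" using T by auto
    have "min_connected V' (F \<union> {{p, u}, {q, v}})"
      by (rule min_connected_rails[OF F(1), THEN iffD2]) (use F(2) in simp)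
    moreover have "F \<union> {{p, u}, {q, v}} \<subseteq> E'" using F(1) by auto
    ultimately show "F \<union> {{p, u}, {q, v}} \<in> ?L" unfolding T' by (intro CollectI conjI[of "_ \<subseteq> _"])
  next
    fix F assume "F \<in> spanning_trees V E"
    then have F: "F \<subseteq> E" "min_connected V F" using T by auto
    have "min_connected V' (F \<union> {{p, u}, {u, v}})"
      by (rule min_connected_rail_rung[OF F(1), THEN iffD2]) (use F(2) in simp)
    moreover have "F \<union> {{p, u}, {u, v}} \<subseteq> E'" using F(1) by auto
    ultimately show "F \<union> {{p, u}, {u, v}} \<in> ?L" unfolding T' by (intro CollectI conjI[of "_ \<subseteq> _"])
  next
    fix F assume "F \<in> spanning_trees V E"
    then have F: "F \<subseteq> E" "min_connected V F" using T by auto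
    have "min_connected V' (F \<union> {{q, v}, {u, v}})"
      by (rule min_connected_other_rail_rung[OF F(1), THEN iffD2]) (use F(2) in simp)
    moreover have "F \<union> {{q, v}, {u, v}} \<subseteq> E'" using F(1) by auto
    ultimately show "F \<union> {{q, v}, {u, v}} \<in> ?L" unfolding T' by (intro CollectI conjI[of "_ \<subseteq> _"])
  next
    fix F assume "F \<in> {F \<in> spanning_trees V E. {p, q} \<in> F}"
    then have F: "F - {{p, q}} \<subseteq> E" "min_connected V (insert {p, q} (F - {{p, q}}))"
      using T by (auto simp: insert_absorb)
    have "min_connected V' ((F - {{p, q}}) \<union> {{p, u}, {q, v}, {u, v}})"
      by (rule min_connected_square[OF F(1), THEN iffD2]) (use F(2) in simp)
    moreover have "(F - {{p, q}}) \<union> {{p, u}, {q, v}, {u, v}} \<subseteq> E'" using F(1) by auto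
    ultimately show "(F - {{p, q}}) \<union> {{p, u}, {q, v}, {u, v}} \<in> ?L" unfolding T' by (intro CollectI conjI[of "_ \<subseteq> _"])
  qed
qed

end

section \<open>Spanning trees of finite ladders\<close>

abbreviation ladder_trees :: "int \<Rightarrow> int \<Rightarrow> ladder_vertex edge set set" where
  "ladder_trees a b \<equiv> spanning_trees (ladder_vertices_between a b) (ladder_edges_between a b)"

lemma rung_inj [simp]: "rung m = rung n \<longleftrightarrow> m = n"
  by (auto simp: rung_def doubleton_eq_iff)

lemma rail_inj [simp]: "rail i m = rail j n \<longleftrightarrow> i = j \<and> m = n"
  by (auto simp: rail_def doubleton_eq_iff)

lemma rung_neq_rail [simp]: "rung m \<noteq> rail i n" "rail i n \<noteq> rung m"
  by (auto simp: rung_def rail_def doubleton_eq_iff)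

lemma mem_ladder_edges:
  "e \<in> ladder_edges \<longleftrightarrow> (\<exists>m. e = rung m \<or> e = rail 0 m \<or> e = rail 1 m)"
  by (auto simp: ladder_edges_def)

lemma mem_ladder_edges_between:
  "e \<in> ladder_edges_between a b \<longleftrightarrow>
     (\<exists>m. a \<le> m \<and> m \<le> b \<and> (e = rung m \<or> a < m \<and> (e = rail 0 m \<or> e = rail 1 m)))"
proof -
  have rung: "rung m \<subseteq> ladder_vertices_between a b \<longleftrightarrow> a \<le> m \<and> m \<le> b" for m
    by (auto simp: rung_def ladder_vertices_between_def)
  have rail: "rail i m \<subseteq> ladder_vertices_between a b \<longleftrightarrow> a < m \<and> m \<le> b" if "i \<in> {0, 1}" for i m
    using that by (auto simp: rail_def ladder_vertices_between_def)
  have "e \<in> ladder_edges_between a b \<longleftrightarrow> (\<exists>m. (e = rung m \<or> e = rail 0 m \<or> e = rail 1 m) \<and>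
      e \<subseteq> ladder_vertices_between a b)"
    unfolding ladder_edges_between_def mem_Collect_eq mem_ladder_edges by blast
  also have "\<dots> \<longleftrightarrow> (\<exists>m. a \<le> m \<and> m \<le> b \<and> (e = rung m \<or> a < m \<and> (e = rail 0 m \<or> e = rail 1 m)))"
    using rung rail[of 0] rail[of 1] by (intro ex_cong1) (metis insertCI order_less_imp_le)
  finally show ?thesis .
qed

lemma rung_in_between [simp]: "rung m \<in> ladder_edges_between a b \<longleftrightarrow> a \<le> m \<and> m \<le> b"
  by (auto simp: mem_ladder_edges_between)

lemma rail_in_between [simp]:
  "i \<in> {0, 1} \<Longrightarrow> rail i m \<in> ladder_edges_between a b \<longleftrightarrow> a < m \<and> m \<le> b"
  by (auto simp: mem_ladder_edges_between)

lemma ladder_edges_between_extend: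
  assumes "a \<le> b"
  shows "ladder_edges_between a (b + 1) =
     ladder_edges_between a b \<union> {rail 0 (b + 1), rail 1 (b + 1), rung (b + 1)}"
proof (intro equalityI subsetI)
  fix e
  assume "e \<in> ladder_edges_between a (b + 1)"
  then obtain m where m: "a \<le> m" "m \<le> b + 1" "e = rung m \<or> a < m \<and> (e = rail 0 m \<or> e = rail 1 m)"
    unfolding mem_ladder_edges_between by blast
  show "e \<in> ladder_edges_between a b \<union> {rail 0 (b + 1), rail 1 (b + 1), rung (b + 1)}"
  proof (cases "m = b + 1")
    case True
    then show ?thesis using m by auto
  next
    case False
    then have "m \<le> b" using m by simp
    then show ?thesis using m unfolding Un_iff mem_ladder_edges_between by blast
  qed
next
  fix e
  assume "e \<in> ladder_edges_between a b \<union> {rail 0 (b + 1), rail 1 (b + 1), rung (b + 1)}"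
  then consider "e \<in> ladder_edges_between a b" | "e = rail 0 (b + 1)" | "e = rail 1 (b + 1)" | "e = rung (b + 1)"
    by blast
  then show "e \<in> ladder_edges_between a (b + 1)"
  proof cases
    case 1
    then obtain m where "a \<le> m" "m \<le> b" "e = rung m \<or> a < m \<and> (e = rail 0 m \<or> e = rail 1 m)"
      unfolding mem_ladder_edges_between by blast
    then show ?thesis unfolding mem_ladder_edges_between by (intro exI[of _ m]) simp
  qed (use assms in simp_all)
qed

lemma ladder_vertices_between_extend:
  "a \<le> b \<Longrightarrow> ladder_vertices_between a (b + 1) =
     insert (0, b + 1) (insert (1, b + 1) (ladder_vertices_between a b))"
  by (auto simp: ladder_vertices_between_def)

lemma finite_ladder_edges_between: "finite (ladder_edges_between a b)"
proof (rule finite_subset)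
  show "ladder_edges_between a b \<subseteq> rung ` {a..b} \<union> rail 0 ` {a..b} \<union> rail 1 ` {a..b}"
    by (auto simp: mem_ladder_edges_between)
qed simp

lemma finite_ladder_trees: "finite (ladder_trees a b)"
  by (rule finite_subset[of _ "Pow (ladder_edges_between a b)"])
    (auto simp: spanning_trees_def finite_ladder_edges_between)

lemma ladder_trees_subset: "F \<in> ladder_trees a b \<Longrightarrow> F \<subseteq> ladder_edges_between a b"
  by (simp add: spanning_trees_def)

lemma ladder_edge_between_doubleton:
  assumes "e \<in> ladder_edges_between a b"
  shows "\<exists>x\<in>ladder_vertices_between a b. \<exists>y\<in>ladder_vertices_between a b. x \<noteq> y \<and> e = {x, y}"
proof -
  obtain m where "a \<le> m" "m \<le> b" "e = rung m \<or> a < m \<and> (e = rail 0 m \<or> e = rail 1 m)"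
    using assms unfolding mem_ladder_edges_between by blast
  then consider "e = rung m" | i where "i \<in> {0, 1}" "a < m" "e = rail i m" by blast
  then show ?thesis
  proof cases
    case 1
    then show ?thesis using \<open>a \<le> m\<close> \<open>m \<le> b\<close>
      by - (rule bexI[of _ "(0, m)"], rule bexI[of _ "(1, m)"], auto simp: rung_def ladder_vertices_between_def)
  next
    case 2
    then show ?thesis using \<open>m \<le> b\<close>
      by - (rule bexI[of _ "(i, m - 1)"], rule bexI[of _ "(i, m)"], auto simp: rail_def ladder_vertices_between_def)
  qed
qed

lemma square_extension_ladder:
  assumes "a \<le> b"
  shows "square_extension (ladder_vertices_between a b) (ladder_edges_between a b)
    (0, b) (1, b) (0, b + 1) (1, b + 1)"
proof
  show "{(0, b), (1, b)} \<in> ladder_edges_between a b"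
    using rung_in_between[of b a b] assms by (simp add: rung_def)
qed (fact ladder_edge_between_doubleton, use assms in \<open>simp_all add: ladder_vertices_between_def\<close>)

lemma ladder_trees_single: "ladder_trees a a = {{rung a}}"
proof -
  have E: "ladder_edges_between a a = {rung a}"
    by (auto simp: mem_ladder_edges_between)
  have V: "ladder_vertices_between a a = {(0, a), (1, a)}"
    by (auto simp: ladder_vertices_between_def)
  have nc: "\<not> connected_graph (ladder_vertices_between a a) {}"
    by (rule not_connected_graph_if_cut[of "(0, a)" _ "{(0, a)}" "(1, a)"]) (auto simp: V)
  have c: "connected_graph (ladder_vertices_between a a) {rung a}"
  proof -
    let ?R = "(graph_adj (ladder_vertices_between a a) {rung a})\<^sup>*"
    have "((0, a), (1, a)) \<in> ?R" by (rule r_into_rtrancl) (simp add: V rung_def)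
    moreover from this have "((1, a), (0, a)) \<in> ?R" by (rule graph_adj_sym)
    ultimately show ?thesis unfolding connected_graph_iff by (auto simp: V)
  qed
  have eq: "ladder_trees a a = {F. F \<subseteq> {rung a} \<and> connected_graph (ladder_vertices_between a a) F \<and>
      (\<forall>e\<in>F. \<not> connected_graph (ladder_vertices_between a a) (F - {e}))}"
    unfolding E[symmetric]
    by (rule spanning_trees_eq_minimally_connected) (rule ladder_edge_between_doubleton)
  have "F \<in> ladder_trees a a \<longleftrightarrow> F = {rung a}" for F
    unfolding eq mem_Collect_eq subset_singleton_iff using nc c by auto
  then show ?thesis by blast
qed

text \<open>The four kinds of trees are told apart by their edges in the last column, so the sum over all
  trees splits accordingly.\<close>

lemma sum_ladder_trees_extend:
  fixes \<psi> :: "ladder_vertex edge set \<Rightarrow> real"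
  assumes "a \<le> b"
  defines "r0 \<equiv> rail 0 (b + 1)" and "r1 \<equiv> rail 1 (b + 1)" and "z \<equiv> rung (b + 1)"
  shows "(\<Sum>F\<in>ladder_trees a (b + 1). \<psi> F) =
    (\<Sum>F\<in>ladder_trees a b. \<psi> (F \<union> {r0, r1}) + \<psi> (F \<union> {r0, z}) + \<psi> (F \<union> {r1, z})) +
    (\<Sum>F | F \<in> ladder_trees a b \<and> rung b \<in> F. \<psi> ((F - {rung b}) \<union> {r0, r1, z}))"
proof -
  interpret square_extension "ladder_vertices_between a b" "ladder_edges_between a b"
    "(0, b)" "(1, b)" "(0, b + 1)" "(1, b + 1)"
    using assms(1) by (rule square_extension_ladder)
  define N where "N = {r0, r1, z}"
  define T where "T = ladder_trees a b"
  define Tr where "Tr = {F \<in> T. rung b \<in> F}"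
  define A1 where "A1 = (\<lambda>F. F \<union> {r0, r1}) ` T"
  define A2 where "A2 = (\<lambda>F. F \<union> {r0, z}) ` T"
  define A3 where "A3 = (\<lambda>F. F \<union> {r1, z}) ` T"
  define A4 where "A4 = (\<lambda>F. (F - {rung b}) \<union> {r0, r1, z}) ` Tr"
  have new: "r0 \<notin> F" "r1 \<notin> F" "z \<notin> F" if "F \<in> T" for F
    using ladder_trees_subset[OF that[unfolded T_def]] by (auto simp: r0_def r1_def z_def dest!: subsetD)
  have dist: "r0 \<noteq> r1" "r0 \<noteq> z" "r1 \<noteq> z" by (auto simp: r0_def r1_def z_def)
  have rungb: "rung b \<notin> N" by (auto simp: N_def r0_def r1_def z_def)
  have eq: "ladder_trees a (b + 1) = A1 \<union> A2 \<union> A3 \<union> A4"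
    using spanning_trees_extension ladder_edges_between_extend[OF assms(1)]
      ladder_vertices_between_extend[OF assms(1)]
    by (simp add: A1_def A2_def A3_def A4_def Tr_def T_def r0_def r1_def z_def rail_def rung_def)
  have inter: "F \<inter> N = {r0, r1}" if "F \<in> A1" for F using that new by (auto simp: A1_def N_def)
  have inter2: "F \<inter> N = {r0, z}" if "F \<in> A2" for F using that new by (auto simp: A2_def N_def)
  have inter3: "F \<inter> N = {r1, z}" if "F \<in> A3" for F using that new by (auto simp: A3_def N_def)
  have inter4: "F \<inter> N = {r0, r1, z}" if "F \<in> A4" for F using that new by (auto simp: A4_def N_def)
  have "{r0, r1} \<noteq> {r0, z}" "{r0, r1} \<noteq> {r1, z}" "{r0, z} \<noteq> {r1, z}"
    "{r0, r1, z} \<noteq> {r0, r1}" "{r0, r1, z} \<noteq> {r0, z}" "{r0, r1, z} \<noteq> {r1, z}"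
    using dist by (simp_all add: set_eq_iff) metis+
  with inter inter2 inter3 inter4
  have disj: "A1 \<inter> A2 = {}" "(A1 \<union> A2) \<inter> A3 = {}" "(A1 \<union> A2 \<union> A3) \<inter> A4 = {}"
    unfolding disjoint_iff Un_iff by metis+
  have fin: "finite T" "finite Tr" by (auto simp: T_def Tr_def finite_ladder_trees)
  have inj: "inj_on (\<lambda>F. F \<union> G) T" if "G \<subseteq> N" for G
    by (rule inj_on_inverseI[of _ "\<lambda>F. F - N"]) (use that new in \<open>auto simp: N_def\<close>)
  have inj4: "inj_on (\<lambda>F. (F - {rung b}) \<union> {r0, r1, z}) Tr"
    by (rule inj_on_inverseI[of _ "\<lambda>F. insert (rung b) (F - N)"]) (use new rungb in \<open>auto simp: N_def Tr_def\<close>)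
  have "sum \<psi> (ladder_trees a (b + 1)) = sum \<psi> A1 + sum \<psi> A2 + sum \<psi> A3 + sum \<psi> A4"
    unfolding eq using disj fin
    by (subst sum.union_disjoint; (simp add: A1_def A2_def A3_def A4_def)?)+
  also have "sum \<psi> A1 = (\<Sum>F\<in>T. \<psi> (F \<union> {r0, r1}))"
    unfolding A1_def by (subst sum.reindex[OF inj]) (auto simp: N_def)
  also have "sum \<psi> A2 = (\<Sum>F\<in>T. \<psi> (F \<union> {r0, z}))"
    unfolding A2_def by (subst sum.reindex[OF inj]) (auto simp: N_def)
  also have "sum \<psi> A3 = (\<Sum>F\<in>T. \<psi> (F \<union> {r1, z}))"
    unfolding A3_def by (subst sum.reindex[OF inj]) (auto simp: N_def)
  also have "sum \<psi> A4 = (\<Sum>F\<in>Tr. \<psi> ((F - {rung b}) \<union> {r0, r1, z}))"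
    unfolding A4_def by (subst sum.reindex[OF inj4]) auto
  finally show ?thesis unfolding T_def Tr_def by (simp add: sum.distrib)
qed

section \<open>Transfer matrix\<close>

type_synonym column_weight = "int \<Rightarrow> bool \<Rightarrow> bool \<Rightarrow> bool \<Rightarrow> real"

text \<open>A column weight \<open>\<phi> m\<close> is a function of three truth values, which say whether the two rails that
  end in column \<open>m\<close> and the rung of column \<open>m\<close> are present.\<close>

definition columns_weight :: "column_weight \<Rightarrow> int \<Rightarrow> int \<Rightarrow> ladder_vertex edge set \<Rightarrow> real" where
  "columns_weight \<phi> a b F = (\<Prod>m\<in>{a..b}. \<phi> m (rail 0 m \<in> F) (rail 1 m \<in> F) (rung m \<in> F))"

text \<open>The spanning trees that contain the last rung, with that rung removed, are exactly the spanning
  forests with two components that separate the two vertices of the last column. Trees and such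
  forests are the two states of a transfer matrix: they are all that can still be completed to a
  spanning tree further to the right.\<close>

definition tree_sums :: "column_weight \<Rightarrow> int \<Rightarrow> int \<Rightarrow> real \<times> real" where
  "tree_sums \<phi> a b =
    (\<Sum>F\<in>ladder_trees a b. columns_weight \<phi> a b F,
     \<Sum>F | F \<in> ladder_trees a b \<and> rung b \<in> F. columns_weight \<phi> a b (F - {rung b}))"

text \<open>This is multiplication of a row vector by the transfer matrix of one column. A tree is extended
  by two of the three new edges or, if it is turned into a forest, by a single rail; a forest needs
  both rails, and becomes a tree with the rung.\<close>

definition column_step :: "(bool \<Rightarrow> bool \<Rightarrow> bool \<Rightarrow> real) \<Rightarrow> real \<times> real \<Rightarrow> real \<times> real" where
  "column_step w v =
    (fst v * (w True True False + w True False True + w False True True) + snd v * w True True True,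
     fst v * (w True False False + w False True False) + snd v * w True True False)"

lemma columns_weight_extend:
  assumes "a \<le> b" "F \<subseteq> ladder_edges_between a b" "G \<subseteq> {rail 0 (b + 1), rail 1 (b + 1), rung (b + 1)}"
  shows "columns_weight \<phi> a (b + 1) (F \<union> G) =
    columns_weight \<phi> a b F * \<phi> (b + 1) (rail 0 (b + 1) \<in> G) (rail 1 (b + 1) \<in> G) (rung (b + 1) \<in> G)"
proof -
  have "{a..b + 1} = insert (b + 1) {a..b}" using assms(1) by auto
  then have "columns_weight \<phi> a (b + 1) (F \<union> G) =
      \<phi> (b + 1) (rail 0 (b + 1) \<in> F \<union> G) (rail 1 (b + 1) \<in> F \<union> G) (rung (b + 1) \<in> F \<union> G) *
      columns_weight \<phi> a b (F \<union> G)"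
    unfolding columns_weight_def by simp
  moreover have "columns_weight \<phi> a b (F \<union> G) = columns_weight \<phi> a b F"
    unfolding columns_weight_def
  proof (rule prod.cong[OF refl])
    fix m assume m: "m \<in> {a..b}"
    then have "rail 0 m \<notin> G" "rail 1 m \<notin> G" "rung m \<notin> G" using assms(3) by (auto dest!: subsetD)
    then show "\<phi> m (rail 0 m \<in> F \<union> G) (rail 1 m \<in> F \<union> G) (rung m \<in> F \<union> G) =
      \<phi> m (rail 0 m \<in> F) (rail 1 m \<in> F) (rung m \<in> F)" by simp
  qed
  moreover have "rail 0 (b + 1) \<notin> F" "rail 1 (b + 1) \<notin> F" "rung (b + 1) \<notin> F"
    using assms(2) by (auto dest!: subsetD)
  ultimately show ?thesis by simp
qed

lemma tree_sums_single: "tree_sums \<phi> a a = (\<phi> a False False True, \<phi> a False False False)"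
proof -
  have "{F. F = {rung a} \<and> rung a \<in> F} = {{rung a}}" by auto
  then show ?thesis
    by (simp add: tree_sums_def ladder_trees_single columns_weight_def)
qed

text \<open>The second component is the same sum over trees as the first, taken over those that contain the
  new rung, whose own contribution is left out.\<close>

lemma tree_sums_extend:
  assumes "a \<le> b"
  shows "tree_sums \<phi> a (b + 1) = column_step (\<phi> (b + 1)) (tree_sums \<phi> a b)"
proof -
  define r0 r1 z where "r0 = rail 0 (b + 1)" and "r1 = rail 1 (b + 1)" and "z = rung (b + 1)"
  have dist: "r0 \<noteq> r1" "r0 \<noteq> z" "r1 \<noteq> z" by (auto simp: r0_def r1_def z_def)
  let ?T = "ladder_trees a b"
  let ?w = "columns_weight \<phi> a b"
  let ?w' = "columns_weight \<phi> a (b + 1)"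
  let ?\<phi> = "\<phi> (b + 1)"
  have z: "z \<notin> F" if "F \<in> ?T" for F
    using ladder_trees_subset[OF that] by (auto simp: z_def)
  have ext: "?w' (F \<union> G) = ?w F * ?\<phi> (r0 \<in> G) (r1 \<in> G) (z \<in> G)"
    if "F \<in> ?T" "G \<subseteq> {r0, r1, z}" for F G
    using columns_weight_extend[OF assms ladder_trees_subset[OF that(1)], of G] that(2)
    by (simp add: r0_def r1_def z_def)
  have ext': "?w' (F - {rung b} \<union> G) = ?w (F - {rung b}) * ?\<phi> (r0 \<in> G) (r1 \<in> G) (z \<in> G)"
    if "F \<in> ?T" "G \<subseteq> {r0, r1, z}" for F G
    using columns_weight_extend[OF assms, of "F - {rung b}" G] ladder_trees_subset[OF that(1)] that(2)
    by (auto simp: r0_def r1_def z_def)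
  have fst: "sum ?w' (ladder_trees a (b + 1)) = fst (column_step ?\<phi> (tree_sums \<phi> a b))"
    unfolding sum_ladder_trees_extend[OF assms, folded r0_def r1_def z_def]
    using dist
    by (simp add: ext ext' column_step_def tree_sums_def sum_distrib_right distrib_left sum.distrib
        del: Un_insert_right)
  define \<psi> where "\<psi> F = (if z \<in> F then ?w' (F - {z}) else 0)" for F
  have del: "F \<union> {r0, z} - {z} = F \<union> {r0}" "F \<union> {r1, z} - {z} = F \<union> {r1}"
      "F - {rung b} \<union> {r0, r1, z} - {z} = F - {rung b} \<union> {r0, r1}" if "F \<in> ?T" for F
    using z[OF that] dist by auto
  have "sum \<psi> (ladder_trees a (b + 1)) = snd (column_step ?\<phi> (tree_sums \<phi> a b))"
    unfolding sum_ladder_trees_extend[OF assms, folded r0_def r1_def z_def]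
    using dist z
    by (simp add: \<psi>_def ext ext' del column_step_def tree_sums_def sum_distrib_right distrib_left sum.distrib
        del: Un_insert_right)
  moreover have "sum \<psi> (ladder_trees a (b + 1)) =
      (\<Sum>F | F \<in> ladder_trees a (b + 1) \<and> z \<in> F. ?w' (F - {z}))"
    unfolding \<psi>_def by (subst sum.inter_filter[symmetric]) (auto simp: finite_ladder_trees)
  ultimately show ?thesis using fst unfolding tree_sums_def[of \<phi> a "b + 1"] z_def[symmetric]
    by (simp add: prod_eq_iff)
qed

section \<open>Products over gaps\<close>

text \<open>For a renewal process of density \<open>\<rho>\<close> and with renewal probabilities \<open>u\<close> this is the probability
  that there are renewals at all points of \<open>S\<close>. The conversion to \<open>nat\<close> is harmless since the list
  is increasing.\<close>

definition gap_product :: "real \<Rightarrow> (nat \<Rightarrow> real) \<Rightarrow> int set \<Rightarrow> real" where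
  "gap_product \<rho> u S = (if S = {} then 1 else
     \<rho> * (\<Prod>i<card S - 1. u (nat (sorted_list_of_set S ! Suc i - sorted_list_of_set S ! i))))"

text \<open>These are the principal minors of the matrix \<open>A k l = \<rho> * \<alpha> ^ \<bar>l - k\<bar>\<close>: its minors for two points
  at distance \<open>m\<close> are \<open>\<rho>\<^sup>2 * (1 - \<alpha> ^ (2 * m))\<close>.\<close>

abbreviation geometric_gap_product :: "real \<Rightarrow> real \<Rightarrow> int set \<Rightarrow> real" where
  "geometric_gap_product \<rho> \<alpha> \<equiv> gap_product \<rho> (\<lambda>m. \<rho> * (1 - \<alpha> ^ (2 * m)))"

abbreviation rung_density :: "real \<Rightarrow> real" where
  "rung_density \<alpha> \<equiv> (1 - \<alpha>) / (1 + \<alpha>)"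

lemma gap_product_empty [simp]: "gap_product \<rho> u {} = 1"
  by (simp add: gap_product_def)

lemma gap_product_singleton [simp]: "gap_product \<rho> u {s} = \<rho>"
  by (simp add: gap_product_def)

lemma sorted_list_of_set_insert_greatest:
  fixes S :: "'a::linorder set"
  assumes "finite S" "\<And>s. s \<in> S \<Longrightarrow> s < t"
  shows "sorted_list_of_set (insert t S) = sorted_list_of_set S @ [t]"
proof -
  have "t \<notin> S" using assms(2) by blast
  then have "sorted_list_of_set (insert t S) = insort t (sorted_list_of_set S)"
    using assms(1) by simp
  also have "\<dots> = sorted_list_of_set S @ [t]"
    using assms by (intro sorted_insort_is_snoc) (auto intro: less_imp_le)
  finally show ?thesis .
qed

lemma last_sorted_list_of_set:
  fixes S :: "'a::linorder set"
  assumes "finite S" "S \<noteq> {}"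
  shows "sorted_list_of_set S ! (card S - 1) = Max S"
proof -
  have "sorted_list_of_set S = sorted_list_of_set (S - {Max S}) @ [Max S]"
    using sorted_list_of_set_insert_greatest[of "S - {Max S}" "Max S"] assms
    by (simp add: insert_absorb Max_ge order_less_le)
  moreover have "card S - 1 = length (sorted_list_of_set (S - {Max S}))"
    using assms by simp
  ultimately show ?thesis by (metis nth_append_length)
qed

lemma gap_product_insert_greatest:
  assumes "finite S" "S \<noteq> {}" "\<And>s. s \<in> S \<Longrightarrow> s < t"
  shows "gap_product \<rho> u (insert t S) = gap_product \<rho> u S * u (nat (t - Max S))"
proof -
  let ?xs = "sorted_list_of_set S"
  have t: "t \<notin> S" using assms(3) by blast
  obtain n where n: "card S = Suc n" using assms by (metis card_gt_0_iff gr0_implies_Suc)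
  have eq: "sorted_list_of_set (insert t S) = ?xs @ [t]"
    using assms(1,3) by (rule sorted_list_of_set_insert_greatest)
  have "(\<Prod>i<Suc n. u (nat ((?xs @ [t]) ! Suc i - (?xs @ [t]) ! i))) =
      (\<Prod>i<n. u (nat (?xs ! Suc i - ?xs ! i))) * u (nat (t - Max S))"
    using last_sorted_list_of_set[OF assms(1,2)] n by (simp add: nth_append)
  then show ?thesis
    using assms t n by (simp add: gap_product_def eq)
qed

section \<open>Asymptotics of the transfer matrix\<close>

text \<open>A column on which nothing is prescribed has the transfer matrix with rows \<open>(1 + 2 * c, 2)\<close> and
  \<open>(c, 1)\<close>, of determinant 1 and trace \<open>2 + 2 * c = \<alpha> + 1 / \<alpha>\<close>. Its eigenvalues are \<open>1 / \<alpha>\<close> and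
  \<open>\<alpha>\<close>, and the factor \<open>\<alpha>\<close> turns them into 1 and \<open>\<alpha>\<^sup>2\<close>.\<close>

definition scaled_step :: "real \<Rightarrow> (bool \<Rightarrow> bool \<Rightarrow> bool \<Rightarrow> real) \<Rightarrow> real \<times> real \<Rightarrow> real \<times> real" where
  "scaled_step \<alpha> w v = \<alpha> *\<^sub>R column_step w v"

definition free_column :: "real \<Rightarrow> bool \<Rightarrow> bool \<Rightarrow> bool \<Rightarrow> real" where
  "free_column c h0 h1 z = (if z then c else 1)"

text \<open>The right eigenvectors of the free transfer matrix, for the eigenvalues \<open>1 / \<alpha>\<close> and \<open>\<alpha>\<close>, act on
  row vectors as linear functionals. Together they determine a vector.\<close>

definition dominant_functional :: "real \<Rightarrow> real \<times> real \<Rightarrow> real" where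
  "dominant_functional \<alpha> v = 2 * fst v + (1 - \<alpha>) * snd v"

definition recessive_functional :: "real \<Rightarrow> real \<times> real \<Rightarrow> real" where
  "recessive_functional \<alpha> v = 2 * fst v + (1 - 1 / \<alpha>) * snd v"

text \<open>The left eigenvector for the eigenvalue \<open>1 / \<alpha>\<close>, normalised so that the dominant functional
  takes the value 1 on it.\<close>

definition stationary_state :: "real \<Rightarrow> real \<times> real" where
  "stationary_state \<alpha> = (1 / (2 * (1 + \<alpha>)), \<alpha> / (1 - \<alpha>\<^sup>2))"

text \<open>The state after \<open>j\<close> columns of the window \<open>{-k..k}\<close>, when the ladder extends infinitely far to
  the left.\<close>

primrec window_state :: "real \<Rightarrow> column_weight \<Rightarrow> nat \<Rightarrow> nat \<Rightarrow> real \<times> real" where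
  "window_state \<alpha> \<phi> k 0 = stationary_state \<alpha>"
| "window_state \<alpha> \<phi> k (Suc j) = scaled_step \<alpha> (\<phi> (int j - int k)) (window_state \<alpha> \<phi> k j)"

lemma column_step_scaleR: "column_step w (r *\<^sub>R v) = r *\<^sub>R column_step w v"
  by (simp add: column_step_def algebra_simps)

lemma scaled_step_scaleR: "scaled_step \<alpha> w (r *\<^sub>R v) = r *\<^sub>R scaled_step \<alpha> w v"
  by (simp add: scaled_step_def column_step_scaleR)

lemma tendsto_scaled_step:
  "(f \<longlongrightarrow> v) F \<Longrightarrow> ((\<lambda>n. scaled_step \<alpha> w (f n)) \<longlongrightarrow> scaled_step \<alpha> w v) F"
  unfolding scaled_step_def column_step_def by (intro tendsto_intros)

locale ladder_parameter =
  fixes \<alpha> :: real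
  assumes \<alpha>_pos: "0 < \<alpha>" and \<alpha>_less_1: "\<alpha> < 1"
begin

abbreviation c :: real where "c \<equiv> ladder_conductance \<alpha>"

lemma c_pos: "0 < c"
  using \<alpha>_pos \<alpha>_less_1 by (simp add: ladder_conductance_def)

lemma \<alpha>_square_less_1: "\<alpha>\<^sup>2 < 1"
  using \<alpha>_pos \<alpha>_less_1 by (simp add: power_less_one_iff)

lemma free_step_fst: "fst (scaled_step \<alpha> (free_column c) v) =
    ((1 - \<alpha> + \<alpha>\<^sup>2) * fst v + (1 - \<alpha>)\<^sup>2 / 2 * snd v)"
  using \<alpha>_pos by (simp add: scaled_step_def column_step_def free_column_def ladder_conductance_def
      field_simps power2_eq_square)

lemma free_step_snd: "snd (scaled_step \<alpha> (free_column c) v) = \<alpha> * (2 * fst v + snd v)"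
  by (simp add: scaled_step_def column_step_def free_column_def algebra_simps)

lemma dominant_free_step [simp]:
  "dominant_functional \<alpha> (scaled_step \<alpha> (free_column c) v) = dominant_functional \<alpha> v"
  unfolding dominant_functional_def free_step_fst free_step_snd
  by (simp add: field_simps power2_eq_square)

lemma recessive_free_step [simp]:
  "recessive_functional \<alpha> (scaled_step \<alpha> (free_column c) v) = \<alpha>\<^sup>2 * recessive_functional \<alpha> v"
  unfolding recessive_functional_def free_step_fst free_step_snd
  using \<alpha>_pos by (simp add: field_simps power2_eq_square)

lemma state_from_functionals:
  "v = ((dominant_functional \<alpha> v + \<alpha> * recessive_functional \<alpha> v) / (2 * (1 + \<alpha>)),
        \<alpha> * (dominant_functional \<alpha> v - recessive_functional \<alpha> v) / (1 - \<alpha>\<^sup>2))"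
proof -
  have nz: "2 * (1 + \<alpha>) \<noteq> 0" "1 - \<alpha>\<^sup>2 \<noteq> 0" using \<alpha>_pos \<alpha>_square_less_1 by auto
  have "dominant_functional \<alpha> v + \<alpha> * recessive_functional \<alpha> v = fst v * (2 * (1 + \<alpha>))"
    "\<alpha> * (dominant_functional \<alpha> v - recessive_functional \<alpha> v) = snd v * (1 - \<alpha>\<^sup>2)"
    using \<alpha>_pos unfolding dominant_functional_def recessive_functional_def
    by (simp_all add: field_simps power2_eq_square)
  then show ?thesis using nz by (metis nonzero_mult_div_cancel_right prod.collapse)
qed

lemma free_steps:
  "(scaled_step \<alpha> (free_column c) ^^ l) v =
     ((dominant_functional \<alpha> v + \<alpha> * (\<alpha>\<^sup>2) ^ l * recessive_functional \<alpha> v) / (2 * (1 + \<alpha>)),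
      \<alpha> * (dominant_functional \<alpha> v - (\<alpha>\<^sup>2) ^ l * recessive_functional \<alpha> v) / (1 - \<alpha>\<^sup>2))"
proof -
  have D: "dominant_functional \<alpha> ((scaled_step \<alpha> (free_column c) ^^ l) v) = dominant_functional \<alpha> v"
    by (induction l) simp_all
  have R: "recessive_functional \<alpha> ((scaled_step \<alpha> (free_column c) ^^ l) v) =
      (\<alpha>\<^sup>2) ^ l * recessive_functional \<alpha> v"
    by (induction l) simp_all
  show ?thesis
    by (rule trans[OF state_from_functionals]) (simp only: D R mult.assoc)
qed

lemma dominant_initial [simp]: "dominant_functional \<alpha> (stationary_state \<alpha>) = 1"
proof -
  have "1 + \<alpha> \<noteq> 0" "1 - \<alpha> \<noteq> 0" using \<alpha>_pos \<alpha>_less_1 by auto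
  moreover have "1 - \<alpha>\<^sup>2 = (1 - \<alpha>) * (1 + \<alpha>)" by (simp add: power2_eq_square algebra_simps)
  ultimately have "(1 - \<alpha>) * (\<alpha> / (1 - \<alpha>\<^sup>2)) = \<alpha> / (1 + \<alpha>)" by simp
  moreover have "2 * (1 / (2 * (1 + \<alpha>))) = 1 / (1 + \<alpha>)"
    using \<open>1 + \<alpha> \<noteq> 0\<close> by (simp add: divide_simps)
  moreover have "1 / (1 + \<alpha>) + \<alpha> / (1 + \<alpha>) = 1"
    unfolding add_divide_distrib[symmetric] using \<open>1 + \<alpha> \<noteq> 0\<close> by simp
  ultimately show ?thesis by (simp only: stationary_state_def dominant_functional_def fst_conv snd_conv)
qed

lemma recessive_initial: "recessive_functional \<alpha> (stationary_state \<alpha>) = 0"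
proof -
  have nz: "1 + \<alpha> \<noteq> 0" "1 - \<alpha> \<noteq> 0" "2 * (1 + \<alpha>) \<noteq> 0" using \<alpha>_pos \<alpha>_less_1 by auto
  have "(1 - 1 / \<alpha>) * (\<alpha> / (1 - \<alpha>\<^sup>2)) = ((1 - 1 / \<alpha>) * \<alpha>) / ((1 - \<alpha>) * (1 + \<alpha>))"
    by (simp add: power2_eq_square algebra_simps)
  also have "(1 - 1 / \<alpha>) * \<alpha> = (1 - \<alpha>) * (- 1)" using \<alpha>_pos by (simp add: field_simps)
  also have "(1 - \<alpha>) * (- 1) / ((1 - \<alpha>) * (1 + \<alpha>)) = (- 1) / (1 + \<alpha>)"
    using nz by (intro mult_divide_mult_cancel_left)
  finally have eq: "(1 - 1 / \<alpha>) * (\<alpha> / (1 - \<alpha>\<^sup>2)) = (- 1) / (1 + \<alpha>)" .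
  show ?thesis
    unfolding stationary_state_def recessive_functional_def fst_conv snd_conv eq
    using nz by (simp add: divide_simps)
qed

lemma free_step_initial:
  "scaled_step \<alpha> (free_column c) (stationary_state \<alpha>) =
    stationary_state \<alpha>"
proof -
  have "scaled_step \<alpha> (free_column c) (stationary_state \<alpha>) = (1 / (2 * (1 + \<alpha>)), \<alpha> / (1 - \<alpha>\<^sup>2))"
    using free_steps[of 1 "stationary_state \<alpha>"] by (simp add: recessive_initial)
  then show ?thesis by (simp only: stationary_state_def[symmetric])
qed

lemma tendsto_square_power: "(\<lambda>n. (\<alpha>\<^sup>2) ^ n) \<longlonglongrightarrow> 0"
  using \<alpha>_square_less_1 by (intro LIMSEQ_power_zero) simp

lemma tendsto_free_steps:
  assumes "v \<longlonglongrightarrow> w" "filterlim l at_top sequentially"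
  shows "(\<lambda>n. (scaled_step \<alpha> (free_column c) ^^ l n) (v n)) \<longlonglongrightarrow>
    dominant_functional \<alpha> w *\<^sub>R stationary_state \<alpha>"
proof -
  have pow: "(\<lambda>n. (\<alpha>\<^sup>2) ^ l n) \<longlonglongrightarrow> 0"
    using filterlim_compose[OF tendsto_square_power assms(2)] .
  have D: "(\<lambda>n. dominant_functional \<alpha> (v n)) \<longlonglongrightarrow> dominant_functional \<alpha> w"
    and R: "(\<lambda>n. recessive_functional \<alpha> (v n)) \<longlonglongrightarrow> recessive_functional \<alpha> w"
    unfolding dominant_functional_def recessive_functional_def by (intro tendsto_intros assms)+
  have "(\<lambda>n. (scaled_step \<alpha> (free_column c) ^^ l n) (v n)) \<longlonglongrightarrow>
    ((dominant_functional \<alpha> w + \<alpha> * 0 * recessive_functional \<alpha> w) / (2 * (1 + \<alpha>)),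
      \<alpha> * (dominant_functional \<alpha> w - 0 * recessive_functional \<alpha> w) / (1 - \<alpha>\<^sup>2))"
    unfolding free_steps using \<alpha>_pos \<alpha>_square_less_1
    by (intro pow D R tendsto_const tendsto_Pair tendsto_divide tendsto_add tendsto_diff tendsto_mult) auto
  then show ?thesis by (simp add: stationary_state_def mult.commute)
qed

definition scaled_tree_sums :: "column_weight \<Rightarrow> int \<Rightarrow> nat \<Rightarrow> real \<times> real" where
  "scaled_tree_sums \<phi> a j = \<alpha> ^ j *\<^sub>R tree_sums \<phi> a (a + int j)"

lemma scaled_tree_sums_Suc:
  "scaled_tree_sums \<phi> a (Suc j) = scaled_step \<alpha> (\<phi> (a + int j + 1)) (scaled_tree_sums \<phi> a j)"
  using tree_sums_extend[of a "a + int j" \<phi>]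
  by (simp add: scaled_tree_sums_def scaled_step_def column_step_scaleR add.assoc add.commute[of 1])

lemma scaled_tree_sums_free:
  assumes "\<And>m. a + int j < m \<Longrightarrow> m \<le> a + int j + int l \<Longrightarrow> \<phi> m = free_column c"
  shows "scaled_tree_sums \<phi> a (j + l) = (scaled_step \<alpha> (free_column c) ^^ l) (scaled_tree_sums \<phi> a j)"
  using assms
proof (induction l)
  case (Suc l)
  have "\<phi> (a + int (j + l) + 1) = free_column c" using Suc.prems[of "a + int (j + l) + 1"] by simp
  then show ?case using Suc by (simp add: scaled_tree_sums_Suc)
qed simp

lemma dominant_scaleR: "dominant_functional \<alpha> (r *\<^sub>R v) = r * dominant_functional \<alpha> v"
  by (simp add: dominant_functional_def algebra_simps)

text \<open>The columns left of the window bring the state to a multiple of the stationary one; the columns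
  right of it keep only the dominant functional. Both limits are geometric, as the other
  eigenvalue of the scaled matrix is \<open>\<alpha>\<^sup>2\<close>.\<close>

lemma tendsto_scaled_tree_sums:
  assumes free: "\<And>m. \<bar>m\<bar> > int k \<Longrightarrow> \<phi> m = free_column c"
  shows "(\<lambda>n. \<alpha> ^ (2 * n) * fst (tree_sums \<phi> (- int n) (int n))) \<longlonglongrightarrow>
    (1 - \<alpha>) / \<alpha> * dominant_functional \<alpha> (window_state \<alpha> \<phi> k (2 * k + 1)) * fst (stationary_state \<alpha>)"
proof -
  let ?t = "\<lambda>n j. scaled_tree_sums \<phi> (- int n) j"
  \<comment> \<open>The state of a single free column is \<open>(c, 1)\<close>: the rung is the only tree, and without it the two
    vertices form the only forest. The dominant functional of \<open>(c, 1)\<close> is \<open>(1 - \<alpha>) / \<alpha>\<close>. The offset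
    \<open>k + 1\<close> makes the ladder start left of the window for every \<open>n\<close>.\<close>
  have left: "(\<lambda>n. ?t (n + (k + 1)) n) \<longlonglongrightarrow> ((1 - \<alpha>) / \<alpha>) *\<^sub>R window_state \<alpha> \<phi> k 0"
  proof -
    have "?t (n + (k + 1)) n = (scaled_step \<alpha> (free_column c) ^^ n) (c, 1)" for n
    proof -
      have "?t (n + (k + 1)) (0 + n) = (scaled_step \<alpha> (free_column c) ^^ n) (?t (n + (k + 1)) 0)"
        by (rule scaled_tree_sums_free) (rule free, simp)
      moreover have "?t (n + (k + 1)) 0 = (c, 1)"
        using free[of "- int (n + (k + 1))"]
        by (simp add: scaled_tree_sums_def tree_sums_single free_column_def)
      ultimately show ?thesis by simp
    qed
    moreover have dom: "dominant_functional \<alpha> (c, 1) = (1 - \<alpha>) / \<alpha>"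
      using \<alpha>_pos by (simp add: dominant_functional_def ladder_conductance_def field_simps power2_eq_square)
    moreover have "(\<lambda>n. (scaled_step \<alpha> (free_column c) ^^ n) (c, 1)) \<longlonglongrightarrow>
        dominant_functional \<alpha> (c, 1) *\<^sub>R stationary_state \<alpha>"
      by (rule tendsto_free_steps) (rule tendsto_const, rule filterlim_ident)
    ultimately show ?thesis by (simp only: window_state.simps)
  qed
  have window: "(\<lambda>n. ?t (n + (k + 1)) (n + i)) \<longlonglongrightarrow> ((1 - \<alpha>) / \<alpha>) *\<^sub>R window_state \<alpha> \<phi> k i" for i
  proof (induction i)
    case (Suc i)
    have "?t (n + (k + 1)) (n + Suc i) = scaled_step \<alpha> (\<phi> (int i - int k)) (?t (n + (k + 1)) (n + i))" for n
      by (simp add: scaled_tree_sums_Suc)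
    then show ?case using tendsto_scaled_step[OF Suc.IH] by (simp add: scaled_step_scaleR)
  qed (use left in simp)
  have "(\<lambda>n. ?t (n + (k + 1)) (n + (2 * k + 1) + (n + 1))) \<longlonglongrightarrow>
      dominant_functional \<alpha> (((1 - \<alpha>) / \<alpha>) *\<^sub>R window_state \<alpha> \<phi> k (2 * k + 1)) *\<^sub>R
        stationary_state \<alpha>"
  proof -
    have eq: "?t (n + (k + 1)) (n + (2 * k + 1) + (n + 1)) =
        (scaled_step \<alpha> (free_column c) ^^ (n + 1)) (?t (n + (k + 1)) (n + (2 * k + 1)))" for n
      by (rule scaled_tree_sums_free) (rule free, simp)
    show ?thesis
      unfolding eq by (rule tendsto_free_steps[OF window filterlim_add_const_nat_at_top])
  qed
  then have "(\<lambda>n. fst (?t (n + (k + 1)) (2 * (n + (k + 1))))) \<longlonglongrightarrow>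
      fst (dominant_functional \<alpha> (((1 - \<alpha>) / \<alpha>) *\<^sub>R window_state \<alpha> \<phi> k (2 * k + 1)) *\<^sub>R
        stationary_state \<alpha>)"
    by (intro tendsto_fst) (simp add: algebra_simps mult_2)
  then have "(\<lambda>n. fst (?t n (2 * n))) \<longlonglongrightarrow>
      fst (dominant_functional \<alpha> (((1 - \<alpha>) / \<alpha>) *\<^sub>R window_state \<alpha> \<phi> k (2 * k + 1)) *\<^sub>R
        stationary_state \<alpha>)"
    by (rule LIMSEQ_offset)
  then show ?thesis
    by (simp add: scaled_tree_sums_def dominant_scaleR)
qed

lemma dominant_free_window [simp]:
  "dominant_functional \<alpha> (window_state \<alpha> (\<lambda>_. free_column c) k j) = 1"
  by (induction j) (simp_all only: window_state.simps dominant_initial dominant_free_step)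

theorem tendsto_tree_sum_ratio:
  assumes "\<And>m. \<bar>m\<bar> > int k \<Longrightarrow> \<phi> m = free_column c"
  shows "(\<lambda>n. fst (tree_sums \<phi> (- int n) (int n)) /
      fst (tree_sums (\<lambda>_. free_column c) (- int n) (int n))) \<longlonglongrightarrow>
    dominant_functional \<alpha> (window_state \<alpha> \<phi> k (2 * k + 1))"
proof -
  let ?K = "(1 - \<alpha>) / \<alpha> * 1 * fst (stationary_state \<alpha>)"
  let ?L = "dominant_functional \<alpha> (window_state \<alpha> \<phi> k (2 * k + 1))"
  have "?K \<noteq> 0" using \<alpha>_pos \<alpha>_less_1 by (auto simp: stationary_state_def)
  moreover have "(\<lambda>n. \<alpha> ^ (2 * n) * fst (tree_sums (\<lambda>_. free_column c) (- int n) (int n))) \<longlonglongrightarrow> ?K"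
    using tendsto_scaled_tree_sums[of k "\<lambda>_. free_column c"] by (simp only: dominant_free_window)
  ultimately have "(\<lambda>n. (\<alpha> ^ (2 * n) * fst (tree_sums \<phi> (- int n) (int n))) /
      (\<alpha> ^ (2 * n) * fst (tree_sums (\<lambda>_. free_column c) (- int n) (int n)))) \<longlonglongrightarrow>
    ((1 - \<alpha>) / \<alpha> * ?L * fst (stationary_state \<alpha>)) / ?K"
    using tendsto_scaled_tree_sums[OF assms] by (intro tendsto_divide)
  moreover have "((1 - \<alpha>) / \<alpha> * ?L * fst (stationary_state \<alpha>)) / ?K = ?L"
    using \<open>?K \<noteq> 0\<close> by (simp add: field_simps)
  ultimately show ?thesis using \<alpha>_pos by simp
qed

section \<open>Windows in which some rungs are prescribed\<close>

definition forced_column :: "int set \<Rightarrow> column_weight" where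
  "forced_column S m h0 h1 z = (if m \<in> S \<and> \<not> z then 0 else free_column c h0 h1 z)"

lemma forced_step:
  assumes "m \<in> S"
  shows "scaled_step \<alpha> (forced_column S m) v = ((1 - \<alpha>)\<^sup>2 * (fst v + snd v / 2), 0)"
  using assms \<alpha>_pos
  by (simp add: scaled_step_def column_step_def forced_column_def free_column_def
      ladder_conductance_def field_simps)

text \<open>A forced rung maps every state to a multiple of \<open>(1, 0)\<close>: once the rung is known to be present,
  the past matters through a constant factor only. This is the renewal property at the level of
  the transfer matrix, and it is why the weights multiply over the gaps. The vector \<open>(1 / 2, 0)\<close> is
  \<open>(1, 0)\<close> normalised by the dominant functional.\<close>

lemma window_state_forced:
  fixes S :: "int set"
  assumes "finite S" "\<And>s. s \<in> S \<Longrightarrow> - int k \<le> s"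
  defines "\<rho> \<equiv> (1 - \<alpha>) / (1 + \<alpha>)"
  defines "u \<equiv> \<lambda>m. \<rho> * (1 - \<alpha> ^ (2 * m))"
  defines "S' j \<equiv> {s \<in> S. s < int j - int k}"
  shows "window_state \<alpha> (forced_column S) k j =
    (if S' j = {} then stationary_state \<alpha>
     else (gap_product \<rho> u (S' j)) *\<^sub>R
       (scaled_step \<alpha> (free_column c) ^^ nat (int j - int k - 1 - Max (S' j))) (1 / 2, 0))"
proof (induction j)
  case 0
  have "S' 0 = {}" using assms(2) by (force simp: S'_def)
  then show ?case by simp
next
  case (Suc j)
  let ?m = "int j - int k"
  have fin: "finite (S' j)" for j using assms(1) by (simp add: S'_def)
  have lt: "s < ?m" if "s \<in> S' j" for s using that by (simp add: S'_def)
  have pos: "1 + \<alpha> \<noteq> 0" "1 - \<alpha> \<noteq> 0" using \<alpha>_pos \<alpha>_less_1 by auto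
  have sq: "1 - \<alpha>\<^sup>2 = (1 - \<alpha>) * (1 + \<alpha>)" by (simp add: power2_eq_square algebra_simps)
  show ?case
  proof (cases "?m \<in> S")
    case False
    then have eq: "S' (Suc j) = S' j"
      by (auto simp: S'_def order_less_le)
    have step: "forced_column S ?m = free_column c" using False
      by (intro ext) (simp add: forced_column_def)
    show ?thesis
    proof (cases "S' j = {}")
      case True
      then show ?thesis using eq step Suc.IH by (simp add: free_step_initial)
    next
      case False
      have "Max (S' j) < ?m" using False fin lt by simp
      then have n: "nat (int (Suc j) - int k - 1 - Max (S' j)) = Suc (nat (?m - 1 - Max (S' j)))" by simp
      show ?thesis
        using False by (simp only: window_state.simps step Suc.IH eq n if_False scaled_step_scaleR
            funpow.simps o_apply)
    qed
  next
    case True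
    then have eq: "S' (Suc j) = insert ?m (S' j)" by (auto simp: S'_def)
    then have ne: "S' (Suc j) \<noteq> {}" by simp
    have max: "Max (S' (Suc j)) = ?m"
      unfolding eq using fin lt by (intro Max_eqI) (auto intro: less_imp_le)
    show ?thesis
    proof (cases "S' j = {}")
      case S': True
      have "scaled_step \<alpha> (forced_column S ?m) (stationary_state \<alpha>) = \<rho> *\<^sub>R (1 / 2, 0)"
      proof -
        have "1 / (2 * (1 + \<alpha>)) + \<alpha> / ((1 - \<alpha>) * (1 + \<alpha>)) / 2 = 1 / (2 * ((1 - \<alpha>) * (1 + \<alpha>)))"
          using pos by (simp add: divide_simps) (simp add: algebra_simps)
        then have "(1 - \<alpha>)\<^sup>2 * (fst (stationary_state \<alpha>) + snd (stationary_state \<alpha>) / 2) =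
            (1 - \<alpha>)\<^sup>2 / (2 * ((1 - \<alpha>) * (1 + \<alpha>)))"
          by (simp only: stationary_state_def fst_conv snd_conv sq times_divide_eq_right mult_1_right)
        also have "\<dots> = \<rho> / 2"
          using pos by (simp add: \<rho>_def divide_simps power2_eq_square)
        finally show ?thesis unfolding forced_step[OF True] by simp
      qed
      then show ?thesis using S' eq max Suc.IH by simp
    next
      case S': False
      have "Max (S' j) < ?m" using S' fin lt by simp
      then obtain d where d: "?m - 1 - Max (S' j) = int d"
        using zero_le_imp_eq_int[of "?m - 1 - Max (S' j)"] by auto
      then have u: "u (nat (?m - Max (S' j))) = \<rho> * (1 - \<alpha> ^ (2 * Suc d))"
      proof -
        have "nat (?m - Max (S' j)) = Suc d" using d by linarith
        then show ?thesis by (simp only: u_def)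
      qed
      have "scaled_step \<alpha> (forced_column S ?m) ((scaled_step \<alpha> (free_column c) ^^ d) (1 / 2, 0)) =
          u (nat (?m - Max (S' j))) *\<^sub>R (1 / 2, 0)"
      proof -
        define P where "P = (\<alpha>\<^sup>2) ^ d"
        have P: "\<alpha> ^ (2 * Suc d) = \<alpha>\<^sup>2 * P" by (simp only: P_def power_mult power_Suc)
        have "(1 - \<alpha>)\<^sup>2 * ((1 + \<alpha> * P) / (2 * (1 + \<alpha>)) + \<alpha> * (1 - P) / ((1 - \<alpha>) * (1 + \<alpha>)) / 2) =
            (1 - \<alpha>) / (1 + \<alpha>) * (1 - \<alpha>\<^sup>2 * P) / 2"
          using pos by (simp add: divide_simps) (simp add: algebra_simps power2_eq_square)
        then show ?thesis
          unfolding forced_step[OF True] free_steps u P sq \<rho>_def P_def[symmetric]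
          by (simp add: dominant_functional_def recessive_functional_def)
      qed
      moreover have "gap_product \<rho> u (S' (Suc j)) = gap_product \<rho> u (S' j) * u (nat (?m - Max (S' j)))"
        unfolding eq using fin S' lt by (rule gap_product_insert_greatest)
      ultimately show ?thesis
        using S' Suc.IH d max ne by (simp add: scaled_step_scaleR)
    qed
  qed
qed

theorem dominant_window_state_forced:
  assumes "finite S" "S \<subseteq> {- int k..int k}"
  shows "dominant_functional \<alpha> (window_state \<alpha> (forced_column S) k (2 * k + 1)) =
    geometric_gap_product (rung_density \<alpha>) \<alpha> S"
proof -
  have S: "{s \<in> S. s < int (2 * k + 1) - int k} = S" using assms(2) by auto
  have dom: "dominant_functional \<alpha> ((scaled_step \<alpha> (free_column c) ^^ l) v) = dominant_functional \<alpha> v" for l v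
    by (induction l) simp_all
  have "dominant_functional \<alpha> (1 / 2, 0) = 1" by (simp add: dominant_functional_def)
  then show ?thesis
    by (subst window_state_forced[OF assms(1), of k "2 * k + 1", unfolded S])
      (use assms(2) in \<open>auto simp: dominant_scaleR dom\<close>)
qed

end

section \<open>Random subsets with prescribed finite marginals\<close>

definition subset_algebra :: "'e set \<Rightarrow> 'e set measure" where
  "subset_algebra L = sigma (Pow L) ((\<lambda>e. {F \<in> Pow L. e \<in> F}) ` L)"

lemma edge_sets_algebra_eq: "edge_sets_algebra = subset_algebra ladder_edges"
  by (simp add: edge_sets_algebra_def subset_algebra_def)

lemma space_subset_algebra [simp]: "space (subset_algebra L) = Pow L"
  unfolding subset_algebra_def by (rule space_measure_of) blast

lemma sets_subset_algebra:
  "sets (subset_algebra L) = sigma_sets (Pow L) ((\<lambda>e. {F \<in> Pow L. e \<in> F}) ` L)"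
  unfolding subset_algebra_def by (rule sets_measure_of) blast

lemma mem_event_measurable:
  "e \<in> L \<Longrightarrow> (\<lambda>F. e \<in> F) \<in> measurable (subset_algebra L) (count_space UNIV)"
proof (rule pred_def[THEN iffD2])
  assume "e \<in> L"
  then have "{F \<in> Pow L. e \<in> F} \<in> sigma_sets (Pow L) ((\<lambda>e. {F \<in> Pow L. e \<in> F}) ` L)"
    by (intro sigma_sets.Basic) blast
  then show "{F \<in> space (subset_algebra L). e \<in> F} \<in> sets (subset_algebra L)"
    unfolding space_subset_algebra sets_subset_algebra .
qed

lemma cylinder_single_in_sets:
  assumes "finite D" "D \<subseteq> L" "H \<subseteq> D"
  shows "{F \<in> Pow L. F \<inter> D = H} \<in> sets (subset_algebra L)"
proof -
  have "{F \<in> space (subset_algebra L). \<forall>e\<in>D. (e \<in> F) = (e \<in> H)} \<in> sets (subset_algebra L)"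
  proof (rule sets.sets_Collect_finite_All[OF _ assms(1)])
    fix e assume "e \<in> D"
    then have [measurable]: "(\<lambda>F. e \<in> F) \<in> measurable (subset_algebra L) (count_space UNIV)"
      using assms by (intro mem_event_measurable) auto
    show "{F \<in> space (subset_algebra L). (e \<in> F) = (e \<in> H)} \<in> sets (subset_algebra L)" by measurable
  qed
  moreover have "{F \<in> space (subset_algebra L). \<forall>e\<in>D. (e \<in> F) = (e \<in> H)} = {F \<in> Pow L. F \<inter> D = H}"
    using assms(3) by auto
  ultimately show ?thesis by simp
qed

lemma cylinder_eq_Union:
  "{F \<in> Pow L. F \<inter> D \<in> B} = (\<Union>H\<in>Pow D \<inter> B. {F \<in> Pow L. F \<inter> D = H})"
  by auto

lemma cylinder_in_sets:
  assumes "finite D" "D \<subseteq> L"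
  shows "{F \<in> Pow L. F \<inter> D \<in> B} \<in> sets (subset_algebra L)"
  unfolding cylinder_eq_Union using assms by (intro sets.finite_UN cylinder_single_in_sets) simp_all

lemma measure_cylinder_eq_sum:
  assumes "prob_space P" "sets P = sets (subset_algebra L)" "finite D" "D \<subseteq> L"
  shows "measure P {F \<in> Pow L. F \<inter> D \<in> B} = (\<Sum>H\<in>Pow D \<inter> B. measure P {F \<in> Pow L. F \<inter> D = H})"
proof -
  interpret prob_space P by fact
  show ?thesis
    unfolding cylinder_eq_Union[of L D B]
  proof (rule finite_measure_finite_Union)
    show "(\<lambda>H. {F \<in> Pow L. F \<inter> D = H}) ` (Pow D \<inter> B) \<subseteq> events"
      using cylinder_single_in_sets[OF assms(3,4)] assms(2) by blast
  qed (use assms(3) in \<open>auto simp: disjoint_family_on_def\<close>)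
qed

text \<open>The cylinder events are closed under intersection and generate the \<open>\<sigma>\<close>-algebra.\<close>

lemma random_subset_measure_unique:
  assumes "prob_space P" "prob_space P'"
    and sets: "sets P = sets (subset_algebra L)" "sets P' = sets (subset_algebra L)"
    and eq: "\<And>D B. finite D \<Longrightarrow> D \<subseteq> L \<Longrightarrow>
      measure P {F \<in> Pow L. F \<inter> D \<in> B} = measure P' {F \<in> Pow L. F \<inter> D \<in> B}"
  shows "P = P'"
proof (rule measure_eqI_generator_eq)
  interpret P: prob_space P by fact
  interpret P': prob_space P' by fact
  define G where "G = {{F \<in> Pow L. F \<inter> D \<in> B} | D B. finite D \<and> D \<subseteq> L}"
  show "Int_stable G"
  proof (rule Int_stableI)
    fix X Y assume "X \<in> G" "Y \<in> G"
    then obtain D B D' B' where XY: "X = {F \<in> Pow L. F \<inter> D \<in> B}" "finite D" "D \<subseteq> L"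
      "Y = {F \<in> Pow L. F \<inter> D' \<in> B'}" "finite D'" "D' \<subseteq> L" unfolding G_def by blast
    have "F \<inter> (D \<union> D') \<inter> D = F \<inter> D" "F \<inter> (D \<union> D') \<inter> D' = F \<inter> D'" for F by auto
    then have "X \<inter> Y = {F \<in> Pow L. F \<inter> (D \<union> D') \<in> {K. K \<inter> D \<in> B \<and> K \<inter> D' \<in> B'}}"
      unfolding XY by auto
    then show "X \<inter> Y \<in> G" using XY unfolding G_def by blast
  qed
  show "G \<subseteq> Pow (Pow L)" unfolding G_def by blast
  show "emeasure P X = emeasure P' X" if "X \<in> G" for X
    using that eq unfolding G_def by (auto simp: P.emeasure_eq_measure P'.emeasure_eq_measure)
  have "sets (subset_algebra L) = sigma_sets (Pow L) G"
  proof (rule equalityI)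
    have "(\<lambda>e. {F \<in> Pow L. e \<in> F}) ` L \<subseteq> G"
    proof
      fix X assume "X \<in> (\<lambda>e. {F \<in> Pow L. e \<in> F}) ` L"
      then obtain e where e: "e \<in> L" "X = {F \<in> Pow L. e \<in> F}" by blast
      then have "X = {F \<in> Pow L. F \<inter> {e} \<in> {{e}}}" by auto
      then show "X \<in> G" unfolding G_def using e(1) by blast
    qed
    then show "sets (subset_algebra L) \<subseteq> sigma_sets (Pow L) G"
      unfolding sets_subset_algebra by (rule sigma_sets_mono')
    have "G \<subseteq> sets (subset_algebra L)"
    proof
      fix X assume "X \<in> G"
      then obtain D B where "X = {F \<in> Pow L. F \<inter> D \<in> B}" "finite D" "D \<subseteq> L" unfolding G_def by blast
      then show "X \<in> sets (subset_algebra L)" by (simp only: cylinder_in_sets)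
    qed
    then show "sigma_sets (Pow L) G \<subseteq> sets (subset_algebra L)"
      using sets.sigma_sets_subset[of G "subset_algebra L"] by simp
  qed
  with sets show "sets P = sigma_sets (Pow L) G" "sets P' = sigma_sets (Pow L) G" by simp_all
  have "Pow L = {F \<in> Pow L. F \<inter> {} \<in> UNIV} \<and> finite {} \<and> {} \<subseteq> L" by auto
  then have "Pow L \<in> G" unfolding G_def mem_Collect_eq by (intro exI)
  then show "range (\<lambda>_::nat. Pow L) \<subseteq> G" by blast
  show "emeasure P (Pow L) \<noteq> \<infinity>" for i :: nat by (simp add: P.emeasure_eq_measure)
qed simp

text \<open>Kolmogorov's extension theorem for Polish spaces, applied to the indicator functions of the random
  sets as points of a product of copies of the real line.\<close>

theorem random_subset_measure_exists:
  fixes q :: "'e set \<Rightarrow> 'e set \<Rightarrow> real"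
  assumes nonneg: "\<And>D H. finite D \<Longrightarrow> D \<subseteq> L \<Longrightarrow> H \<subseteq> D \<Longrightarrow> 0 \<le> q D H"
    and total: "\<And>D. finite D \<Longrightarrow> D \<subseteq> L \<Longrightarrow> (\<Sum>H\<in>Pow D. q D H) = 1"
    and consistent: "\<And>D J H. finite D \<Longrightarrow> D \<subseteq> L \<Longrightarrow> J \<subseteq> D \<Longrightarrow> H \<subseteq> J \<Longrightarrow>
      q J H = (\<Sum>H' | H' \<subseteq> D \<and> H' \<inter> J = H. q D H')"
  shows "\<exists>P. prob_space P \<and> sets P = sets (subset_algebra L) \<and>
    (\<forall>D H. finite D \<longrightarrow> D \<subseteq> L \<longrightarrow> H \<subseteq> D \<longrightarrow> measure P {F \<in> Pow L. F \<inter> D = H} = q D H)"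
proof -
  define Q where "Q D = embed_pmf (\<lambda>H. if H \<subseteq> D then q D H else 0)" for D
  have pmf_Q: "pmf (Q D) H = (if H \<subseteq> D then q D H else 0)" if D: "finite D" "D \<subseteq> L" for D H
    unfolding Q_def
  proof (rule pmf_embed_pmf)
    show "0 \<le> (if H \<subseteq> D then q D H else 0)" for H using nonneg D by simp
    have "(\<integral>\<^sup>+ H. ennreal (if H \<subseteq> D then q D H else 0) \<partial>count_space UNIV) =
        (\<Sum>H\<in>Pow D. ennreal (if H \<subseteq> D then q D H else 0))"
      using D by (intro nn_integral_count_space') auto
    also have "\<dots> = ennreal (\<Sum>H\<in>Pow D. if H \<subseteq> D then q D H else 0)"
      using nonneg D by (intro sum_ennreal) auto
    also have "(\<Sum>H\<in>Pow D. if H \<subseteq> D then q D H else 0) = 1"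
      using total[OF D] by (subst sum.cong[OF refl, of _ _ "q D"]) auto
    finally show "(\<integral>\<^sup>+ H. ennreal (if H \<subseteq> D then q D H else 0) \<partial>count_space UNIV) = 1" by simp
  qed
  have set_Q: "set_pmf (Q D) \<subseteq> Pow D" if "finite D" "D \<subseteq> L" for D
    using pmf_Q[OF that] by (auto simp: set_pmf_iff split: if_splits)
  have marginal: "map_pmf (\<lambda>H. H \<inter> J) (Q D) = Q J" if D: "finite D" "D \<subseteq> L" "J \<subseteq> D" for D J
  proof (rule pmf_eqI)
    fix H
    have J: "finite J" "J \<subseteq> L" using D by (auto intro: finite_subset)
    have "pmf (map_pmf (\<lambda>H. H \<inter> J) (Q D)) H = measure (Q D) ((\<lambda>H. H \<inter> J) -` {H} \<inter> set_pmf (Q D))"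
      by (simp add: pmf_map measure_Int_set_pmf)
    also have "\<dots> = measure (Q D) ({H'. H' \<subseteq> D \<and> H' \<inter> J = H} \<inter> set_pmf (Q D))"
      using set_Q[OF D(1,2)] by (intro arg_cong[where f = "measure (Q D)"]) auto
    also have "\<dots> = measure (Q D) {H'. H' \<subseteq> D \<and> H' \<inter> J = H}"
      by (rule measure_Int_set_pmf)
    also have "\<dots> = (\<Sum>H' | H' \<subseteq> D \<and> H' \<inter> J = H. pmf (Q D) H')"
      using D by (intro measure_measure_pmf_finite) (auto intro: finite_subset[of _ "Pow D"])
    also have "\<dots> = (\<Sum>H' | H' \<subseteq> D \<and> H' \<inter> J = H. q D H')"
      using pmf_Q[OF D(1,2)] by (intro sum.cong) auto
    also have "\<dots> = pmf (Q J) H"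
    proof (cases "H \<subseteq> J")
      case True
      then show ?thesis using pmf_Q[OF J] consistent[OF D(1,2,3)] by simp
    next
      case False
      then have "{H'. H' \<subseteq> D \<and> H' \<inter> J = H} = {}" by auto
      then have "(\<Sum>H' | H' \<subseteq> D \<and> H' \<inter> J = H. q D H') = 0" by (simp only: sum.empty)
      then show ?thesis using pmf_Q[OF J] False by simp
    qed
    finally show "pmf (map_pmf (\<lambda>H. H \<inter> J) (Q D)) H = pmf (Q J) H" .
  qed
  \<comment> \<open>\<open>Q D\<close> is carried over to the real-valued functions on \<open>D\<close> by \<open>ind D\<close>. The map \<open>T\<close> back from functions
    on \<open>L\<close> to subsets of \<open>L\<close> is defined for all functions, also those with other values than 0 and 1.\<close>
  define ind where "ind J H = (\<lambda>e\<in>J. indicator H e :: real)" for J H :: "'e set"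
  define PJ where "PJ J = distr (measure_pmf (Q J)) (PiM J (\<lambda>_. borel)) (ind J)" for J
  have ind_measurable: "ind J \<in> measurable (measure_pmf p) (PiM J (\<lambda>_. borel))" for J and p :: "'e set pmf"
    by (simp add: ind_def space_PiM)
  interpret projective: polish_projective L PJ
  proof (rule polish_projective.intro, rule projective_family.intro)
    fix J H :: "'e set" assume JH: "J \<subseteq> H" "finite H" "H \<subseteq> L"
    have "distr (PJ H) (PiM J (\<lambda>_. borel)) (\<lambda>f. restrict f J) =
        distr (measure_pmf (Q H)) (PiM J (\<lambda>_. borel)) ((\<lambda>f. restrict f J) \<circ> ind H)"
      unfolding PJ_def using JH by (intro distr_distr measurable_restrict_subset ind_measurable)
    also have "(\<lambda>f. restrict f J) \<circ> ind H = ind J \<circ> (\<lambda>K. K \<inter> J)"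
      using JH by (auto simp: ind_def fun_eq_iff indicator_def restrict_def)
    also have "distr (measure_pmf (Q H)) (PiM J (\<lambda>_. borel)) (ind J \<circ> (\<lambda>K. K \<inter> J)) =
        distr (distr (measure_pmf (Q H)) (count_space UNIV) (\<lambda>K. K \<inter> J)) (PiM J (\<lambda>_. borel)) (ind J)"
      by (subst distr_distr) (auto simp: ind_def space_PiM)
    also have "distr (measure_pmf (Q H)) (count_space UNIV) (\<lambda>K. K \<inter> J) = measure_pmf (Q J)"
      using marginal[OF JH(2,3,1)] by (simp add: map_pmf_rep_eq[symmetric])
    finally show "PJ J = distr (PJ H) (PiM J (\<lambda>_. borel)) (\<lambda>f. restrict f J)"
      unfolding PJ_def[of J] by (rule sym)
  next
    fix J :: "'e set" assume "finite J" "J \<subseteq> L"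
    show "prob_space (PJ J)" unfolding PJ_def
      by (intro measure_pmf.prob_space_distr ind_measurable)
  qed
  define R where "R = projective.lim"
  define T where "T f = {e \<in> L. f e = (1::real)}" for f
  define P where "P = distr R (subset_algebra L) T"
  interpret R: prob_space R unfolding R_def by (rule projective.P.prob_space_axioms)
  have sets_R: "sets R = sets (PiM L (\<lambda>_. borel))" by (simp add: R_def)
  have T: "T \<in> measurable R (subset_algebra L)"
    unfolding subset_algebra_def
  proof (rule measurable_measure_of)
    fix X assume "X \<in> (\<lambda>e. {F \<in> Pow L. e \<in> F}) ` L"
    then obtain e where e: "e \<in> L" "X = {F \<in> Pow L. e \<in> F}" by blast
    have "(\<lambda>f. f e) \<in> borel_measurable R"
      unfolding measurable_cong_sets[OF sets_R refl] using e by (intro measurable_component_singleton)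
    then have "(\<lambda>f. f e) -` {1} \<inter> space R \<in> sets R" by (rule measurable_sets) simp
    moreover have "T -` X \<inter> space R = (\<lambda>f. f e) -` {1} \<inter> space R"
      using e by (auto simp: T_def)
    ultimately show "T -` X \<inter> space R \<in> sets R" by simp
  qed (auto simp: T_def)
  show ?thesis
  proof (intro exI[of _ P] conjI allI impI)
    show "prob_space P" unfolding P_def using T by (rule R.prob_space_distr)
    show "sets P = sets (subset_algebra L)" by (simp add: P_def)
    fix D H :: "'e set" assume D: "finite D" "D \<subseteq> L" "H \<subseteq> D"
    define X where "X = {f \<in> space (PiM D (\<lambda>_. borel :: real measure)). \<forall>e\<in>D. (f e = 1) = (e \<in> H)}"
    have X: "X \<in> sets (PiM D (\<lambda>_. borel))"
      unfolding X_def using D(1) by measurable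
    have "measure P {F \<in> Pow L. F \<inter> D = H} = measure R (T -` {F \<in> Pow L. F \<inter> D = H} \<inter> space R)"
      unfolding P_def using T cylinder_single_in_sets[OF D] by (rule measure_distr)
    also have "T -` {F \<in> Pow L. F \<inter> D = H} \<inter> space R = prod_emb L (\<lambda>_. borel) D X"
    proof -
      have "space R = (\<Pi>\<^sub>E e\<in>L. UNIV)" using sets_eq_imp_space_eq[OF sets_R] by (simp add: space_PiM)
      moreover have "T f \<inter> D = H \<longleftrightarrow> (\<forall>e\<in>D. (f e = 1) = (e \<in> H))" for f
        using D by (auto simp: T_def)
      ultimately show ?thesis
        using D by (auto simp: prod_emb_def X_def space_PiM T_def)
    qed
    also have "measure R (prod_emb L (\<lambda>_. borel) D X) = measure (PJ D) X"
      unfolding R_def using D X by (intro projective.measure_lim_emb)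
    also have "\<dots> = measure (measure_pmf (Q D)) (ind D -` X \<inter> space (measure_pmf (Q D)))"
      unfolding PJ_def using ind_measurable X by (rule measure_distr)
    also have "\<dots> = measure (measure_pmf (Q D)) (ind D -` X \<inter> set_pmf (Q D))"
      by (simp add: measure_Int_set_pmf)
    also have "ind D -` X \<inter> set_pmf (Q D) = {H} \<inter> set_pmf (Q D)"
    proof -
      have "ind D K \<in> X \<longleftrightarrow> K \<inter> D = H" for K
      proof -
        have "ind D K \<in> X \<longleftrightarrow> (\<forall>e\<in>D. (e \<in> K) = (e \<in> H))"
          by (simp add: X_def ind_def space_PiM indicator_eq_1_iff)
        then show ?thesis using D(3) by auto
      qed
      then show ?thesis using set_Q[OF D(1,2)] D(3) by auto
    qed
    also have "measure (measure_pmf (Q D)) ({H} \<inter> set_pmf (Q D)) = q D H"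
      using pmf_Q[OF D(1,2)] D(3) by (simp add: measure_Int_set_pmf measure_pmf_single)
    finally show "measure P {F \<in> Pow L. F \<inter> D = H} = q D H" .
  qed
qed

section \<open>The infinite-volume limit\<close>

lemma measure_ladder_tree_measure_fin:
  assumes "0 < c"
  shows "\<P>(F in ladder_tree_measure_fin c n. Q F) =
    (\<Sum>F | F \<in> ladder_trees (- int n) (int n) \<and> Q F. tree_weight c F) /
    (\<Sum>F\<in>ladder_trees (- int n) (int n). tree_weight c F)"
proof -
  let ?T = "ladder_trees (- int n) (int n)"
  have nonneg: "0 \<le> tree_weight c F" for F
    unfolding tree_weight_def ladder_edge_weight_def using assms by (intro prod_nonneg) simp
  then have "0 \<le> tree_weight c F / (\<Sum>F'\<in>?T. tree_weight c F')" for F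
    by (intro divide_nonneg_nonneg sum_nonneg) auto
  then have "\<P>(F in ladder_tree_measure_fin c n. Q F) =
      (\<Sum>F | F \<in> ?T \<and> Q F. tree_weight c F / (\<Sum>F'\<in>?T. tree_weight c F'))"
    unfolding ladder_tree_measure_fin_def Let_def space_point_measure measure_def
    by (subst emeasure_point_measure_finite)
      (auto simp: finite_ladder_trees sum_nonneg intro!: enn2real_ennreal[THEN trans])
  then show ?thesis by (simp add: sum_divide_distrib)
qed

lemma tree_weight_eq_columns_weight:
  assumes "F \<subseteq> ladder_edges_between a b"
  shows "tree_weight c F = columns_weight (\<lambda>_. free_column c) a b F"
proof -
  have fin: "finite F" using assms finite_ladder_edges_between by (rule finite_subset)
  have "tree_weight c F = (\<Prod>e\<in>F \<inter> range rung. c)"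
    unfolding tree_weight_def ladder_edge_weight_def using fin
    by (subst prod.inter_restrict) auto
  also have "F \<inter> range rung = rung ` {m \<in> {a..b}. rung m \<in> F}"
    using assms by auto
  also have "(\<Prod>e\<in>rung ` {m \<in> {a..b}. rung m \<in> F}. c) = (\<Prod>m\<in>{m \<in> {a..b}. rung m \<in> F}. c)"
    by (subst prod.reindex) (auto simp: inj_on_def)
  also have "\<dots> = (\<Prod>m\<in>{a..b}. if rung m \<in> F then c else 1)"
    by (rule prod.inter_filter) simp
  finally show ?thesis by (simp add: columns_weight_def free_column_def)
qed

definition cylinder_column :: "real \<Rightarrow> ladder_vertex edge set \<Rightarrow> ladder_vertex edge set \<Rightarrow> column_weight" where
  "cylinder_column c D H m h0 h1 z =
    (if (rail 0 m \<in> D \<longrightarrow> h0 = (rail 0 m \<in> H)) \<and> (rail 1 m \<in> D \<longrightarrow> h1 = (rail 1 m \<in> H)) \<and>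
        (rung m \<in> D \<longrightarrow> z = (rung m \<in> H))
     then free_column c h0 h1 z else 0)"

text \<open>A column that disagrees with the prescribed edges is given the weight 0, which kills all trees
  outside the cylinder event.\<close>

lemma columns_weight_cylinder:
  assumes "F \<subseteq> ladder_edges_between a b" "D \<subseteq> ladder_edges_between a b" "H \<subseteq> D"
  shows "columns_weight (cylinder_column c D H) a b F = (if F \<inter> D = H then tree_weight c F else 0)"
proof -
  let ?agree = "\<lambda>m. (rail 0 m \<in> D \<longrightarrow> (rail 0 m \<in> F) = (rail 0 m \<in> H)) \<and>
    (rail 1 m \<in> D \<longrightarrow> (rail 1 m \<in> F) = (rail 1 m \<in> H)) \<and> (rung m \<in> D \<longrightarrow> (rung m \<in> F) = (rung m \<in> H))"
  have agree: "(\<forall>m\<in>{a..b}. ?agree m) \<longleftrightarrow> F \<inter> D = H"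
  proof
    assume *: "\<forall>m\<in>{a..b}. ?agree m"
    have "e \<in> F \<longleftrightarrow> e \<in> H" if eD: "e \<in> D" for e
    proof -
      obtain m where m: "m \<in> {a..b}" "e = rung m \<or> e = rail 0 m \<or> e = rail 1 m"
        using subsetD[OF assms(2) eD] unfolding mem_ladder_edges_between by auto
      then show ?thesis using bspec[OF * m(1)] eD by blast
    qed
    then show "F \<inter> D = H" using assms(3) by blast
  qed blast
  show ?thesis
  proof (cases "F \<inter> D = H")
    case True
    then have "columns_weight (cylinder_column c D H) a b F = columns_weight (\<lambda>_. free_column c) a b F"
      unfolding columns_weight_def cylinder_column_def using agree by (intro prod.cong) auto
    then show ?thesis using True tree_weight_eq_columns_weight[OF assms(1)] by simp
  next
    case False
    then obtain m where "m \<in> {a..b}" "\<not> ?agree m" using agree by blast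
    then have "cylinder_column c D H m (rail 0 m \<in> F) (rail 1 m \<in> F) (rung m \<in> F) = 0"
      unfolding cylinder_column_def by (intro if_not_P)
    then have "columns_weight (cylinder_column c D H) a b F = 0"
      unfolding columns_weight_def using \<open>m \<in> {a..b}\<close> by (intro prod_zero) auto
    then show ?thesis using False by simp
  qed
qed

lemma measure_fin_cylinder:
  assumes "0 < c" "D \<subseteq> ladder_edges_between (- int n) (int n)" "H \<subseteq> D"
  shows "\<P>(F in ladder_tree_measure_fin c n. F \<inter> D = H) =
    fst (tree_sums (cylinder_column c D H) (- int n) (int n)) /
    fst (tree_sums (\<lambda>_. free_column c) (- int n) (int n))"
proof -
  let ?T = "ladder_trees (- int n) (int n)"
  have "(\<Sum>F | F \<in> ?T \<and> F \<inter> D = H. tree_weight c F) = (\<Sum>F\<in>?T. if F \<inter> D = H then tree_weight c F else 0)"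
    using finite_ladder_trees by (intro sum.inter_filter)
  also have "\<dots> = fst (tree_sums (cylinder_column c D H) (- int n) (int n))"
    unfolding tree_sums_def fst_conv
    by (intro sum.cong refl columns_weight_cylinder[symmetric] ladder_trees_subset assms)
  finally have "(\<Sum>F | F \<in> ?T \<and> F \<inter> D = H. tree_weight c F) =
      fst (tree_sums (cylinder_column c D H) (- int n) (int n))" .
  moreover have "(\<Sum>F\<in>?T. tree_weight c F) = fst (tree_sums (\<lambda>_. free_column c) (- int n) (int n))"
    unfolding tree_sums_def fst_conv
    by (intro sum.cong refl tree_weight_eq_columns_weight ladder_trees_subset)
  ultimately show ?thesis using measure_ladder_tree_measure_fin[OF assms(1)] by simp
qed

lemma finite_edges_in_window:
  assumes "finite D" "D \<subseteq> ladder_edges"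
  obtains k where "\<And>m. int k < \<bar>m\<bar> \<Longrightarrow> rung m \<notin> D \<and> rail 0 m \<notin> D \<and> rail 1 m \<notin> D"
    "\<And>n. k < n \<Longrightarrow> D \<subseteq> ladder_edges_between (- int n) (int n)"
proof -
  have "\<forall>e\<in>D. \<exists>m. e = rung m \<or> e = rail 0 m \<or> e = rail 1 m"
    using assms(2) mem_ladder_edges by blast
  then obtain pos where pos: "\<And>e. e \<in> D \<Longrightarrow> e = rung (pos e) \<or> e = rail 0 (pos e) \<or> e = rail 1 (pos e)"
    by metis
  obtain k where k: "\<And>e. e \<in> D \<Longrightarrow> nat \<bar>pos e\<bar> \<le> k"
    using finite_nat_set_iff_bounded_le[of "(\<lambda>e. nat \<bar>pos e\<bar>) ` D"] assms(1) by auto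
  show thesis
  proof
    fix m assume m: "int k < \<bar>m\<bar>"
    have "pos e \<noteq> m" if "e \<in> D" for e using k[OF that] m by auto
    with pos show "rung m \<notin> D \<and> rail 0 m \<notin> D \<and> rail 1 m \<notin> D"
      by (metis rung_inj rail_inj rung_neq_rail)
  next
    fix n assume n: "k < n"
    show "D \<subseteq> ladder_edges_between (- int n) (int n)"
    proof
      fix e assume e: "e \<in> D"
      have "- int n < pos e" "pos e \<le> int n" using k[OF e] n by auto
      then show "e \<in> ladder_edges_between (- int n) (int n)"
        using pos[OF e] unfolding mem_ladder_edges_between by (intro exI[of _ "pos e"]) auto
    qed
  qed
qed

lemma is_ladder_tree_limitD:
  assumes "is_ladder_tree_limit c P"
  shows "prob_space P" "space P = Pow ladder_edges" "sets P = sets (subset_algebra ladder_edges)"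
    "\<And>D B. finite D \<Longrightarrow> D \<subseteq> ladder_edges \<Longrightarrow>
      (\<lambda>n. \<P>(F in ladder_tree_measure_fin c n. F \<inter> D \<in> B)) \<longlonglongrightarrow>
        measure P {F \<in> Pow ladder_edges. F \<inter> D \<in> B}"
proof -
  note P = assms[unfolded is_ladder_tree_limit_def edge_sets_algebra_eq space_subset_algebra]
  show "prob_space P" and space: "space P = Pow ladder_edges"
    and "sets P = sets (subset_algebra ladder_edges)"
    using P by blast+
  fix D B assume "finite D" "D \<subseteq> ladder_edges"
  then have "(\<lambda>n. \<P>(F in ladder_tree_measure_fin c n. F \<inter> D \<in> B)) \<longlonglongrightarrow> \<P>(F in P. F \<inter> D \<in> B)"
    using P by blast
  then show "(\<lambda>n. \<P>(F in ladder_tree_measure_fin c n. F \<inter> D \<in> B)) \<longlonglongrightarrow>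
      measure P {F \<in> Pow ladder_edges. F \<inter> D \<in> B}"
    unfolding space .
qed

context ladder_parameter
begin

text \<open>Both the weight of the cylinder event and the total weight are sums of products over columns,
  which differ in finitely many columns.\<close>

lemma tendsto_fin_cylinder:
  assumes "D \<subseteq> ladder_edges_between (- int k) (int k)" "H \<subseteq> D"
  shows "(\<lambda>n. \<P>(F in ladder_tree_measure_fin c n. F \<inter> D = H)) \<longlonglongrightarrow>
    dominant_functional \<alpha> (window_state \<alpha> (cylinder_column c D H) k (2 * k + 1))"
proof -
  have out: "rail 0 m \<notin> D \<and> rail 1 m \<notin> D \<and> rung m \<notin> D" if "int k < \<bar>m\<bar>" for m
    using subsetD[OF assms(1), of "rail 0 m"] subsetD[OF assms(1), of "rail 1 m"]
      subsetD[OF assms(1), of "rung m"] that by auto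
  have "cylinder_column c D H m = free_column c" if "int k < \<bar>m\<bar>" for m
    using out[OF that] by (intro ext) (simp add: cylinder_column_def)
  then have "(\<lambda>n. fst (tree_sums (cylinder_column c D H) (- int n) (int n)) /
      fst (tree_sums (\<lambda>_. free_column c) (- int n) (int n))) \<longlonglongrightarrow>
      dominant_functional \<alpha> (window_state \<alpha> (cylinder_column c D H) k (2 * k + 1))"
    by (intro tendsto_tree_sum_ratio) simp
  moreover have "\<forall>\<^sub>F n in sequentially. fst (tree_sums (cylinder_column c D H) (- int n) (int n)) /
      fst (tree_sums (\<lambda>_. free_column c) (- int n) (int n)) = \<P>(F in ladder_tree_measure_fin c n. F \<inter> D = H)"
    using eventually_ge_at_top[of k]
  proof eventually_elim
    case (elim n)
    have "ladder_edges_between (- int k) (int k) \<subseteq> ladder_edges_between (- int n) (int n)"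
      using elim by (auto simp: mem_ladder_edges_between)
    then have "D \<subseteq> ladder_edges_between (- int n) (int n)" using assms(1) by (rule order_trans[rotated])
    then show ?case by (rule measure_fin_cylinder[OF c_pos _ assms(2), symmetric])
  qed
  ultimately show ?thesis by (rule Lim_transform_eventually)
qed

lemma fin_cylinder_eq_sum:
  assumes "finite D"
  shows "\<P>(F in ladder_tree_measure_fin c n. F \<inter> D \<in> B) =
    (\<Sum>H\<in>Pow D \<inter> B. \<P>(F in ladder_tree_measure_fin c n. F \<inter> D = H))"
proof -
  let ?T = "ladder_trees (- int n) (int n)"
  have "{F. F \<in> ?T \<and> F \<inter> D \<in> B} = (\<Union>H\<in>Pow D \<inter> B. {F. F \<in> ?T \<and> F \<inter> D = H})" by auto
  then have "(\<Sum>F | F \<in> ?T \<and> F \<inter> D \<in> B. tree_weight c F) =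
      (\<Sum>H\<in>Pow D \<inter> B. \<Sum>F | F \<in> ?T \<and> F \<inter> D = H. tree_weight c F)"
    using assms by (simp only:) (subst sum.UNION_disjoint; auto simp: finite_ladder_trees)
  then show ?thesis
    unfolding measure_ladder_tree_measure_fin[OF c_pos] by (simp only: sum_divide_distrib)
qed

text \<open>The limits of the probabilities of cylinder events inherit additivity from the finite ladders,
  so they are the marginals of a random set of edges.\<close>

theorem ladder_tree_limit_exists: "\<exists>P. is_ladder_tree_limit c P"
proof -
  define q where "q D H = lim (\<lambda>n. \<P>(F in ladder_tree_measure_fin c n. F \<inter> D = H))" for D H
  have q: "(\<lambda>n. \<P>(F in ladder_tree_measure_fin c n. F \<inter> D = H)) \<longlonglongrightarrow> q D H"
    if D: "finite D" "D \<subseteq> ladder_edges" "H \<subseteq> D" for D H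
  proof -
    obtain k where "\<And>n. k < n \<Longrightarrow> D \<subseteq> ladder_edges_between (- int n) (int n)"
      using finite_edges_in_window[OF D(1,2)] by metis
    then have "D \<subseteq> ladder_edges_between (- int (Suc k)) (int (Suc k))" by blast
    from tendsto_fin_cylinder[OF this D(3)] show ?thesis
      unfolding q_def using convergentI convergent_LIMSEQ_iff by blast
  qed
  have lim: "(\<lambda>n. \<P>(F in ladder_tree_measure_fin c n. F \<inter> D \<in> B)) \<longlonglongrightarrow> (\<Sum>H\<in>Pow D \<inter> B. q D H)"
    if D: "finite D" "D \<subseteq> ladder_edges" for D B
    unfolding fin_cylinder_eq_sum[OF D(1)] using D by (intro tendsto_sum q) auto
  have total: "(\<Sum>H\<in>Pow D. q D H) = 1" if D: "finite D" "D \<subseteq> ladder_edges" for D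
  proof -
    have "(\<lambda>n. \<P>(F in ladder_tree_measure_fin c n. F \<inter> {} = {})) \<longlonglongrightarrow> 1"
    proof -
      have "cylinder_column c {} {} = (\<lambda>_. free_column c)"
        by (intro ext) (simp add: cylinder_column_def)
      then show ?thesis using tendsto_fin_cylinder[of "{}" 0 "{}"] by simp
    qed
    moreover have "(\<lambda>n. \<P>(F in ladder_tree_measure_fin c n. F \<inter> {} = {})) \<longlonglongrightarrow> (\<Sum>H\<in>Pow D. q D H)"
      using lim[OF D, of UNIV] by simp
    ultimately show ?thesis by (rule LIMSEQ_unique[symmetric])
  qed
  have consistent: "q J H = (\<Sum>H' | H' \<subseteq> D \<and> H' \<inter> J = H. q D H')"
    if D: "finite D" "D \<subseteq> ladder_edges" "J \<subseteq> D" "H \<subseteq> J" for D J H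
  proof -
    have J: "finite J" "J \<subseteq> ladder_edges" using D by (auto intro: finite_subset)
    have "Pow D \<inter> {H'. H' \<inter> J = H} = {H'. H' \<subseteq> D \<and> H' \<inter> J = H}" by auto
    moreover have "F \<inter> D \<in> {H'. H' \<inter> J = H} \<longleftrightarrow> F \<inter> J = H" for F using D(3) by auto
    ultimately have "(\<lambda>n. \<P>(F in ladder_tree_measure_fin c n. F \<inter> J = H)) \<longlonglongrightarrow>
        (\<Sum>H' | H' \<subseteq> D \<and> H' \<inter> J = H. q D H')"
      using lim[OF D(1,2), of "{H'. H' \<inter> J = H}"] by simp
    then show ?thesis by (rule LIMSEQ_unique[OF q[OF J D(4)]])
  qed
  have nonneg: "0 \<le> q D H" if "finite D" "D \<subseteq> ladder_edges" "H \<subseteq> D" for D H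
    by (rule LIMSEQ_le_const[OF q[OF that]]) simp
  obtain P where P: "prob_space P" "sets P = sets (subset_algebra ladder_edges)"
    "\<And>D H. finite D \<Longrightarrow> D \<subseteq> ladder_edges \<Longrightarrow> H \<subseteq> D \<Longrightarrow>
      measure P {F \<in> Pow ladder_edges. F \<inter> D = H} = q D H"
    using random_subset_measure_exists[of ladder_edges q, OF nonneg total consistent] by blast
  have space: "space P = Pow ladder_edges" using sets_eq_imp_space_eq[OF P(2)] by simp
  have "(\<lambda>n. \<P>(F in ladder_tree_measure_fin c n. F \<inter> D \<in> B)) \<longlonglongrightarrow> \<P>(F in P. F \<inter> D \<in> B)"
    if D: "finite D" "D \<subseteq> ladder_edges" for D B
  proof -
    have "\<P>(F in P. F \<inter> D \<in> B) = (\<Sum>H\<in>Pow D \<inter> B. q D H)"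
      unfolding space measure_cylinder_eq_sum[OF P(1,2) D] using P(3)[OF D] by (intro sum.cong) auto
    then show ?thesis using lim[OF D] by simp
  qed
  then have "is_ladder_tree_limit c P"
    unfolding is_ladder_tree_limit_def edge_sets_algebra_eq using P(1,2) space by simp
  then show ?thesis by blast
qed

lemma ladder_tree_limit_unique:
  assumes "is_ladder_tree_limit c P" "is_ladder_tree_limit c P'"
  shows "P = P'"
proof (rule random_subset_measure_unique)
  fix D B assume D: "finite D" "D \<subseteq> ladder_edges"
  show "measure P {F \<in> Pow ladder_edges. F \<inter> D \<in> B} = measure P' {F \<in> Pow ladder_edges. F \<inter> D \<in> B}"
    using is_ladder_tree_limitD(4)[OF assms(1) D] is_ladder_tree_limitD(4)[OF assms(2) D]
    by (rule LIMSEQ_unique)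
qed (use assms in \<open>simp_all add: is_ladder_tree_limitD\<close>)

theorem is_ladder_tree_limit_ladder_tree_measure:
  "is_ladder_tree_limit c (ladder_tree_measure c)"
  unfolding ladder_tree_measure_def
proof -
  obtain P where P: "is_ladder_tree_limit c P" using ladder_tree_limit_exists by blast
  then show "is_ladder_tree_limit c (THE P. is_ladder_tree_limit c P)"
    by (rule theI) (rule ladder_tree_limit_unique[OF _ P])
qed

text \<open>Prescribing that the rungs over \<open>S\<close> are present is a cylinder event, and its column weights are
  those of a window with forced rungs.\<close>

theorem measure_rungs:
  assumes "finite S"
  shows "measure (ladder_tree_measure c) {F \<in> Pow ladder_edges. \<forall>s\<in>S. rung s \<in> F} =
    geometric_gap_product (rung_density \<alpha>) \<alpha> S"
proof -
  let ?D = "rung ` S"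
  let ?P = "ladder_tree_measure c"
  have D: "finite ?D" "?D \<subseteq> ladder_edges" using assms by (auto simp: mem_ladder_edges)
  obtain k where k: "\<And>s. s \<in> S \<Longrightarrow> nat \<bar>s\<bar> \<le> k"
    using finite_nat_set_iff_bounded_le[of "(\<lambda>s. nat \<bar>s\<bar>) ` S"] assms by auto
  have S: "S \<subseteq> {- int k..int k}" using k by (fastforce dest: k)
  then have "?D \<subseteq> ladder_edges_between (- int k) (int k)" by auto
  moreover have "cylinder_column c ?D ?D = forced_column S"
    by (intro ext) (auto simp: cylinder_column_def forced_column_def)
  ultimately have "(\<lambda>n. \<P>(F in ladder_tree_measure_fin c n. F \<inter> ?D = ?D)) \<longlonglongrightarrow>
      dominant_functional \<alpha> (window_state \<alpha> (forced_column S) k (2 * k + 1))"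
    using tendsto_fin_cylinder[of ?D k ?D] by simp
  moreover have "(\<lambda>n. \<P>(F in ladder_tree_measure_fin c n. F \<inter> ?D \<in> {?D})) \<longlonglongrightarrow>
      measure ?P {F \<in> Pow ladder_edges. F \<inter> ?D \<in> {?D}}"
    by (rule is_ladder_tree_limitD(4)[OF is_ladder_tree_limit_ladder_tree_measure D])
  ultimately have "measure ?P {F \<in> Pow ladder_edges. F \<inter> ?D \<in> {?D}} =
      dominant_functional \<alpha> (window_state \<alpha> (forced_column S) k (2 * k + 1))"
    by (simp only: singleton_iff) (rule LIMSEQ_unique)
  moreover have "{F \<in> Pow ladder_edges. F \<inter> ?D \<in> {?D}} = {F \<in> Pow ladder_edges. \<forall>s\<in>S. rung s \<in> F}"
    by auto
  ultimately show ?thesis using dominant_window_state_forced[OF assms S] by simp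
qed

end

section \<open>Binary processes and their inclusion probabilities\<close>

abbreviation inclusion_prob :: "'a measure \<Rightarrow> (int \<Rightarrow> 'a \<Rightarrow> bool) \<Rightarrow> int set \<Rightarrow> real" where
  "inclusion_prob M X S \<equiv> \<P>(\<omega> in M. \<forall>s\<in>S. X s \<omega>)"

text \<open>These events form a generating \<open>\<pi>\<close>-system that mentions only the value \<open>True\<close>, which makes
  inclusion probabilities determine the law of a process.\<close>

definition inclusion_events :: "int set \<Rightarrow> (int \<Rightarrow> bool) set set" where
  "inclusion_events I = {{x \<in> I \<rightarrow>\<^sub>E UNIV. \<forall>s\<in>S. x s} | S. finite S \<and> S \<subseteq> I}"

lemma space_seq_algebra: "space (seq_algebra I) = I \<rightarrow>\<^sub>E UNIV"
  by (simp add: space_PiM)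

lemma pred_component [measurable]: "i \<in> I \<Longrightarrow> Measurable.pred (seq_algebra I) (\<lambda>x. x i)"
  by (rule measurable_component_singleton)

lemma inclusion_event_in_sets:
  assumes "finite S" "S \<subseteq> I"
  shows "{x \<in> I \<rightarrow>\<^sub>E UNIV. \<forall>s\<in>S. x s} \<in> sets (seq_algebra I)"
proof -
  have "{x \<in> space (seq_algebra I). \<forall>s\<in>S. x s} \<in> sets (seq_algebra I)"
  proof (rule sets.sets_Collect_finite_All[OF _ assms(1)])
    fix s assume "s \<in> S"
    then have "Measurable.pred (seq_algebra I) (\<lambda>x. x s)" using assms(2) by (intro pred_component) auto
    then show "{x \<in> space (seq_algebra I). x s} \<in> sets (seq_algebra I)" by (rule predE)
  qed
  then show ?thesis by (simp only: space_seq_algebra)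
qed

lemma Int_stable_inclusion_events: "Int_stable (inclusion_events I)"
proof (rule Int_stableI)
  fix X Y assume "X \<in> inclusion_events I" "Y \<in> inclusion_events I"
  then obtain S T where "X = {x \<in> I \<rightarrow>\<^sub>E UNIV. \<forall>s\<in>S. x s}" "finite S" "S \<subseteq> I"
    "Y = {x \<in> I \<rightarrow>\<^sub>E UNIV. \<forall>s\<in>T. x s}" "finite T" "T \<subseteq> I" unfolding inclusion_events_def by blast
  then have "X \<inter> Y = {x \<in> I \<rightarrow>\<^sub>E UNIV. \<forall>s\<in>S \<union> T. x s} \<and> finite (S \<union> T) \<and> S \<union> T \<subseteq> I" by auto
  then show "X \<inter> Y \<in> inclusion_events I" unfolding inclusion_events_def by blast
qed

lemma sets_seq_algebra_inclusion:
  "sets (seq_algebra I) = sigma_sets (I \<rightarrow>\<^sub>E UNIV) (inclusion_events I)"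
proof (rule equalityI)
  show "sets (seq_algebra I) \<subseteq> sigma_sets (I \<rightarrow>\<^sub>E UNIV) (inclusion_events I)"
    unfolding sets_PiM_single space_count_space
  proof (rule sigma_sets_mono, rule subsetI)
    fix X :: "(int \<Rightarrow> bool) set"
    assume "X \<in> {{f \<in> I \<rightarrow>\<^sub>E UNIV. f i \<in> A} |i A. i \<in> I \<and> A \<in> sets (count_space UNIV)}"
    then obtain i and A :: "bool set" where i: "i \<in> I" "X = {f \<in> I \<rightarrow>\<^sub>E UNIV. f i \<in> A}" by blast
    define T where "T = {f \<in> I \<rightarrow>\<^sub>E (UNIV :: bool set). f i}"
    have "T = {x \<in> I \<rightarrow>\<^sub>E UNIV. \<forall>s\<in>{i}. x s} \<and> finite {i} \<and> {i} \<subseteq> I" using i by (simp add: T_def)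
    then have "T \<in> inclusion_events I" unfolding inclusion_events_def by blast
    then have T: "T \<in> sigma_sets (I \<rightarrow>\<^sub>E UNIV) (inclusion_events I)" by (rule sigma_sets.Basic)
    have "f i \<in> A \<longleftrightarrow> (if f i then True \<in> A else False \<in> A)" for f :: "int \<Rightarrow> bool"
      by (cases "f i") simp_all
    then have X: "X = {f \<in> I \<rightarrow>\<^sub>E UNIV. if f i then True \<in> A else False \<in> A}"
      unfolding i(2) by (intro Collect_cong conj_cong refl)
    show "X \<in> sigma_sets (I \<rightarrow>\<^sub>E UNIV) (inclusion_events I)"
    proof (cases "True \<in> A")
      case True
      show ?thesis
      proof (cases "False \<in> A")
        case False
        then have "X = T" unfolding X T_def using True by (intro Collect_cong) simp
        then show ?thesis using T by simp
      qed (simp add: X True sigma_sets_top)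
    next
      case nT: False
      show ?thesis
      proof (cases "False \<in> A")
        case True
        then have "X = (I \<rightarrow>\<^sub>E UNIV) - T" unfolding X T_def using nT by (simp add: set_diff_eq) blast
        then show ?thesis using sigma_sets.Compl[OF T] by simp
      qed (simp add: X nT sigma_sets.Empty)
    qed
  qed
next
  have "inclusion_events I \<subseteq> sets (seq_algebra I)"
  proof
    fix E assume "E \<in> inclusion_events I"
    then obtain S where "E = {x \<in> I \<rightarrow>\<^sub>E UNIV. \<forall>s\<in>S. x s}" "finite S" "S \<subseteq> I"
      unfolding inclusion_events_def by blast
    then show "E \<in> sets (seq_algebra I)" by (simp only: inclusion_event_in_sets)
  qed
  then show "sigma_sets (I \<rightarrow>\<^sub>E UNIV) (inclusion_events I) \<subseteq> sets (seq_algebra I)"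
    using sets.sigma_sets_subset[of "inclusion_events I" "seq_algebra I"] by (simp only: space_seq_algebra)
qed

lemma binary_process_pred:
  "binary_process M X \<Longrightarrow> Measurable.pred M (X m)"
  by (simp add: binary_process_def)

lemma binary_process_measurable:
  "binary_process M X \<Longrightarrow> (\<lambda>\<omega>. \<lambda>m\<in>I. X m \<omega>) \<in> measurable M (seq_algebra I)"
  by (intro measurable_restrict) (simp add: binary_process_def)

lemma binary_process_measurable_UNIV:
  "binary_process M X \<Longrightarrow> (\<lambda>\<omega> m. X m \<omega>) \<in> measurable M (seq_algebra UNIV)"
  using binary_process_measurable[of M X UNIV] by (simp add: restrict_def)

lemma binary_process_shift: "binary_process M X \<Longrightarrow> binary_process M (\<lambda>m. X (m + k))"
  by (simp add: binary_process_def)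

lemma measure_process_law:
  assumes "binary_process M X" "E \<in> sets (seq_algebra UNIV)"
  shows "measure (process_law M X) E = \<P>(\<omega> in M. (\<lambda>m. X m \<omega>) \<in> E)"
  unfolding process_law_def
  by (subst measure_distr[OF binary_process_measurable_UNIV[OF assms(1)] assms(2)])
    (simp add: vimage_def Int_def conj_commute)

lemma process_law_eqI:
  assumes X: "binary_process M X" and Z: "binary_process N Z"
    and eq: "\<And>S. finite S \<Longrightarrow> inclusion_prob M X S = inclusion_prob N Z S"
  shows "process_law M X = process_law N Z"
proof (rule measure_eqI_generator_eq[OF Int_stable_inclusion_events[of UNIV]])
  interpret LX: prob_space "process_law M X"
    unfolding process_law_def using X
    by (intro prob_space.prob_space_distr binary_process_measurable_UNIV) (simp_all add: binary_process_def)
  interpret LZ: prob_space "process_law N Z"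
    unfolding process_law_def using Z
    by (intro prob_space.prob_space_distr binary_process_measurable_UNIV) (simp_all add: binary_process_def)
  show "inclusion_events UNIV \<subseteq> Pow (UNIV \<rightarrow>\<^sub>E UNIV)" unfolding inclusion_events_def by blast
  show "emeasure (process_law M X) E = emeasure (process_law N Z) E" if E: "E \<in> inclusion_events UNIV" for E
  proof -
    obtain S :: "int set" where S: "E = {x \<in> UNIV \<rightarrow>\<^sub>E UNIV. \<forall>s\<in>S. x s}" "finite S"
      using E unfolding inclusion_events_def by blast
    have sets: "E \<in> sets (seq_algebra UNIV)"
      unfolding S(1) by (rule inclusion_event_in_sets[OF S(2) subset_UNIV])
    have "measure (process_law M X) E = inclusion_prob M X S"
      by (subst measure_process_law[OF X sets]) (simp add: S(1) PiE_UNIV_domain)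
    also have "\<dots> = inclusion_prob N Z S" by (rule eq[OF S(2)])
    also have "\<dots> = measure (process_law N Z) E"
      by (subst measure_process_law[OF Z sets]) (simp add: S(1) PiE_UNIV_domain)
    finally have "measure (process_law M X) E = measure (process_law N Z) E" .
    then show ?thesis by (simp add: LX.emeasure_eq_measure LZ.emeasure_eq_measure)
  qed
  show "sets (process_law M X) = sigma_sets (UNIV \<rightarrow>\<^sub>E UNIV) (inclusion_events UNIV)"
    "sets (process_law N Z) = sigma_sets (UNIV \<rightarrow>\<^sub>E UNIV) (inclusion_events UNIV)"
    by (simp_all add: process_law_def sets_seq_algebra_inclusion)
  have "(UNIV \<rightarrow>\<^sub>E UNIV :: (int \<Rightarrow> bool) set) \<in> inclusion_events UNIV"
    unfolding inclusion_events_def by (rule CollectI, rule exI[of _ "{}"]) simp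
  then show "range (\<lambda>_::nat. UNIV \<rightarrow>\<^sub>E UNIV) \<subseteq> inclusion_events UNIV" by blast
  show "emeasure (process_law M X) (UNIV \<rightarrow>\<^sub>E UNIV) \<noteq> \<infinity>" for i :: nat
    by (simp add: LX.emeasure_eq_measure)
qed simp

section \<open>Product formulas and renewal processes\<close>

lemma gap_product_shift:
  assumes "finite S"
  shows "gap_product \<rho> u ((\<lambda>s. s + k) ` S) = gap_product \<rho> u S"
  using assms
proof (induction S rule: finite_linorder_max_induct)
  case (insert t S)
  show ?case
  proof (cases "S = {}")
    case False
    have max: "Max ((\<lambda>s. s + k) ` S) = Max S + k"
      using mono_Max_commute[of "\<lambda>s. s + k" S] insert(1) False by (simp add: mono_def)
    have "gap_product \<rho> u ((\<lambda>s. s + k) ` insert t S) =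
        gap_product \<rho> u ((\<lambda>s. s + k) ` S) * u (nat ((t + k) - Max ((\<lambda>s. s + k) ` S)))"
      unfolding image_insert using insert False by (intro gap_product_insert_greatest) auto
    also have "\<dots> = gap_product \<rho> u S * u (nat (t - Max S))"
      using insert.IH max by simp
    also have "\<dots> = gap_product \<rho> u (insert t S)"
      using insert False by (intro gap_product_insert_greatest[symmetric]) auto
    finally show ?thesis .
  qed simp
qed simp

text \<open>The gaps of a set containing 0 are those to the left of 0 and those to the right of it.\<close>

lemma gap_product_split:
  assumes "finite A" "finite B" "\<And>a. a \<in> A \<Longrightarrow> a < 0" "\<And>b. b \<in> B \<Longrightarrow> 0 < b"
  shows "gap_product \<rho> u (insert 0 A \<union> B) * \<rho> = gap_product \<rho> u (insert 0 A) * gap_product \<rho> u (insert 0 B)"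
  using assms(2,4)
proof (induction B rule: finite_linorder_max_induct)
  case (insert b B)
  have max: "Max (insert 0 A \<union> B) = Max (insert 0 B)"
  proof -
    have "Max (insert 0 A \<union> B) = Max (A \<union> insert 0 B)" by simp
    also have "\<dots> = Max (insert 0 B)"
    proof (rule Max_eqI)
      fix y assume "y \<in> A \<union> insert 0 B"
      then have "y \<le> 0 \<or> y \<in> B" using assms(3) by force
      moreover have "0 \<le> Max (insert 0 B)" using insert(1) by simp
      moreover have "z \<le> Max (insert 0 B)" if "z \<in> B" for z using insert(1) that by (intro Max_ge) auto
      ultimately show "y \<le> Max (insert 0 B)" by (meson order_trans)
    next
      have "Max (insert 0 B) \<in> insert 0 B" using insert(1) by (intro Max_in) auto
      then show "Max (insert 0 B) \<in> A \<union> insert 0 B" by blast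
    qed (use assms(1) insert(1) in auto)
    finally show ?thesis .
  qed
  have b: "0 < b" using insert.prems by simp
  have lt: "s < b" if "s \<in> insert 0 A \<union> B" for s using that insert(2) assms(3)[of s] b by force
  have "gap_product \<rho> u (insert b (insert 0 A \<union> B)) =
      gap_product \<rho> u (insert 0 A \<union> B) * u (nat (b - Max (insert 0 A \<union> B)))"
    using assms(1) insert(1) lt by (intro gap_product_insert_greatest) auto
  moreover have "gap_product \<rho> u (insert b (insert 0 B)) =
      gap_product \<rho> u (insert 0 B) * u (nat (b - Max (insert 0 B)))"
    using insert(1) lt by (intro gap_product_insert_greatest) auto
  moreover have "insert 0 A \<union> insert b B = insert b (insert 0 A \<union> B)"
    "insert 0 (insert b B) = insert b (insert 0 B)" by auto
  moreover have "gap_product \<rho> u (insert 0 A \<union> B) * \<rho> = gap_product \<rho> u (insert 0 A) * gap_product \<rho> u (insert 0 B)"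
    using insert.IH insert.prems by simp
  ultimately show ?case using max by (simp add: mult.assoc mult.left_commute)
qed simp

lemma stationary_if_product_formula:
  assumes X: "binary_process M X" and prod: "\<And>S. finite S \<Longrightarrow> inclusion_prob M X S = gap_product \<rho> u S"
  shows "stationary_process M X"
  unfolding stationary_process_def
proof (intro conjI allI X)
  fix k
  show "process_law M (\<lambda>m. X (m + k)) = process_law M X"
  proof (rule process_law_eqI[OF binary_process_shift[OF X] X])
    fix S :: "int set" assume S: "finite S"
    have "inclusion_prob M (\<lambda>m. X (m + k)) S = inclusion_prob M X ((\<lambda>s. s + k) ` S)" by simp
    also have "\<dots> = inclusion_prob M X S"
      by (simp only: prod[OF S] prod[OF finite_imageI[OF S]] gap_product_shift[OF S])
    finally show "inclusion_prob M (\<lambda>m. X (m + k)) S = inclusion_prob M X S" .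
  qed
qed

text \<open>Given a renewal at 0, the product formula makes inclusion events of the past independent of
  those of the future. Both are \<open>\<pi>\<close>-systems, so the generated \<open>\<sigma>\<close>-algebras are independent under
  the conditional measure.\<close>

theorem renewal_if_product_formula:
  assumes X: "binary_process M X" and prod: "\<And>S. finite S \<Longrightarrow> inclusion_prob M X S = gap_product \<rho> u S"
  shows "renewal_process M X"
  unfolding renewal_process_def
proof (intro conjI ballI impI)
  show "stationary_process M X" by (rule stationary_if_product_formula[OF X prod])
  interpret prob_space M using X by (simp add: binary_process_def)
  have [measurable]: "Measurable.pred M (X m)" for m using X by (rule binary_process_pred)
  define V where "V I = (\<lambda>\<omega>. \<lambda>m\<in>I. X m \<omega>)" for I
  have V: "V I \<in> measurable M (seq_algebra I)" for I
    unfolding V_def using X by (rule binary_process_measurable)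
  define Z where "Z = {\<omega> \<in> space M. X 0 \<omega>}"
  have Z: "Z \<in> events" unfolding Z_def by measurable
  have prob_Z: "prob Z = \<rho>" using prod[of "{0}"] by (simp add: Z_def)
  fix B C assume B: "B \<in> sets (seq_algebra {..-1})" and C: "C \<in> sets (seq_algebra {1..})"
    and pos: "0 < \<P>(\<omega> in M. (\<lambda>m\<in>{..-1}. X m \<omega>) \<in> B \<and> X 0 \<omega>)"
  have "\<P>(\<omega> in M. (\<lambda>m\<in>{..-1}. X m \<omega>) \<in> B \<and> X 0 \<omega>) \<le> prob Z"
    using Z by (intro finite_measure_mono) (auto simp: Z_def)
  then have \<rho>: "0 < \<rho>" using pos prob_Z by simp
  \<comment> \<open>the conditional measure given a renewal at 0\<close>
  define Q where "Q = uniform_measure M Z"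
  have "emeasure M Z \<noteq> 0" "emeasure M Z \<noteq> \<infinity>" using prob_Z \<rho> by (auto simp: emeasure_eq_measure)
  then interpret Q: prob_space Q unfolding Q_def by (rule prob_space_uniform_measure)
  have Q: "measure Q E = prob (Z \<inter> E) / \<rho>" if "E \<in> events" for E
    unfolding Q_def prob_Z[symmetric]
    using that Z prob_Z \<rho> by (intro measure_uniform_measure) (auto simp: emeasure_eq_measure)
  have sets_Q: "sets Q = events" and space_Q: "space Q = space M" by (simp_all add: Q_def)
  define G where "G I = {V I -` E \<inter> space M | E. E \<in> inclusion_events I}" for I
  have G_eq: "G I = {{\<omega> \<in> space M. \<forall>s\<in>S. X s \<omega>} | S. finite S \<and> S \<subseteq> I}" for I
  proof -
    define f g where "f S = {x \<in> I \<rightarrow>\<^sub>E UNIV. \<forall>s\<in>S. x s}" and "g S = {\<omega> \<in> space M. \<forall>s\<in>S. X s \<omega>}" for S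
    have fg: "V I -` f S \<inter> space M = g S" if "S \<subseteq> I" for S
      using that by (auto simp: V_def f_def g_def)
    have "{V I -` E \<inter> space M | E. \<exists>S. E = f S \<and> finite S \<and> S \<subseteq> I} = {g S | S. finite S \<and> S \<subseteq> I}"
    proof (intro equalityI subsetI)
      fix a assume "a \<in> {V I -` E \<inter> space M | E. \<exists>S. E = f S \<and> finite S \<and> S \<subseteq> I}"
      then obtain S where "a = V I -` f S \<inter> space M" "finite S" "S \<subseteq> I" by blast
      then show "a \<in> {g S | S. finite S \<and> S \<subseteq> I}" using fg by blast
    next
      fix a assume "a \<in> {g S | S. finite S \<and> S \<subseteq> I}"
      then obtain S where "a = V I -` f S \<inter> space M" "finite S" "S \<subseteq> I" using fg by blast
      then show "a \<in> {V I -` E \<inter> space M | E. \<exists>S. E = f S \<and> finite S \<and> S \<subseteq> I}" by blast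
    qed
    then show ?thesis unfolding G_def inclusion_events_def f_def g_def mem_Collect_eq .
  qed
  have event: "{\<omega> \<in> space M. \<forall>s\<in>S. X s \<omega>} \<in> events" if "finite S" for S
    using that by measurable
  have Int_stable_G: "Int_stable (G I)" for I
  proof (rule Int_stableI)
    fix a b assume "a \<in> G I" "b \<in> G I"
    then obtain S T where "a = {\<omega> \<in> space M. \<forall>s\<in>S. X s \<omega>}" "finite S" "S \<subseteq> I"
      "b = {\<omega> \<in> space M. \<forall>s\<in>T. X s \<omega>}" "finite T" "T \<subseteq> I" unfolding G_eq by blast
    then have "a \<inter> b = {\<omega> \<in> space M. \<forall>s\<in>S \<union> T. X s \<omega>} \<and> finite (S \<union> T) \<and> S \<union> T \<subseteq> I" by auto
    then show "a \<inter> b \<in> G I" unfolding G_eq by blast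
  qed
  have "Q.indep_set (G {..-1}) (G {1..})"
  proof (rule Q.indep_setI)
    show "G {..-1} \<subseteq> Q.events" "G {1..} \<subseteq> Q.events" unfolding G_eq sets_Q using event by blast+
    fix a b assume "a \<in> G {..-1}" "b \<in> G {1..}"
    then obtain S T where a: "a = {\<omega> \<in> space M. \<forall>s\<in>S. X s \<omega>}" "finite S" "S \<subseteq> {..-1}"
      and b: "b = {\<omega> \<in> space M. \<forall>s\<in>T. X s \<omega>}" "finite T" "T \<subseteq> {1..}" unfolding G_eq by blast
    have "Z \<inter> a = {\<omega> \<in> space M. \<forall>s\<in>insert 0 S. X s \<omega>}" "Z \<inter> b = {\<omega> \<in> space M. \<forall>s\<in>insert 0 T. X s \<omega>}"
      "Z \<inter> (a \<inter> b) = {\<omega> \<in> space M. \<forall>s\<in>insert 0 S \<union> T. X s \<omega>}"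
      using a b by (auto simp: Z_def)
    then have probs: "prob (Z \<inter> a) = gap_product \<rho> u (insert 0 S)" "prob (Z \<inter> b) = gap_product \<rho> u (insert 0 T)"
      "prob (Z \<inter> (a \<inter> b)) = gap_product \<rho> u (insert 0 S \<union> T)"
      using prod[of "insert 0 S"] prod[of "insert 0 T"] prod[of "insert 0 S \<union> T"] a(2) b(2) by simp_all
    have "gap_product \<rho> u (insert 0 S \<union> T) * \<rho> = gap_product \<rho> u (insert 0 S) * gap_product \<rho> u (insert 0 T)"
      using a b by (intro gap_product_split) force+
    moreover have "a \<in> events" "b \<in> events" using event a b by auto
    ultimately show "Q.prob (a \<inter> b) = Q.prob a * Q.prob b"
      using \<rho> by (simp add: Q probs field_simps)
  qed
  then have indep: "Q.indep_set (sigma_sets (space Q) (G {..-1})) (sigma_sets (space Q) (G {1..}))"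
    by (intro Q.indep_set_sigma_sets Int_stable_G)
  have gen: "V I -` E \<inter> space M \<in> sigma_sets (space Q) (G I)" if "E \<in> sets (seq_algebra I)" for I E
  proof -
    have "V I \<in> space M \<rightarrow> (I \<rightarrow>\<^sub>E UNIV)" by (auto simp: V_def)
    then have "{V I -` A \<inter> space M |A. A \<in> sigma_sets (I \<rightarrow>\<^sub>E UNIV) (inclusion_events I)} = sigma_sets (space M) (G I)"
      unfolding G_def by (rule sigma_sets_vimage_commute)
    then show ?thesis using that unfolding sets_seq_algebra_inclusion space_Q by blast
  qed
  define b where "b = V {..-1} -` B \<inter> space M"
  define d where "d = V {1..} -` C \<inter> space M"
  have bd: "b \<in> events" "d \<in> events" unfolding b_def d_def using V B C by (auto intro: measurable_sets)
  have "Q.prob (b \<inter> d) = Q.prob b * Q.prob d"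
    using indep unfolding b_def d_def by (rule Q.indep_setD) (intro gen B C)+
  then have *: "prob (Z \<inter> (b \<inter> d)) * \<rho> = prob (Z \<inter> b) * prob (Z \<inter> d)"
    using bd \<rho> by (simp add: Q field_simps)
  have sets_eq: "{\<omega> \<in> space M. (\<lambda>m\<in>{..-1}. X m \<omega>) \<in> B \<and> X 0 \<omega>} = Z \<inter> b"
    "{\<omega> \<in> space M. (\<lambda>m\<in>{1..}. X m \<omega>) \<in> C \<and> (\<lambda>m\<in>{..-1}. X m \<omega>) \<in> B \<and> X 0 \<omega>} = Z \<inter> (b \<inter> d)"
    "{\<omega> \<in> space M. (\<lambda>m\<in>{1..}. X m \<omega>) \<in> C \<and> X 0 \<omega>} = Z \<inter> d"
    by (auto simp: Z_def b_def d_def V_def)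
  show "\<P>(\<omega> in M. (\<lambda>m\<in>{1..}. X m \<omega>) \<in> C \<bar> (\<lambda>m\<in>{..-1}. X m \<omega>) \<in> B \<and> X 0 \<omega>) =
      \<P>(\<omega> in M. (\<lambda>m\<in>{1..}. X m \<omega>) \<in> C \<bar> X 0 \<omega>)"
    using * pos \<rho> prob_Z unfolding cond_prob_def sets_eq Z_def[symmetric] by (simp add: field_simps)
qed

section \<open>The renewal equation\<close>

lemma cylinder_pred [measurable (raw)]:
  assumes "finite A" "\<And>a. a \<in> A \<Longrightarrow> Measurable.pred M (P a)"
  shows "Measurable.pred M (\<lambda>\<omega>. \<forall>a\<in>A. P a \<omega>)"
  unfolding pred_def
  by (rule sets.sets_Collect_finite_All[OF _ assms(1)]) (use assms(2) in \<open>simp add: pred_def\<close>)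

lemma stationary_pattern:
  assumes X: "stationary_process M X" and A: "finite A"
  shows "\<P>(\<omega> in M. \<forall>a\<in>A. X (a + k) \<omega> = v a) = \<P>(\<omega> in M. \<forall>a\<in>A. X a \<omega> = v a)"
proof -
  have B: "binary_process M X" using X by (simp add: stationary_process_def)
  define E where "E = {x \<in> space (seq_algebra UNIV). \<forall>a\<in>A. x a = v a}"
  have "Measurable.pred (seq_algebra UNIV) (\<lambda>x. x a = v a)" for a :: int
    using pred_component[of a UNIV] by (cases "v a") simp_all
  then have E: "E \<in> sets (seq_algebra UNIV)"
    unfolding E_def by (intro sets.sets_Collect_finite_All A) (simp add: pred_def)
  have "measure (process_law M (\<lambda>m. X (m + k))) E = measure (process_law M X) E"
    using X by (simp add: stationary_process_def)
  then show ?thesis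
    unfolding measure_process_law[OF binary_process_shift[OF B] E] measure_process_law[OF B E]
    by (simp add: E_def space_PiM)
qed

text \<open>The renewal property is multiplied out here, so that the case of a past event of probability 0
  can be included. The values \<open>v\<close> allow both present and absent points in the past.\<close>

lemma renewal_factor:
  assumes X: "renewal_process M X" and A: "finite A" "\<And>a. a \<in> A \<Longrightarrow> a < 0" and t: "0 < t"
  shows "\<P>(\<omega> in M. (\<forall>a\<in>A. X a \<omega> = v a) \<and> X 0 \<omega> \<and> X t \<omega>) * \<P>(\<omega> in M. X 0 \<omega>) =
    \<P>(\<omega> in M. (\<forall>a\<in>A. X a \<omega> = v a) \<and> X 0 \<omega>) * \<P>(\<omega> in M. X 0 \<omega> \<and> X t \<omega>)"
proof -
  have BP: "binary_process M X" using X by (simp add: renewal_process_def stationary_process_def)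
  interpret prob_space M using BP by (simp add: binary_process_def)
  have [measurable]: "Measurable.pred M (X m)" for m using BP by (rule binary_process_pred)
  define B where "B = {x \<in> space (seq_algebra {..-1}). \<forall>a\<in>A. x a = v a}"
  define C where "C = {x \<in> space (seq_algebra {1..}). x t}"
  have A': "a \<in> {..-1}" if "a \<in> A" for a using A(2)[OF that] by simp
  have "Measurable.pred (seq_algebra {..-1}) (\<lambda>x. x a = v a)" if "a \<in> A" for a
    using pred_component[OF A'[OF that]] by (cases "v a") simp_all
  then have B: "B \<in> sets (seq_algebra {..-1})"
    unfolding B_def by (intro sets.sets_Collect_finite_All A) (simp add: pred_def)
  have C: "C \<in> sets (seq_algebra {1..})"
    unfolding C_def using t by (intro predE pred_component) simp
  have memB: "(\<lambda>m\<in>{..-1}. X m \<omega>) \<in> B \<longleftrightarrow> (\<forall>a\<in>A. X a \<omega> = v a)" for \<omega>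
    using A' by (auto simp: B_def space_PiM)
  have memC: "(\<lambda>m\<in>{1..}. X m \<omega>) \<in> C \<longleftrightarrow> X t \<omega>" for \<omega>
    using t by (auto simp: C_def space_PiM)
  let ?past = "\<P>(\<omega> in M. (\<forall>a\<in>A. X a \<omega> = v a) \<and> X 0 \<omega>)"
  have swap: "\<P>(\<omega> in M. X t \<omega> \<and> (\<forall>a\<in>A. X a \<omega> = v a) \<and> X 0 \<omega>) =
      \<P>(\<omega> in M. (\<forall>a\<in>A. X a \<omega> = v a) \<and> X 0 \<omega> \<and> X t \<omega>)"
    "\<P>(\<omega> in M. X t \<omega> \<and> X 0 \<omega>) = \<P>(\<omega> in M. X 0 \<omega> \<and> X t \<omega>)"
    by (intro arg_cong[where f = prob]; auto)+
  have [measurable]: "Measurable.pred M (\<lambda>\<omega>. X a \<omega> = v a)" for a by (cases "v a") simp_all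
  have [measurable]: "Measurable.pred M (\<lambda>\<omega>. \<forall>a\<in>A. X a \<omega> = v a)"
    using A(1) by (rule cylinder_pred) measurable
  show ?thesis
  proof (cases "?past > 0")
    case True
    have "?past \<le> \<P>(\<omega> in M. X 0 \<omega>)"
      by (rule finite_measure_mono) auto
    then have pos: "0 < \<P>(\<omega> in M. X 0 \<omega>)" using True by simp
    have "\<P>(\<omega> in M. X t \<omega> \<bar> (\<forall>a\<in>A. X a \<omega> = v a) \<and> X 0 \<omega>) = \<P>(\<omega> in M. X t \<omega> \<bar> X 0 \<omega>)"
      using bspec[OF bspec[OF conjunct2[OF X[unfolded renewal_process_def]] B] C, unfolded memB memC] True
      by (rule mp)
    then show ?thesis
      using True pos unfolding cond_prob_def swap by (simp add: field_simps)
  next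
    case False
    then have past: "?past = 0" by (simp add: not_less measure_le_0_iff)
    have "\<P>(\<omega> in M. (\<forall>a\<in>A. X a \<omega> = v a) \<and> X 0 \<omega> \<and> X t \<omega>) \<le> ?past"
      by (rule finite_measure_mono) auto
    then have "\<P>(\<omega> in M. (\<forall>a\<in>A. X a \<omega> = v a) \<and> X 0 \<omega> \<and> X t \<omega>) = 0"
      unfolding past by (simp only: measure_le_0_iff)
    then show ?thesis using past by simp
  qed
qed

lemma renewal_factor_at:
  assumes X: "renewal_process M X" and A: "finite A" "\<And>a. a \<in> A \<Longrightarrow> a < s" and t: "s < t"
  shows "\<P>(\<omega> in M. (\<forall>a\<in>A. X a \<omega> = v a) \<and> X s \<omega> \<and> X t \<omega>) * \<P>(\<omega> in M. X 0 \<omega>) =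
    \<P>(\<omega> in M. (\<forall>a\<in>A. X a \<omega> = v a) \<and> X s \<omega>) * \<P>(\<omega> in M. X 0 \<omega> \<and> X (t - s) \<omega>)"
proof -
  have S: "stationary_process M X" using X by (simp add: renewal_process_def)
  define A' where "A' = (\<lambda>a. a - s) ` A"
  define v' where "v' a = (if a < 0 then v (a + s) else True)" for a
  have A': "finite A'" "\<And>a. a \<in> A' \<Longrightarrow> a < 0" using A by (auto simp: A'_def)
  have "\<P>(\<omega> in M. (\<forall>a\<in>A. X a \<omega> = v a) \<and> X s \<omega> \<and> X t \<omega>) =
      \<P>(\<omega> in M. \<forall>a\<in>A' \<union> {0, t - s}. X (a + s) \<omega> = v' a)"
    using A(2) t by (intro arg_cong[where f = "measure M"] Collect_cong) (auto simp: A'_def v'_def)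
  also have "\<dots> = \<P>(\<omega> in M. \<forall>a\<in>A' \<union> {0, t - s}. X a \<omega> = v' a)"
    using S A'(1) by (intro stationary_pattern) auto
  also have "\<dots> = \<P>(\<omega> in M. (\<forall>a\<in>A'. X a \<omega> = v' a) \<and> X 0 \<omega> \<and> X (t - s) \<omega>)"
    using t by (intro arg_cong[where f = "measure M"] Collect_cong) (auto simp: v'_def)
  finally have 1: "\<P>(\<omega> in M. (\<forall>a\<in>A. X a \<omega> = v a) \<and> X s \<omega> \<and> X t \<omega>) =
      \<P>(\<omega> in M. (\<forall>a\<in>A'. X a \<omega> = v' a) \<and> X 0 \<omega> \<and> X (t - s) \<omega>)" .
  have "\<P>(\<omega> in M. (\<forall>a\<in>A. X a \<omega> = v a) \<and> X s \<omega>) =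
      \<P>(\<omega> in M. \<forall>a\<in>A' \<union> {0}. X (a + s) \<omega> = v' a)"
    using A(2) by (intro arg_cong[where f = "measure M"] Collect_cong) (auto simp: A'_def v'_def)
  also have "\<dots> = \<P>(\<omega> in M. \<forall>a\<in>A' \<union> {0}. X a \<omega> = v' a)"
    using S A'(1) by (intro stationary_pattern) auto
  also have "\<dots> = \<P>(\<omega> in M. (\<forall>a\<in>A'. X a \<omega> = v' a) \<and> X 0 \<omega>)"
    by (intro arg_cong[where f = "measure M"] Collect_cong) (auto simp: v'_def)
  finally have 2: "\<P>(\<omega> in M. (\<forall>a\<in>A. X a \<omega> = v a) \<and> X s \<omega>) = \<P>(\<omega> in M. (\<forall>a\<in>A'. X a \<omega> = v' a) \<and> X 0 \<omega>)" .
  show ?thesis unfolding 1 2 using X A' t by (intro renewal_factor) auto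
qed

lemma stationary_single:
  assumes "stationary_process M X"
  shows "\<P>(\<omega> in M. X s \<omega>) = \<P>(\<omega> in M. X 0 \<omega>)"
  using stationary_pattern[OF assms, of "{0}" s "\<lambda>_. True"] by simp

lemma stationary_pair:
  assumes "stationary_process M X"
  shows "\<P>(\<omega> in M. X s \<omega> \<and> X t \<omega>) = \<P>(\<omega> in M. X 0 \<omega> \<and> X (t - s) \<omega>)"
  using stationary_pattern[OF assms, of "{0, t - s}" s "\<lambda>_. True"] by simp

text \<open>The largest point of \<open>S\<close> is split off at the second largest one, where the process renews.\<close>

theorem product_formula_if_renewal:
  assumes X: "renewal_process M X" and pos: "\<P>(\<omega> in M. X 0 \<omega>) \<noteq> 0" and S: "finite S"
  shows "inclusion_prob M X S =
    gap_product (\<P>(\<omega> in M. X 0 \<omega>)) (\<lambda>k. \<P>(\<omega> in M. X 0 \<omega> \<and> X (int k) \<omega>) / \<P>(\<omega> in M. X 0 \<omega>)) S"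
  using S
proof (induction S rule: finite_linorder_max_induct)
  case empty
  have "prob_space M" using X by (simp add: renewal_process_def stationary_process_def binary_process_def)
  then show ?case by (simp add: prob_space.prob_space)
next
  case (insert t S)
  have st: "stationary_process M X" using X by (simp add: renewal_process_def)
  let ?\<rho> = "\<P>(\<omega> in M. X 0 \<omega>)"
  let ?u = "\<lambda>k. \<P>(\<omega> in M. X 0 \<omega> \<and> X (int k) \<omega>) / ?\<rho>"
  show ?case
  proof (cases "S = {}")
    case True
    then show ?thesis using stationary_single[OF st, of t] by simp
  next
    case False
    define s where "s = Max S"
    have s: "s \<in> S" "s < t" using insert False by (simp_all add: s_def)
    have lt: "a < s" if "a \<in> S - {s}" for a
      using that Max_ge[of S a] insert(1) unfolding s_def by (simp add: order_less_le)
    have S: "(\<forall>a\<in>S. X a \<omega>) \<longleftrightarrow> (\<forall>a\<in>S - {s}. X a \<omega> = True) \<and> X s \<omega>" for \<omega>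
      using s by auto
    have "inclusion_prob M X (insert t S) * ?\<rho> =
        \<P>(\<omega> in M. (\<forall>a\<in>S - {s}. X a \<omega> = True) \<and> X s \<omega> \<and> X t \<omega>) * ?\<rho>"
      using S by (simp add: conj_commute conj_left_commute)
    also have "\<dots> = inclusion_prob M X S * \<P>(\<omega> in M. X 0 \<omega> \<and> X (t - s) \<omega>)"
      unfolding S using insert(1) lt s by (intro renewal_factor_at[OF X]) auto
    finally have "inclusion_prob M X (insert t S) = inclusion_prob M X S * ?u (nat (t - s))"
      using pos s by (simp add: field_simps)
    also have "\<dots> = gap_product ?\<rho> ?u (insert t S)"
      unfolding s_def insert.IH using insert False by (intro gap_product_insert_greatest[symmetric]) auto
    finally show ?thesis .
  qed
qed

text \<open>The conditional probability, given a renewal at 0, that the next renewal is at \<open>k\<close>.\<close>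

definition first_renewal_prob :: "'a measure \<Rightarrow> (int \<Rightarrow> 'a \<Rightarrow> bool) \<Rightarrow> nat \<Rightarrow> real" where
  "first_renewal_prob M X k =
     \<P>(\<omega> in M. X 0 \<omega> \<and> (\<forall>j\<in>{0<..<int k}. \<not> X j \<omega>) \<and> X (int k) \<omega>) / \<P>(\<omega> in M. X 0 \<omega>)"

text \<open>Given renewals at 0 and \<open>n\<close>, decompose according to the first renewal \<open>k\<close> after 0; it is at
  most \<open>n\<close>, and the process starts afresh at \<open>k\<close>.\<close>

theorem renewal_equation:
  assumes X: "renewal_process M X" and pos: "\<P>(\<omega> in M. X 0 \<omega>) \<noteq> 0" and n: "1 \<le> n"
  defines "u \<equiv> \<lambda>k. \<P>(\<omega> in M. X 0 \<omega> \<and> X (int k) \<omega>) / \<P>(\<omega> in M. X 0 \<omega>)"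
  shows "u n = (\<Sum>k=1..n. first_renewal_prob M X k * u (n - k))"
proof -
  have BP: "binary_process M X" using X by (simp add: renewal_process_def stationary_process_def)
  interpret prob_space M using BP by (simp add: binary_process_def)
  have [measurable]: "Measurable.pred M (X m)" for m using BP by (rule binary_process_pred)
  let ?\<rho> = "\<P>(\<omega> in M. X 0 \<omega>)"
  define first where "first k \<omega> \<longleftrightarrow> X 0 \<omega> \<and> (\<forall>j\<in>{0<..<int k}. \<not> X j \<omega>) \<and> X (int k) \<omega>" for k :: nat and \<omega>
  have [measurable]: "Measurable.pred M (first k)" for k
    unfolding first_def by measurable
  have not_less: "\<not> k < k'" if "first k \<omega>" "first k' \<omega>" "1 \<le> k" for k k' \<omega>
  proof
    assume "k < k'"
    then have "int k \<in> {0<..<int k'}" using that by simp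
    then show False using that unfolding first_def by blast
  qed
  have unique: "k = k'" if "first k \<omega>" "first k' \<omega>" "1 \<le> k" "1 \<le> k'" for k k' \<omega>
    using not_less[of k \<omega> k'] not_less[of k' \<omega> k] that by simp
  have "{\<omega> \<in> space M. X 0 \<omega> \<and> X (int n) \<omega>} = (\<Union>k\<in>{1..n}. {\<omega> \<in> space M. first k \<omega> \<and> X (int n) \<omega>})"
  proof (intro equalityI subsetI)
    fix \<omega> assume \<omega>: "\<omega> \<in> {\<omega> \<in> space M. X 0 \<omega> \<and> X (int n) \<omega>}"
    define k where "k = (LEAST k. 1 \<le> k \<and> X (int k) \<omega>)"
    have k: "1 \<le> k \<and> X (int k) \<omega>" unfolding k_def using \<omega> n
      by - (rule LeastI[of "\<lambda>k. 1 \<le> k \<and> X (int k) \<omega>" n], simp)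
    have least: "k \<le> j" if "1 \<le> j" "X (int j) \<omega>" for j      unfolding k_def using that by - (rule Least_le[of "\<lambda>k. 1 \<le> k \<and> X (int k) \<omega>" j], simp)
    have "\<not> X j \<omega>" if "j \<in> {0<..<int k}" for j
    proof
      assume "X j \<omega>"
      then have "k \<le> nat j" using that by (intro least) auto
      then show False using that unfolding greaterThanLessThan_iff by arith
    qed
    then have "first k \<omega>" using \<omega> k by (simp add: first_def)
    moreover have "k \<le> n" using least[of n] \<omega> n by simp
    ultimately show "\<omega> \<in> (\<Union>k\<in>{1..n}. {\<omega> \<in> space M. first k \<omega> \<and> X (int n) \<omega>})" using \<omega> k by auto
  qed (auto simp: first_def)
  then have s1: "\<P>(\<omega> in M. X 0 \<omega> \<and> X (int n) \<omega>) = (\<Sum>k\<in>{1..n}. \<P>(\<omega> in M. first k \<omega> \<and> X (int n) \<omega>))"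
    using unique by (simp only:) (subst finite_measure_finite_Union; fastforce simp: disjoint_family_on_def)
  have s2: "(\<Sum>k\<in>{1..n}. \<P>(\<omega> in M. first k \<omega> \<and> X (int n) \<omega>)) =
      (\<Sum>k\<in>{1..n}. \<P>(\<omega> in M. first k \<omega>) * u (n - k))"
  proof (rule sum.cong[OF refl])
    fix k assume k: "k \<in> {1..n}"
    have first: "first k \<omega> \<longleftrightarrow> (\<forall>a\<in>{0..<int k}. X a \<omega> = (a = 0)) \<and> X (int k) \<omega>" for \<omega>
    proof -
      have "{0..<int k} = insert 0 {0<..<int k}" using k by auto
      moreover have "(\<forall>a\<in>{0<..<int k}. X a \<omega> = (a = 0)) \<longleftrightarrow> (\<forall>a\<in>{0<..<int k}. \<not> X a \<omega>)"
        by (rule ball_cong) auto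
      ultimately show ?thesis unfolding first_def by simp
    qed
    show "\<P>(\<omega> in M. first k \<omega> \<and> X (int n) \<omega>) = \<P>(\<omega> in M. first k \<omega>) * u (n - k)"
    proof (cases "k = n")
      case True
      have "(first k \<omega> \<and> X (int n) \<omega>) = first k \<omega>" for \<omega> using True by (auto simp: first_def)
      then show ?thesis using True pos by (simp add: u_def)
    next
      case False
      then have *: "\<P>(\<omega> in M. first k \<omega> \<and> X (int n) \<omega>) * ?\<rho> =
          \<P>(\<omega> in M. first k \<omega>) * \<P>(\<omega> in M. X 0 \<omega> \<and> X (int n - int k) \<omega>)"
        unfolding first conj_assoc using k by (intro renewal_factor_at[OF X]) auto
      have nk: "int n - int k = int (n - k)" using k by auto
      have cancel: "a = b * (q / r)" if "a * r = b * q" "r \<noteq> 0" for a b q r :: real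
        using that by (simp add: field_simps)
      show ?thesis
        unfolding u_def using *[unfolded nk] pos by (rule cancel)
    qed
  qed
  have sum: "\<P>(\<omega> in M. X 0 \<omega> \<and> X (int n) \<omega>) = (\<Sum>k\<in>{1..n}. \<P>(\<omega> in M. first k \<omega>) * u (n - k))"
    using s1 s2 by (rule trans)
  have f: "first_renewal_prob M X k = \<P>(\<omega> in M. first k \<omega>) / ?\<rho>" for k
    unfolding first_renewal_prob_def first_def ..
  have "u n = \<P>(\<omega> in M. X 0 \<omega> \<and> X (int n) \<omega>) / ?\<rho>" unfolding u_def ..
  also have "\<dots> = (\<Sum>k\<in>{1..n}. \<P>(\<omega> in M. first k \<omega>) * u (n - k)) / ?\<rho>"
    by (rule arg_cong[OF sum])
  also have "\<dots> = (\<Sum>k=1..n. first_renewal_prob M X k * u (n - k))"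
    unfolding f sum_divide_distrib times_divide_eq_left ..
  finally show ?thesis .
qed

text \<open>The generating functions of \<open>u\<close> and \<open>f\<close> satisfy \<open>U = 1 + F * U\<close>. For the given \<open>u\<close> one has
  \<open>(1 - x) * (1 - \<alpha>\<^sup>2 * x) * U = 1 - b * x + \<alpha>\<^sup>2 * x\<^sup>2\<close> with \<open>b = 1 + \<alpha>\<^sup>2 - \<rho> * (1 - \<alpha>\<^sup>2)\<close>, so that
  \<open>F\<close> is the rational function \<open>\<rho> * (1 - \<alpha>\<^sup>2) * x / (1 - b * x + \<alpha>\<^sup>2 * x\<^sup>2)\<close>.\<close>

lemma first_renewal_recurrence:
  fixes u f :: "nat \<Rightarrow> real"
  assumes u0: "u 0 = 1" and u: "\<And>n. 1 \<le> n \<Longrightarrow> u n = \<rho> * (1 - \<alpha> ^ (2 * n))"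
    and eq: "\<And>n. 1 \<le> n \<Longrightarrow> u n = (\<Sum>k=1..n. f k * u (n - k))"
  shows "f 1 = \<rho> * (1 - \<alpha>\<^sup>2)"
    and "f 2 = (1 + \<alpha>\<^sup>2 - \<rho> * (1 - \<alpha>\<^sup>2)) * f 1"
    and "1 \<le> m \<Longrightarrow> f (m + 2) = (1 + \<alpha>\<^sup>2 - \<rho> * (1 - \<alpha>\<^sup>2)) * f (m + 1) - \<alpha>\<^sup>2 * f m"
proof -
  define b where "b = 1 + \<alpha>\<^sup>2 - \<rho> * (1 - \<alpha>\<^sup>2)"
  define U F D N :: "real fps" where "U = Abs_fps u" and "F = Abs_fps (\<lambda>k. if k = 0 then 0 else f k)"
    and "D = 1 - fps_const (1 + \<alpha>\<^sup>2) * fps_X + fps_const (\<alpha>\<^sup>2) * fps_X ^ 2"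
    and "N = 1 - fps_const b * fps_X + fps_const (\<alpha>\<^sup>2) * fps_X ^ 2"
  have coeff: "fps_nth ((1 - fps_const r * fps_X + fps_const s * fps_X ^ 2) * G) n =
      fps_nth G n - (if n = 0 then 0 else r * fps_nth G (n - 1)) + (if n < 2 then 0 else s * fps_nth G (n - 2))"
    for r s n and G :: "real fps"
  proof -
    have "(1 - fps_const r * fps_X + fps_const s * fps_X ^ 2) * G =
        G - fps_const r * (fps_X * G) + fps_const s * (fps_X ^ 2 * G)"
      by (simp only: distrib_right left_diff_distrib mult_1 mult.assoc)
    then show ?thesis
      by (simp only: fps_add_nth fps_sub_nth fps_mult_left_const_nth fps_X_mult_nth fps_X_power_mult_nth) simp
  qed
  have FU: "U = 1 + F * U"
  proof (rule fps_ext)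
    fix n
    show "fps_nth U n = fps_nth (1 + F * U) n"
    proof (cases "n = 0")
      case True
      then show ?thesis by (simp add: U_def F_def u0)
    next
      case False
      have "fps_nth (F * U) n = (\<Sum>k=0..n. (if k = 0 then 0 else f k) * u (n - k))"
        by (simp add: fps_mult_nth F_def U_def)
      also have "\<dots> = (\<Sum>k=1..n. f k * u (n - k))"
        using False by (subst sum.atLeast_Suc_atMost) (auto intro!: sum.cong)
      finally show ?thesis using False eq[of n] by (simp add: U_def)
    qed
  qed
  have DU: "D * U = N"
  proof (rule fps_ext)
    fix n
    have N: "fps_nth N n = (if n = 0 then 1 else if n = 1 then - b else if n = 2 then \<alpha>\<^sup>2 else 0)"
      using coeff[of b "\<alpha>\<^sup>2" 1 n] by (auto simp: N_def)
    have "n = 0 \<or> n = 1 \<or> n = 2 \<or> (\<exists>k. n = k + 3)" by presburger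
    then consider "n = 0" | "n = 1" | "n = 2" | k where "n = k + 3" by blast
    then show "fps_nth (D * U) n = fps_nth N n"
    proof cases
      case 4
      then show ?thesis unfolding D_def coeff N U_def
        by (simp add: u power_add algebra_simps power2_eq_square numeral_eq_Suc)
    qed (unfold D_def coeff N U_def, simp_all add: u0 u b_def algebra_simps power2_eq_square numeral_eq_Suc)
  qed
  have "N = D * (1 + F * U)" using DU FU by simp
  also have "\<dots> = D + F * (D * U)" by (simp add: distrib_left mult.left_commute)
  also have "\<dots> = D + F * N" by (simp only: DU)
  finally have "N * F = N - D" by (simp only: mult.commute[of N F] eq_diff_eq add.commute[of "F * N" D])
  also have "N - D = fps_const (1 + \<alpha>\<^sup>2 - b) * fps_X"
    unfolding N_def D_def fps_const_sub[symmetric] by (simp add: left_diff_distrib)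
  finally have NF: "N * F = fps_const (1 + \<alpha>\<^sup>2 - b) * fps_X" .
  have rec: "fps_nth F n - (if n = 0 then 0 else b * fps_nth F (n - 1)) + (if n < 2 then 0 else \<alpha>\<^sup>2 * fps_nth F (n - 2)) =
      (if n = 1 then 1 + \<alpha>\<^sup>2 - b else 0)" for n
    unfolding coeff[of b "\<alpha>\<^sup>2" F n, symmetric] N_def[symmetric] NF by (simp add: fps_X_nth)
  show "f 1 = \<rho> * (1 - \<alpha>\<^sup>2)" using rec[of 1] by (simp add: F_def b_def)
  show "f 2 = (1 + \<alpha>\<^sup>2 - \<rho> * (1 - \<alpha>\<^sup>2)) * f 1" using rec[of 2] by (simp add: F_def b_def numeral_eq_Suc)
  assume "1 \<le> m"
  then show "f (m + 2) = (1 + \<alpha>\<^sup>2 - \<rho> * (1 - \<alpha>\<^sup>2)) * f (m + 1) - \<alpha>\<^sup>2 * f m"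
    using rec[of "m + 2"] by (simp add: F_def b_def)
qed

section \<open>Principal minors\<close>

lemma det_mat_Suc:
  fixes f :: "nat \<times> nat \<Rightarrow> 'a :: comm_ring_1"
  shows "Determinant.det (Matrix.mat (Suc n) (Suc n) f) = (\<Sum>j<Suc n. f (0, j) * (- 1) ^ j *
    Determinant.det (Matrix.mat n n (\<lambda>(i, k). f (Suc i, if k < j then k else Suc k))))"
proof -
  let ?M = "Matrix.mat (Suc n) (Suc n) f"
  have "Determinant.det ?M = (\<Sum>j<Suc n. ?M $$ (0, j) * cofactor ?M 0 j)"
    by (rule laplace_expansion_row) auto
  also have "\<dots> = (\<Sum>j<Suc n. f (0, j) * (- 1) ^ j *
      Determinant.det (Matrix.mat n n (\<lambda>(i, k). f (Suc i, if k < j then k else Suc k))))"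
  proof (rule sum.cong[OF refl])
    fix j assume j: "j \<in> {..<Suc n}"
    have "mat_delete ?M 0 j = Matrix.mat n n (\<lambda>(i, k). f (Suc i, if k < j then k else Suc k))"
      by (rule eq_matI) (auto simp: mat_delete_def)
    then show "?M $$ (0, j) * cofactor ?M 0 j = f (0, j) * (- 1) ^ j *
        Determinant.det (Matrix.mat n n (\<lambda>(i, k). f (Suc i, if k < j then k else Suc k)))"
      using j by (simp add: cofactor_def mult.assoc)
  qed
  finally show ?thesis .
qed

lemma det_mat_0: "Determinant.det (Matrix.mat 0 0 f) = 1"
  by (rule det_dim_zero) simp

lemma principal_minor_empty [simp]: "principal_minor A {} = 1"
  by (simp add: principal_minor_def det_mat_0)

lemma principal_minor_singleton [simp]: "principal_minor A {s} = A s s"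
  by (simp add: principal_minor_def det_mat_Suc[of 0, simplified] det_mat_0)

lemma principal_minor_pair:
  assumes "s < t"
  shows "principal_minor A {s, t} = A s s * A t t - A s t * A t s"
proof -
  have "sorted_list_of_set {s, t} = [s, t]"
    using assms by (intro sorted_list_of_set_unique[THEN iffD1]) auto
  then show ?thesis
    using assms by (simp add: principal_minor_def numeral_2_eq_2 det_mat_Suc det_mat_0)
qed

lemma principal_minor_triple:
  assumes "r < s" "s < t"
  shows "principal_minor A {r, s, t} = A r r * (A s s * A t t - A s t * A t s) -
    A r s * (A s r * A t t - A s t * A t r) + A r t * (A s r * A t s - A s s * A t r)"
proof -
  have "sorted_list_of_set {r, s, t} = [r, s, t]"
    using assms by (intro sorted_list_of_set_unique[THEN iffD1]) auto
  moreover have "card {r, s, t} = 3" using assms by simp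
  ultimately show ?thesis
    by (simp add: principal_minor_def numeral_3_eq_3 det_mat_Suc det_mat_0 algebra_simps)
qed

text \<open>The entries of a row are geometric in the distance to the diagonal. Subtracting \<open>a ^ g\<close> times the
  last but one row from the last row, where \<open>g\<close> is the last gap, therefore clears the last row
  except for the diagonal entry \<open>r * (1 - a ^ (2 * g))\<close>.\<close>

lemma principal_minor_geometric_insert_greatest:
  fixes r a :: complex
  assumes S: "finite S" "S \<noteq> {}" and t: "\<And>s. s \<in> S \<Longrightarrow> s < t"
  defines "A \<equiv> \<lambda>k l. r * a ^ nat \<bar>l - k\<bar>"
  shows "principal_minor A (insert t S) = principal_minor A S * (r * (1 - a ^ (2 * nat (t - Max S))))"
proof -
  define n where "n = card S"
  define xs where "xs = sorted_list_of_set S"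
  define ys where "ys = xs @ [t]"
  define g where "g = nat (t - Max S)"
  have n: "0 < n" "length xs = n" using S by (auto simp: n_def xs_def card_gt_0_iff)
  have "t \<notin> S" using t by blast
  then have card: "card (insert t S) = Suc n" using S(1) by (simp add: n_def)
  have ys: "sorted_list_of_set (insert t S) = ys"
    unfolding ys_def xs_def using S(1) t by (rule sorted_list_of_set_insert_greatest)
  have last: "xs ! (n - 1) = Max S" unfolding xs_def n_def using S by (rule last_sorted_list_of_set)
  have "set xs = S" using S by (simp add: xs_def)
  then have mem: "xs ! j \<in> S" if "j < n" for j using that n by (metis nth_mem)
  define M where "M = Matrix.mat (Suc n) (Suc n) (\<lambda>(i, j). A (ys ! i) (ys ! j))"
  define M' where "M' = addrow (- (a ^ g)) n (n - 1) M"
  have M: "M \<in> carrier_mat (Suc n) (Suc n)" by (simp add: M_def)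
  have M': "M' \<in> carrier_mat (Suc n) (Suc n)" using M by (simp add: M'_def)
  have "Determinant.det M = Determinant.det M'"
    unfolding M'_def using n M by (intro det_addrow[symmetric]) auto
  also have "\<dots> = (\<Sum>j<Suc n. M' $$ (n, j) * cofactor M' n j)"
    using M' by (intro laplace_expansion_row) auto
  also have "\<dots> = M' $$ (n, n) * cofactor M' n n"
  proof -
    have "M' $$ (n, j) = 0" if j: "j < n" for j
    proof -
      have le: "xs ! j \<le> Max S" using mem[OF j] S(1) by (rule Max_ge[rotated])
      moreover have "Max S < t" using S t by simp
      ultimately have "nat \<bar>xs ! j - t\<bar> = g + nat \<bar>xs ! j - Max S\<bar>" by (simp add: g_def)
      then have "A t (xs ! j) = a ^ g * A (Max S) (xs ! j)" by (simp add: A_def power_add)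
      then show ?thesis
        using j n last by (simp add: M'_def M_def ys_def nth_append)
    qed
    then show ?thesis by simp
  qed
  also have "M' $$ (n, n) = r * (1 - a ^ (2 * g))"
  proof -
    have "Max S < t" using S t by simp
    then have "nat \<bar>t - Max S\<bar> = g" by (simp add: g_def)
    then show ?thesis using n last
      by (simp add: M'_def M_def ys_def nth_append A_def right_diff_distrib mult_2 power_add)
  qed
  also have "cofactor M' n n = Determinant.det (Matrix.mat n n (\<lambda>(i, j). A (xs ! i) (xs ! j)))"
  proof -
    have "mat_delete M' n n = Matrix.mat n n (\<lambda>(i, j). A (xs ! i) (xs ! j))"
      using n by (intro eq_matI) (auto simp: mat_delete_def M'_def M_def ys_def nth_append)
    then show ?thesis by (simp add: cofactor_def)
  qed
  finally show ?thesis
    unfolding principal_minor_def Let_def ys card M_def[symmetric] xs_def[symmetric] n_def[symmetric] g_def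
    by (simp add: mult.commute)
qed

theorem principal_minor_geometric:
  assumes "finite S"
  shows "principal_minor (\<lambda>k l. complex_of_real (\<rho> * \<alpha> ^ nat \<bar>l - k\<bar>)) S =
    complex_of_real (geometric_gap_product \<rho> \<alpha> S)"
  using assms
proof (induction S rule: finite_linorder_max_induct)
  case (insert t S)
  show ?case
  proof (cases "S = {}")
    case False
    have "principal_minor (\<lambda>k l. complex_of_real (\<rho> * \<alpha> ^ nat \<bar>l - k\<bar>)) (insert t S) =
        principal_minor (\<lambda>k l. complex_of_real (\<rho> * \<alpha> ^ nat \<bar>l - k\<bar>)) S *
        (complex_of_real \<rho> * (1 - complex_of_real \<alpha> ^ (2 * nat (t - Max S))))"
      using principal_minor_geometric_insert_greatest[OF insert(1) False, of t "complex_of_real \<rho>" "complex_of_real \<alpha>"]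
        insert(2) by simp
    then show ?thesis
      using gap_product_insert_greatest[OF insert(1) False, of t] insert(2) insert.IH by simp
  qed simp
qed simp

lemma gap_product_thinning:
  assumes "finite S"
  shows "gap_product (p * \<rho>) (\<lambda>m. p * u m) S = p ^ card S * gap_product \<rho> u S"
  using assms
proof (induction S rule: finite_linorder_max_induct)
  case (insert t S)
  show ?case
  proof (cases "S = {}")
    case False
    have "t \<notin> S" using insert(2) by blast
    then show ?thesis
      using gap_product_insert_greatest[OF insert(1) False, of t] insert by simp
  qed simp
qed simp

lemma gap_product_cong:
  assumes "finite S" "\<And>m. 1 \<le> m \<Longrightarrow> u m = u' m"
  shows "gap_product \<rho> u S = gap_product \<rho> u' S"
  using assms(1)
proof (induction S rule: finite_linorder_max_induct)
  case (insert t S)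
  show ?case
  proof (cases "S = {}")
    case False
    have "Max S < t" using insert False by simp
    then have "u (nat (t - Max S)) = u' (nat (t - Max S))" by (intro assms(2)) simp
    then show ?thesis
      using gap_product_insert_greatest[OF insert(1) False, of t] insert by simp
  qed simp
qed simp

section \<open>Fourier coefficients of the symbol\<close>

text \<open>The solutions of the recurrence are spanned by \<open>\<alpha> ^ n\<close> and \<open>\<alpha> ^ (- n)\<close>. The combination \<open>d\<close> of
  consecutive terms picks out the second one, which boundedness excludes.\<close>

lemma bounded_recurrence_geometric:
  fixes b :: "nat \<Rightarrow> complex" and \<alpha> :: real
  assumes \<alpha>: "0 < \<alpha>" "\<alpha> < 1" and bound: "\<And>n. norm (b n) \<le> C"
    and rec: "\<And>n. b (n + 2) = of_real (\<alpha> + 1 / \<alpha>) * b (n + 1) - b n"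
  shows "b n = b 0 * of_real \<alpha> ^ n"
proof -
  define d where "d n = b (n + 1) - of_real \<alpha> * b n" for n
  have step: "of_real \<alpha> * d (n + 1) = d n" for n
    using \<alpha> rec[of n] by (simp add: d_def algebra_simps) (simp add: field_simps)
  have d: "d 0 = of_real \<alpha> ^ n * d n" for n
  proof (induction n)
    case (Suc n)
    then show ?case using step[of n] by (simp add: mult.assoc mult.left_commute)
  qed simp
  have d_bound: "norm (d n) \<le> 2 * C" for n
  proof -
    have "0 \<le> C" using bound[of 0] norm_ge_zero order_trans by blast
    have "norm (d n) \<le> norm (b (n + 1)) + norm (of_real \<alpha> * b n)"
      unfolding d_def by (rule norm_triangle_ineq4)
    also have "norm (of_real \<alpha> * b n) \<le> 1 * C"
      unfolding norm_mult using \<alpha> bound[of n] \<open>0 \<le> C\<close> by (intro mult_mono) auto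
    finally show ?thesis using bound[of "n + 1"] by simp
  qed
  have "norm (d 0) \<le> \<alpha> ^ n * (2 * C)" for n
    using d[of n] d_bound[of n] \<alpha> by (simp add: norm_mult norm_power mult_left_mono)
  moreover have "(\<lambda>n. \<alpha> ^ n * (2 * C)) \<longlonglongrightarrow> 0"
    using \<alpha> by (intro tendsto_mult_left_zero LIMSEQ_power_zero) simp
  ultimately have "norm (d 0) \<le> 0"
    by (intro LIMSEQ_le_const) auto
  then have d0: "d 0 = 0" by simp
  have "d n = 0" for n using d[of n] d0 \<alpha> by simp
  then show ?thesis by (induction n) (simp_all add: d_def)
qed

definition fourier_character :: "int \<Rightarrow> real \<Rightarrow> complex" where
  "fourier_character k x = exp (- (2 * complex_of_real pi * \<i> * of_int k * complex_of_real x))"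

lemma continuous_on_fourier_character [continuous_intros]: "continuous_on S (fourier_character k)"
  unfolding fourier_character_def by (intro continuous_intros)

lemma integral_fourier_character:
  "(CLINT x:{0..1}|lborel. fourier_character k x) = (if k = 0 then 1 else 0)"
proof -
  have "(CLINT x:{0..1}|lborel. fourier_character k x) = integral {0..1} (fourier_character k)"
    by (intro set_borel_integral_eq_integral borel_integrable_atLeastAtMost' continuous_intros)
  also have "\<dots> = (if k = 0 then 1 else 0)"
  proof (cases "k = 0")
    case True
    have "fourier_character 0 = (\<lambda>_. 1)" by (simp add: fun_eq_iff fourier_character_def)
    then show ?thesis using True by simp
  next
    case False
    define w where "w = - (2 * complex_of_real pi * \<i> * of_int k)"
    have w: "w \<noteq> 0" using False by (simp add: w_def)
    have char: "fourier_character k x = exp (w * of_real x)" for x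
      by (simp add: fourier_character_def w_def)
    have "((\<lambda>x. exp (w * complex_of_real x) / w) has_vector_derivative exp (w * complex_of_real x)) (at x within {0..1})" for x
    proof -
      have "((\<lambda>z. exp (w * z) / w) has_field_derivative exp (w * complex_of_real x)) (at (complex_of_real x))"
        by (auto intro!: derivative_eq_intros simp: w)
      then show ?thesis
        by (rule has_vector_derivative_real_field)
    qed
    then have "(fourier_character k has_integral exp (w * complex_of_real 1) / w - exp (w * complex_of_real 0) / w) {0..1}"
      unfolding char by (intro fundamental_theorem_of_calculus) auto
    moreover have "exp (w * complex_of_real 1) = 1"
      unfolding exp_eq_1 w_def using False by (auto intro: exI[of _ "- k"])
    ultimately show ?thesis using False by (simp add: integral_unique)
  qed
  finally show ?thesis .
qed

lemma fourier_coeff_character: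
  "fourier_coeff f k = (CLINT x:{0..1}|lborel. complex_of_real (f x) * fourier_character k x)"
  by (simp add: fourier_coeff_def fourier_character_def)

lemma norm_fourier_character [simp]: "norm (fourier_character k x) = 1"
  by (simp add: fourier_character_def)

lemma norm_fourier_coeff_le:
  assumes "continuous_on {0..1} f"
  shows "norm (fourier_coeff f k) \<le> (LINT x:{0..1}|lborel. \<bar>f x\<bar>)"
proof -
  have "set_integrable lborel {0..1} (\<lambda>x. complex_of_real (f x) * fourier_character k x)"
    using assms by (intro borel_integrable_atLeastAtMost' continuous_intros)
  then have "norm (fourier_coeff f k) \<le> (LINT x:{0..1}|lborel. norm (complex_of_real (f x) * fourier_character k x))"
    unfolding fourier_coeff_character by (rule set_integral_norm_bound)
  then show ?thesis by (simp add: norm_mult)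
qed

lemma fourier_coeff_mult: "fourier_coeff (\<lambda>x. p * f x) k = complex_of_real p * fourier_coeff f k"
proof -
  have "fourier_coeff (\<lambda>x. p * f x) k =
      (CLINT x:{0..1}|lborel. complex_of_real p * (complex_of_real (f x) * fourier_character k x))"
    by (simp add: fourier_coeff_character mult.assoc)
  also have "\<dots> = complex_of_real p * fourier_coeff f k"
    unfolding fourier_coeff_character by (rule set_integral_mult_right)
  finally show ?thesis .
qed

lemma fourier_coeff_one: "fourier_coeff (\<lambda>x. 1) k = (if k = 0 then 1 else 0)"
  unfolding fourier_coeff_character using integral_fourier_character[of k] by simp

context ladder_parameter
begin

lemma symbol_denominator_pos: "0 < c + 1 - cos y"
  using c_pos cos_le_one[of y] by linarith

lemma ladder_symbol_eq: "ladder_symbol \<alpha> = (\<lambda>x. c / (c + 1 - cos (2 * pi * x)))"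
  using \<alpha>_pos by (simp add: ladder_symbol_def fun_eq_iff Let_def)

lemma continuous_on_ladder_symbol: "continuous_on S (ladder_symbol \<alpha>)"
  unfolding ladder_symbol_eq using symbol_denominator_pos
  by (intro continuous_intros) (auto simp: less_imp_neq[symmetric])

text \<open>Integrate the identity \<open>(c + 1 - cos (2 * pi * x)) * f x = c\<close> against a character;
  multiplication by the cosine shifts the index by one in both directions.\<close>

lemma fourier_coeff_symbol_recurrence:
  "2 * (c + 1) * fourier_coeff (ladder_symbol \<alpha>) k =
     fourier_coeff (ladder_symbol \<alpha>) (k - 1) + fourier_coeff (ladder_symbol \<alpha>) (k + 1) +
     (if k = 0 then 2 * complex_of_real c else 0)"
proof -
  let ?f = "ladder_symbol \<alpha>"
  let ?g = "\<lambda>k x. complex_of_real (?f x) * fourier_character k x"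
  have int: "set_integrable lborel {0..1} (?g k)" for k
    using continuous_on_ladder_symbol by (intro borel_integrable_atLeastAtMost' continuous_intros)
  have int': "set_integrable lborel {0..1} (\<lambda>x. a * ?g k x)" for a k
    using int[of k] by simp
  have char: "fourier_character (k - 1) x + fourier_character (k + 1) x =
      complex_of_real (2 * cos (2 * pi * x)) * fourier_character k x" for x
  proof -
    define w where "w = complex_of_real (2 * pi * x)"
    have "fourier_character (k - 1) x = exp (\<i> * w) * fourier_character k x"
      "fourier_character (k + 1) x = exp (- (\<i> * w)) * fourier_character k x"
      unfolding fourier_character_def w_def exp_add[symmetric] by (simp_all add: algebra_simps)
    moreover have "complex_of_real (2 * cos (2 * pi * x)) = exp (\<i> * w) + exp (- (\<i> * w))"
      using cos_exp_eq[of w] by (simp add: w_def cos_of_real[symmetric] mult.commute del: cos_of_real)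
    ultimately show ?thesis by (simp add: algebra_simps)
  qed
  have pointwise: "complex_of_real (2 * (c + 1)) * ?g k x - (?g (k - 1) x + ?g (k + 1) x) =
      complex_of_real (2 * c) * fourier_character k x" for x
  proof -
    have "?f x * (2 * (c + 1) - 2 * cos (2 * pi * x)) = 2 * c"
      using symbol_denominator_pos[of "2 * pi * x"] by (simp add: ladder_symbol_eq field_simps)
    then have eq: "complex_of_real (?f x) * (complex_of_real (2 * (c + 1)) - complex_of_real (2 * cos (2 * pi * x))) =
        complex_of_real (2 * c)"
      by (metis of_real_diff of_real_mult)
    have "complex_of_real (2 * (c + 1)) * ?g k x - (?g (k - 1) x + ?g (k + 1) x) =
        complex_of_real (?f x) * (complex_of_real (2 * (c + 1)) - complex_of_real (2 * cos (2 * pi * x))) *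
        fourier_character k x"
    proof -
      have "a * (z * e) - (z * e1 + z * e2) = z * (a - d) * e" if "e1 + e2 = d * e" for a z e e1 e2 d :: complex
        unfolding distrib_left[symmetric] that by (simp add: algebra_simps)
      then show ?thesis using char by blast
    qed
    then show ?thesis by (simp only: eq)
  qed
  have "complex_of_real (2 * (c + 1)) * fourier_coeff ?f k - (fourier_coeff ?f (k - 1) + fourier_coeff ?f (k + 1)) =
      (CLINT x:{0..1}|lborel. complex_of_real (2 * (c + 1)) * ?g k x - (?g (k - 1) x + ?g (k + 1) x))"
    unfolding fourier_coeff_character
    by (subst set_integral_diff(2)[OF int' set_integral_add(1)[OF int int]])
      (simp only: set_integral_add(2)[OF int int] set_integral_mult_right)
  also have "\<dots> = complex_of_real (2 * c) * (if k = 0 then 1 else 0)"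
    unfolding pointwise set_integral_mult_right integral_fourier_character ..
  finally show ?thesis by (simp add: algebra_simps split: if_splits)
qed

text \<open>Away from the index 0 the coefficients form a bounded solution of a linear recurrence on either
  side, hence they decay geometrically; the equation at 0 fixes the constant.\<close>

theorem fourier_coeff_ladder_symbol_pos:
  "fourier_coeff (ladder_symbol \<alpha>) k = complex_of_real ((1 - \<alpha>) / (1 + \<alpha>) * \<alpha> ^ nat \<bar>k\<bar>)"
proof -
  let ?I = "fourier_coeff (ladder_symbol \<alpha>)"
  have c: "2 * (c + 1) = \<alpha> + 1 / \<alpha>"
    using \<alpha>_pos by (simp add: ladder_conductance_def field_simps power2_eq_square)
  have rec: "of_real (\<alpha> + 1 / \<alpha>) * ?I k = ?I (k - 1) + ?I (k + 1)" if "k \<noteq> 0" for k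
    using fourier_coeff_symbol_recurrence[of k] that unfolding c by simp
  have bound: "norm (?I k) \<le> (LINT x:{0..1}|lborel. \<bar>ladder_symbol \<alpha> x\<bar>)" for k
    by (rule norm_fourier_coeff_le[OF continuous_on_ladder_symbol])
  have pos: "?I (int n) = ?I 0 * of_real \<alpha> ^ n" for n
    using bounded_recurrence_geometric[OF \<alpha>_pos \<alpha>_less_1, of "\<lambda>n. ?I (int n)", OF bound] rec[of "int _ + 1"]
    by (simp add: add.commute)
  have neg: "?I (- int n) = ?I 0 * of_real \<alpha> ^ n" for n
    using bounded_recurrence_geometric[OF \<alpha>_pos \<alpha>_less_1, of "\<lambda>n. ?I (- int n)", OF bound] rec[of "- 1 - int _"]
    by (simp add: algebra_simps)
  have all: "?I k = ?I 0 * of_real \<alpha> ^ nat \<bar>k\<bar>" for k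
    using pos[of "nat k"] neg[of "nat (- k)"] by (cases "0 \<le> k") auto
  have "of_real (\<alpha> + 1 / \<alpha>) * ?I 0 = ?I (- 1) + ?I 1 + 2 * complex_of_real c"
    using fourier_coeff_symbol_recurrence[of 0] unfolding c by simp
  then have "(of_real (\<alpha> + 1 / \<alpha>) - 2 * of_real \<alpha>) * ?I 0 = 2 * complex_of_real c"
    using all[of "- 1"] all[of 1] by (simp add: algebra_simps)
  then have "complex_of_real (1 / \<alpha> - \<alpha>) * ?I 0 = complex_of_real ((1 - \<alpha>)\<^sup>2 / \<alpha>)"
    by (simp add: ladder_conductance_def algebra_simps)
  moreover have "1 < 1 / \<alpha>" using \<alpha>_pos \<alpha>_less_1 by simp
  then have "1 / \<alpha> - \<alpha> \<noteq> 0" using \<alpha>_less_1 by linarith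
  then have "complex_of_real (1 / \<alpha> - \<alpha>) \<noteq> 0" unfolding of_real_eq_0_iff .
  ultimately have "?I 0 = complex_of_real ((1 - \<alpha>)\<^sup>2 / \<alpha>) / complex_of_real (1 / \<alpha> - \<alpha>)"
    by (metis mult.commute nonzero_eq_divide_eq)
  also have "\<dots> = complex_of_real ((1 - \<alpha>)\<^sup>2 / \<alpha> / (1 / \<alpha> - \<alpha>))"
    by (simp only: of_real_divide)
  also have "(1 - \<alpha>)\<^sup>2 / \<alpha> / (1 / \<alpha> - \<alpha>) = (1 - \<alpha>) / (1 + \<alpha>)"
  proof -
    have "1 / \<alpha> - \<alpha> = (1 - \<alpha>) * (1 + \<alpha>) / \<alpha>" using \<alpha>_pos by (simp add: field_simps)
    then show ?thesis using \<alpha>_pos \<alpha>_less_1 by (simp add: power2_eq_square)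
  qed
  finally show ?thesis using all[of k] by simp
qed

end

section \<open>The rung process and its thinning\<close>

lemma gap_product_one:
  assumes "finite S"
  shows "geometric_gap_product 1 0 S = 1"
proof -
  have "geometric_gap_product 1 0 S = gap_product 1 (\<lambda>_. 1) S"
    using assms by (rule gap_product_cong) simp
  then show ?thesis by (simp add: gap_product_def)
qed

lemma thinned_ladder_modelD:
  assumes "thinned_ladder_model \<alpha> p M T Y"
  shows "prob_space M"
    "0 < \<alpha> \<Longrightarrow> T \<in> measurable M edge_sets_algebra"
    "0 < \<alpha> \<Longrightarrow> distr M edge_sets_algebra T = ladder_tree_measure (ladder_conductance \<alpha>)"
    "prob_space.indep_vars M (\<lambda>_. count_space UNIV) Y UNIV"
    "\<And>m. distr M (count_space UNIV) (Y m) = measure_pmf (bernoulli_pmf p)"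
    "prob_space.indep_var M (seq_algebra UNIV) (\<lambda>\<omega> m. rung_process \<alpha> T m \<omega>)
       (seq_algebra UNIV) (\<lambda>\<omega> m. Y m \<omega>)"
  using assms unfolding thinned_ladder_model_def by blast+

lemma binary_process_rung_process:
  assumes "prob_space M" "0 \<le> \<alpha>" "0 < \<alpha> \<Longrightarrow> T \<in> measurable M edge_sets_algebra"
  shows "binary_process M (rung_process \<alpha> T)"
  unfolding binary_process_def
proof (intro conjI allI assms(1))
  fix m
  show "rung_process \<alpha> T m \<in> measurable M (count_space UNIV)"
  proof (cases "\<alpha> = 0")
    case True
    then have "rung_process \<alpha> T m = (\<lambda>_. True)" by (simp add: rung_process_def fun_eq_iff)
    then show ?thesis by simp
  next
    case False
    then have "T \<in> measurable M (subset_algebra ladder_edges)"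
      using assms by (simp add: edge_sets_algebra_eq)
    moreover have "rung m \<in> ladder_edges" by (auto simp: mem_ladder_edges)
    ultimately have "(\<lambda>\<omega>. rung m \<in> T \<omega>) \<in> measurable M (count_space UNIV)"
      by (rule measurable_compose[OF _ mem_event_measurable])
    moreover have "rung_process \<alpha> T m = (\<lambda>\<omega>. rung m \<in> T \<omega>)"
      using False by (simp add: rung_process_def fun_eq_iff)
    ultimately show ?thesis by simp
  qed
qed

text \<open>For \<open>\<alpha> = 0\<close> all rungs are present, and the formula holds with \<open>\<rho> = 1\<close> because \<open>0 ^ (2 * m) = 0\<close> for
  every gap \<open>m \<ge> 1\<close>.\<close>

theorem inclusion_prob_rung_process:
  assumes "prob_space M" "0 \<le> \<alpha>" "\<alpha> < 1" "0 < \<alpha> \<Longrightarrow> T \<in> measurable M edge_sets_algebra"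
    and "0 < \<alpha> \<Longrightarrow> distr M edge_sets_algebra T = ladder_tree_measure (ladder_conductance \<alpha>)"
    and S: "finite S"
  shows "inclusion_prob M (rung_process \<alpha> T) S =
    geometric_gap_product (rung_density \<alpha>) \<alpha> S"
proof (cases "\<alpha> = 0")
  case True
  then have "inclusion_prob M (rung_process \<alpha> T) S = 1"
    using assms(1) by (simp add: rung_process_def prob_space.prob_space)
  then show ?thesis using True gap_product_one[OF S] by simp
next
  case False
  then interpret ladder_parameter \<alpha> using assms by unfold_locales auto
  define L where "L = {F \<in> Pow ladder_edges. \<forall>s\<in>S. rung s \<in> F}"
  have T: "T \<in> measurable M (subset_algebra ladder_edges)"
    using assms(4) \<alpha>_pos by (simp add: edge_sets_algebra_eq)
  have L_eq: "L = {F \<in> Pow ladder_edges. F \<inter> rung ` S \<in> {rung ` S}}" by (auto simp: L_def)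
  have "L \<in> sets (subset_algebra ladder_edges)"
    unfolding L_eq using S by (intro cylinder_in_sets) (auto simp: mem_ladder_edges)
  then have "measure (distr M (subset_algebra ladder_edges) T) L = measure M (T -` L \<inter> space M)"
    using T by (intro measure_distr)
  moreover have "T -` L \<inter> space M = {\<omega> \<in> space M. \<forall>s\<in>S. rung_process \<alpha> T s \<omega>}"
    using measurable_space[OF T] False by (auto simp: L_def rung_process_def)
  moreover have "measure (ladder_tree_measure c) L =
      geometric_gap_product (rung_density \<alpha>) \<alpha> S"
    unfolding L_def by (rule measure_rungs[OF S])
  ultimately show ?thesis using assms(5)[OF \<alpha>_pos] by (simp add: edge_sets_algebra_eq)
qed

theorem inclusion_prob_thinned:
  assumes model: "thinned_ladder_model \<alpha> p M T Y" and \<alpha>: "0 \<le> \<alpha>" "\<alpha> < 1" and p: "0 \<le> p" "p \<le> 1"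
    and S: "finite S"
  shows "inclusion_prob M (thinned_process (rung_process \<alpha> T) Y) S =
    geometric_gap_product (p * rung_density \<alpha>) \<alpha> S"
proof -
  note model = thinned_ladder_modelD[OF model]
  interpret prob_space M by (rule model)
  let ?X = "rung_process \<alpha> T"
  define E where "E = {x \<in> UNIV \<rightarrow>\<^sub>E UNIV. \<forall>s\<in>S. x s :: bool}"
  have E: "E \<in> sets (seq_algebra UNIV)" unfolding E_def using S by (intro inclusion_event_in_sets) auto
  have "prob ((\<lambda>\<omega>. (\<lambda>m. ?X m \<omega>, \<lambda>m. Y m \<omega>)) -` (E \<times> E) \<inter> space M) =
      prob ((\<lambda>\<omega> m. ?X m \<omega>) -` E \<inter> space M) * prob ((\<lambda>\<omega> m. Y m \<omega>) -` E \<inter> space M)"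
    using model(6) E E by (rule indep_varD)
  moreover have "(\<lambda>\<omega>. (\<lambda>m. ?X m \<omega>, \<lambda>m. Y m \<omega>)) -` (E \<times> E) \<inter> space M =
      {\<omega> \<in> space M. \<forall>s\<in>S. thinned_process ?X Y s \<omega>}"
    "(\<lambda>\<omega> m. ?X m \<omega>) -` E \<inter> space M = {\<omega> \<in> space M. \<forall>s\<in>S. ?X s \<omega>}"
    "(\<lambda>\<omega> m. Y m \<omega>) -` E \<inter> space M = {\<omega> \<in> space M. \<forall>s\<in>S. Y s \<omega>}"
    by (auto simp: E_def thinned_process_def)
  ultimately have "inclusion_prob M (thinned_process ?X Y) S = inclusion_prob M ?X S * inclusion_prob M Y S"
    by simp
  also have "inclusion_prob M Y S = p ^ card S"
  proof (cases "S = {}")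
    case True
    then show ?thesis by (simp add: prob_space)
  next
    case False
    have Y: "Y m \<in> measurable M (count_space UNIV)" for m
      using model(4) unfolding indep_vars_def by blast
    have Y_prob: "prob (Y m -` {True} \<inter> space M) = p" for m
    proof -
      have "prob (Y m -` {True} \<inter> space M) = measure (distr M (count_space UNIV) (Y m)) {True}"
        by (rule measure_distr[OF Y, symmetric]) simp
      also have "\<dots> = p" unfolding model(5) using p by (simp add: measure_pmf_single)
      finally show ?thesis .
    qed
    have "{\<omega> \<in> space M. \<forall>s\<in>S. Y s \<omega>} = (\<Inter>s\<in>S. Y s -` {True} \<inter> space M)" using False by auto
    then have "inclusion_prob M Y S = (\<Prod>s\<in>S. prob (Y s -` {True} \<inter> space M))"
      using indep_varsD[OF model(4) False S, of "\<lambda>_. {True}"] by simp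
    then show ?thesis by (simp add: Y_prob)
  qed
  also have "inclusion_prob M ?X S =
      geometric_gap_product (rung_density \<alpha>) \<alpha> S"
    by (rule inclusion_prob_rung_process[OF model(1) \<alpha> model(2,3) S])
  finally show ?thesis
    using gap_product_thinning[OF S, of p "rung_density \<alpha>" "\<lambda>m. rung_density \<alpha> * (1 - \<alpha> ^ (2 * m))"]
    by (simp add: mult.assoc mult.commute)
qed

lemma binary_process_thinned:
  assumes "thinned_ladder_model \<alpha> p M T Y" "0 \<le> \<alpha>"
  shows "binary_process M (thinned_process (rung_process \<alpha> T) Y)"
  unfolding binary_process_def
proof (intro conjI allI)
  note model = thinned_ladder_modelD[OF assms(1)]
  show "prob_space M" by (rule model)
  then interpret prob_space M .
  fix m
  have [measurable]: "Measurable.pred M (Y m)"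
    using model(4) unfolding indep_vars_def by blast
  have [measurable]: "Measurable.pred M (rung_process \<alpha> T m)"
    by (rule binary_process_pred[OF binary_process_rung_process[OF model(1) assms(2) model(2)]])
  show "Measurable.pred M (thinned_process (rung_process \<alpha> T) Y m)"
    unfolding thinned_process_def by measurable
qed

lemma next_renewal_eq_iff:
  assumes "1 \<le> m"
  shows "next_renewal X \<omega> = enat m \<longleftrightarrow> (\<forall>j\<in>{0<..<int m}. \<not> X j \<omega>) \<and> X (int m) \<omega>"
proof -
  define K where "K = {k::nat. 1 \<le> k \<and> X (int k) \<omega>}"
  have nr: "next_renewal X \<omega> = Inf (enat ` K)" by (simp add: next_renewal_def K_def)
  show ?thesis
  proof
    assume eq: "next_renewal X \<omega> = enat m"
    have "K \<noteq> {}"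
    proof
      assume "K = {}"
      then show False using eq nr by (simp add: top_enat_def)
    qed
    then have "Inf (enat ` K) \<in> enat ` K"
      unfolding Inf_enat_def by (auto intro: LeastI)
    then have "X (int m) \<omega>" using eq nr by (auto simp: K_def)
    moreover have "\<not> X j \<omega>" if j: "j \<in> {0<..<int m}" for j
    proof
      assume "X j \<omega>"
      then have "nat j \<in> K" using j by (auto simp: K_def)
      then have "enat m \<le> enat (nat j)" using eq nr by (metis INF_lower)
      then show False using j by auto
    qed
    ultimately show "(\<forall>j\<in>{0<..<int m}. \<not> X j \<omega>) \<and> X (int m) \<omega>" by blast
  next
    assume m: "(\<forall>j\<in>{0<..<int m}. \<not> X j \<omega>) \<and> X (int m) \<omega>"
    have "m \<in> K" using m assms by (simp add: K_def)
    moreover have "m \<le> k" if "k \<in> K" for k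
    proof (rule ccontr)
      assume "\<not> m \<le> k"
      then have "int k \<in> {0<..<int m}" using that by (simp add: K_def)
      then show False using m that by (auto simp: K_def)
    qed
    ultimately have "Inf (enat ` K) = enat m"
      by (intro antisym INF_lower INF_greatest) auto
    then show "next_renewal X \<omega> = enat m" using nr by simp
  qed
qed

text \<open>For the density \<open>(1 - \<alpha>) / (1 + \<alpha>)\<close> the recurrence of the first renewal probabilities has
  characteristic polynomial \<open>(x - \<alpha>)\<^sup>2\<close>, so that the solution is linear times geometric.\<close>

lemma next_renewal_distribution:
  assumes X: "binary_process M X" and \<alpha>: "0 \<le> \<alpha>" "\<alpha> < 1"
    and incl: "\<And>S. finite S \<Longrightarrow> inclusion_prob M X S =
      geometric_gap_product (rung_density \<alpha>) \<alpha> S"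
    and m: "1 \<le> m"
  shows "\<P>(\<omega> in M. next_renewal X \<omega> = enat m \<bar> X 0 \<omega>) = (1 - \<alpha>)\<^sup>2 * real m * \<alpha> ^ (m - 1)"
proof -
  have ren: "renewal_process M X" using X incl by (rule renewal_if_product_formula)
  let ?\<rho> = "rung_density \<alpha>"
  have \<rho>: "\<P>(\<omega> in M. X 0 \<omega>) = ?\<rho>" using incl[of "{0}"] by simp
  have \<rho>_pos: "0 < ?\<rho>" using \<alpha> by simp
  have \<rho>_sq: "?\<rho> * (1 - \<alpha>\<^sup>2) = (1 - \<alpha>)\<^sup>2"
  proof -
    have "1 - \<alpha>\<^sup>2 = (1 - \<alpha>) * (1 + \<alpha>)" by (simp add: power2_eq_square algebra_simps)
    then show ?thesis using \<alpha> by (simp add: power2_eq_square)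
  qed
  define u where "u k = \<P>(\<omega> in M. X 0 \<omega> \<and> X (int k) \<omega>) / \<P>(\<omega> in M. X 0 \<omega>)" for k
  let ?f = "first_renewal_prob M X"
  have nz: "?\<rho> \<noteq> 0" using \<rho>_pos by (rule less_imp_neq[symmetric])
  then have nz': "\<P>(\<omega> in M. X 0 \<omega>) \<noteq> 0" unfolding \<rho> .
  then have u0: "u 0 = 1" by (simp add: u_def)
  have u: "u n = ?\<rho> * (1 - \<alpha> ^ (2 * n))" if n: "1 \<le> n" for n
  proof -
    have "\<P>(\<omega> in M. X 0 \<omega> \<and> X (int n) \<omega>) = inclusion_prob M X (insert (int n) {0})"
      by (simp add: conj_commute)
    also have "\<dots> = geometric_gap_product ?\<rho> \<alpha> (insert (int n) {0})"
      by (rule incl) simp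
    also have "\<dots> = geometric_gap_product ?\<rho> \<alpha> {0} *
        (?\<rho> * (1 - \<alpha> ^ (2 * nat (int n - Max {0}))))"
      by (rule gap_product_insert_greatest) (use n in auto)
    also have "\<dots> = ?\<rho> * (?\<rho> * (1 - \<alpha> ^ (2 * n)))"
      by (simp only: gap_product_singleton Max_singleton diff_0_right nat_int)
    finally show ?thesis unfolding u_def \<rho> by (simp only: nonzero_mult_div_cancel_left[OF nz])
  qed
  have eq: "u n = (\<Sum>k=1..n. ?f k * u (n - k))" if "1 \<le> n" for n
    unfolding u_def using ren nz' that by (rule renewal_equation)
  have b: "1 + \<alpha>\<^sup>2 - (1 - \<alpha>)\<^sup>2 = 2 * \<alpha>"
    by (simp add: power2_eq_square algebra_simps)
  note rec = first_renewal_recurrence[OF u0 u eq, unfolded \<rho>_sq b]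
  have "?f (k + 1) = (1 - \<alpha>)\<^sup>2 * real (k + 1) * \<alpha> ^ k \<and>
      ?f (k + 2) = (1 - \<alpha>)\<^sup>2 * real (k + 2) * \<alpha> ^ (k + 1)" for k
  proof (induction k)
    case 0
    then show ?case using rec(1,2) by (simp add: numeral_2_eq_2)
  next
    case (Suc k)
    have "?f (Suc k + 2) = 2 * \<alpha> * ?f (k + 2) - \<alpha>\<^sup>2 * ?f (k + 1)"
      using rec(3)[of "k + 1"] by (simp add: add.commute)
    also have "\<dots> = 2 * \<alpha> * ((1 - \<alpha>)\<^sup>2 * real (k + 2) * \<alpha> ^ (k + 1)) -
        \<alpha>\<^sup>2 * ((1 - \<alpha>)\<^sup>2 * real (k + 1) * \<alpha> ^ k)"
      using Suc by (simp only:)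
    also have "\<dots> = (1 - \<alpha>)\<^sup>2 * real (Suc k + 2) * \<alpha> ^ (Suc k + 1)"
      by (simp add: algebra_simps power2_eq_square)
    finally show ?case using Suc by simp
  qed
  from this[of "m - 1"] have "?f m = (1 - \<alpha>)\<^sup>2 * real m * \<alpha> ^ (m - 1)" using m by simp
  moreover have "\<P>(\<omega> in M. next_renewal X \<omega> = enat m \<bar> X 0 \<omega>) = ?f m"
    unfolding cond_prob_def first_renewal_prob_def next_renewal_eq_iff[OF m]
    by (intro arg_cong2[where f = "(/)"] arg_cong[where f = "measure M"]) auto
  ultimately show ?thesis by simp
qed

lemma fourier_coeff_ladder_symbol:
  assumes "0 \<le> \<alpha>" "\<alpha> < 1"
  shows "fourier_coeff (ladder_symbol \<alpha>) k = complex_of_real (rung_density \<alpha> * \<alpha> ^ nat \<bar>k\<bar>)"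
proof (cases "\<alpha> = 0")
  case True
  then have "ladder_symbol \<alpha> = (\<lambda>_. 1)" by (simp add: ladder_symbol_def fun_eq_iff)
  then show ?thesis using True by (simp add: fourier_coeff_one)
next
  case False
  then interpret ladder_parameter \<alpha> using assms by unfold_locales auto
  show ?thesis by (rule fourier_coeff_ladder_symbol_pos)
qed

lemma thinned_ladder_symbol_eq: "thinned_ladder_symbol \<alpha> p = (\<lambda>x. p * ladder_symbol \<alpha> x)"
  by (auto simp: thinned_ladder_symbol_def ladder_symbol_def Let_def)

lemma ladder_symbol_bounds:
  assumes "0 \<le> \<alpha>" "\<alpha> < 1"
  shows "0 \<le> ladder_symbol \<alpha> x" "ladder_symbol \<alpha> x \<le> 1"
proof -
  have "0 \<le> ladder_symbol \<alpha> x \<and> ladder_symbol \<alpha> x \<le> 1"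
  proof (cases "\<alpha> = 0")
    case True
    then show ?thesis by (simp add: ladder_symbol_def)
  next
    case False
    then interpret ladder_parameter \<alpha> using assms by unfold_locales auto
    show ?thesis
      using c_pos symbol_denominator_pos[of "2 * pi * x"] cos_le_one[of "2 * pi * x"]
      by (simp add: ladder_symbol_eq field_simps)
  qed
  then show "0 \<le> ladder_symbol \<alpha> x" "ladder_symbol \<alpha> x \<le> 1" by auto
qed

lemma ladder_symbol_measurable:
  assumes "0 \<le> \<alpha>" "\<alpha> < 1"
  shows "ladder_symbol \<alpha> \<in> borel_measurable (restrict_space borel S)"
proof (cases "\<alpha> = 0")
  case True
  then have "ladder_symbol \<alpha> = (\<lambda>_. 1)" by (simp add: ladder_symbol_def fun_eq_iff)
  then show ?thesis by simp
next
  case False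
  then interpret ladder_parameter \<alpha> using assms by unfold_locales auto
  show ?thesis by (rule borel_measurable_continuous_on_restrict[OF continuous_on_ladder_symbol])
qed

lemma fourier_transform_of_thinned:
  assumes "0 \<le> \<alpha>" "\<alpha> < 1" "0 \<le> p" "p \<le> 1"
  shows "fourier_transform_of (\<lambda>k l. complex_of_real p * fourier_coeff (ladder_symbol \<alpha>) (l - k))
    (thinned_ladder_symbol \<alpha> p)"
  unfolding fourier_transform_of_def
proof (intro conjI allI)
  show "thinned_ladder_symbol \<alpha> p \<in> borel_measurable (restrict_space borel {0..1})"
    unfolding thinned_ladder_symbol_eq
    using ladder_symbol_measurable[OF assms(1,2)] by measurable
  have "p * ladder_symbol \<alpha> x \<le> 1" for x
    using mult_le_one[OF assms(4) ladder_symbol_bounds[OF assms(1,2)]] .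
  moreover have "0 \<le> p * ladder_symbol \<alpha> x" for x
    using assms ladder_symbol_bounds[OF assms(1,2)] by simp
  ultimately show "thinned_ladder_symbol \<alpha> p ` {0..1} \<subseteq> {0..1}"
    unfolding thinned_ladder_symbol_eq by auto
  show "complex_of_real p * fourier_coeff (ladder_symbol \<alpha>) (k - 0) = fourier_coeff (thinned_ladder_symbol \<alpha> p) k" for k
    unfolding thinned_ladder_symbol_eq fourier_coeff_mult by simp
qed simp

lemma determinantal_if_product_formula:
  assumes "binary_process M X"
    and "\<And>S. finite S \<Longrightarrow> inclusion_prob M X S = geometric_gap_product \<rho> \<alpha> S"
  shows "determinantal_process M X (\<lambda>k l. complex_of_real (\<rho> * \<alpha> ^ nat \<bar>l - k\<bar>))"
  unfolding determinantal_process_def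
proof (intro conjI allI impI assms(1))
  show "complex_of_real (\<rho> * \<alpha> ^ nat \<bar>k - l\<bar>) = cnj (complex_of_real (\<rho> * \<alpha> ^ nat \<bar>l - k\<bar>))" for k l :: int
    unfolding complex_cnj_complex_of_real by (simp only: abs_minus_commute)
  show "complex_of_real (inclusion_prob M X S) =
      principal_minor (\<lambda>k l. complex_of_real (\<rho> * \<alpha> ^ nat \<bar>l - k\<bar>)) S" if "finite S" for S
    unfolding principal_minor_geometric[OF that] assms(2)[OF that] ..
qed

theorem ladder_process_properties:
  assumes \<alpha>: "0 \<le> \<alpha>" "\<alpha> < 1" and p: "0 \<le> p" "p \<le> 1" and model: "thinned_ladder_model \<alpha> p M T Y"
  defines "X \<equiv> rung_process \<alpha> T" and "A \<equiv> \<lambda>k l. fourier_coeff (ladder_symbol \<alpha>) (l - k)"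
  shows "0 < \<alpha> \<Longrightarrow> 0 < ladder_conductance \<alpha>"
    and "determinantal_process M X A" and "fourier_transform_of A (ladder_symbol \<alpha>)"
    and "renewal_process M X"
    and "1 \<le> m \<Longrightarrow>
      \<P>(\<omega> in M. next_renewal X \<omega> = enat m \<bar> X 0 \<omega>) = (1 - \<alpha>)\<^sup>2 * real m * \<alpha> ^ (m - 1)"
    and "determinantal_process M (thinned_process X Y) (\<lambda>k l. complex_of_real p * A k l)"
    and "fourier_transform_of (\<lambda>k l. complex_of_real p * A k l) (thinned_ladder_symbol \<alpha> p)"
proof -
  note modelD = thinned_ladder_modelD[OF model]
  have BP: "binary_process M X"
    unfolding X_def by (rule binary_process_rung_process[OF modelD(1) \<alpha>(1) modelD(2)])
  have incl: "inclusion_prob M X S =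
      geometric_gap_product (rung_density \<alpha>) \<alpha> S" if "finite S" for S
    unfolding X_def by (rule inclusion_prob_rung_process[OF modelD(1) \<alpha> modelD(2,3) that])
  have A: "A = (\<lambda>k l. complex_of_real (rung_density \<alpha> * \<alpha> ^ nat \<bar>l - k\<bar>))"
    unfolding A_def fourier_coeff_ladder_symbol[OF \<alpha>] ..
  show "0 < ladder_conductance \<alpha>" if "0 < \<alpha>"
  proof -
    interpret ladder_parameter \<alpha> using \<alpha> that by unfold_locales
    show ?thesis by (rule c_pos)
  qed
  show "determinantal_process M X A"
    unfolding A using BP incl by (rule determinantal_if_product_formula)
  show "renewal_process M X" using BP incl by (rule renewal_if_product_formula)
  show "\<P>(\<omega> in M. next_renewal X \<omega> = enat m \<bar> X 0 \<omega>) = (1 - \<alpha>)\<^sup>2 * real m * \<alpha> ^ (m - 1)" if "1 \<le> m"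
    using BP \<alpha> incl that by (rule next_renewal_distribution)
  have "determinantal_process M (thinned_process X Y)
      (\<lambda>k l. complex_of_real (p * rung_density \<alpha> * \<alpha> ^ nat \<bar>l - k\<bar>))"
    unfolding X_def
    using binary_process_thinned[OF model \<alpha>(1)] inclusion_prob_thinned[OF model \<alpha> p]
    by (rule determinantal_if_product_formula)
  then show "determinantal_process M (thinned_process X Y) (\<lambda>k l. complex_of_real p * A k l)"
    unfolding A by (simp only: of_real_mult mult.assoc)
  show "fourier_transform_of (\<lambda>k l. complex_of_real p * A k l) (thinned_ladder_symbol \<alpha> p)"
    unfolding A_def using \<alpha> p by (rule fourier_transform_of_thinned)
  have "thinned_ladder_symbol \<alpha> 1 = ladder_symbol \<alpha>" by (simp add: thinned_ladder_symbol_eq)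
  then show "fourier_transform_of A (ladder_symbol \<alpha>)"
    unfolding A_def using fourier_transform_of_thinned[OF \<alpha>, of 1] by simp
qed

section \<open>Determinantal renewal processes\<close>

text \<open>If \<open>b < 2 * a\<close>, the characteristic polynomial \<open>x\<^sup>2 - b * x + a\<^sup>2\<close> has no positive roots and the
  solution must change sign. Concretely, the ratio \<open>r\<close> of consecutive terms is replaced by
  \<open>b - a\<^sup>2 / r\<close> in each step. By \<open>r + a\<^sup>2 / r \<ge> 2 * a\<close> it decreases by at least \<open>2 * a - b\<close>, so it cannot
  stay positive.\<close>

lemma nonneg_recurrence_real_roots:
  fixes f :: "nat \<Rightarrow> real"
  assumes a: "0 < a" and f1: "0 < f 1" and f2: "f 2 = b * f 1"
    and rec: "\<And>m. 1 \<le> m \<Longrightarrow> f (m + 2) = b * f (m + 1) - a\<^sup>2 * f m"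
    and nonneg: "\<And>m. 1 \<le> m \<Longrightarrow> 0 \<le> f m"
  shows "2 * a \<le> b"
proof (rule ccontr)
  assume "\<not> 2 * a \<le> b"
  then have b: "b < 2 * a" by simp
  have pos: "0 < f (Suc m)" for m
  proof (induction m)
    case 0
    then show ?case using f1 by simp
  next
    case (Suc m)
    show ?case
    proof (rule ccontr)
      assume "\<not> 0 < f (Suc (Suc m))"
      then have "f (Suc (Suc m)) = 0" using nonneg[of "Suc (Suc m)"] by simp
      then have "f (Suc m + 2) = - (a\<^sup>2 * f (Suc m))" using rec[of "Suc m"] by simp
      moreover have "0 < a\<^sup>2 * f (Suc m)" using a Suc by simp
      ultimately show False using nonneg[of "Suc m + 2"] by simp
    qed
  qed
  define r where "r m = f (Suc (Suc m)) / f (Suc m)" for m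
  have r_pos: "0 < r m" for m using pos[of m] pos[of "Suc m"] by (simp add: r_def)
  have step: "r (Suc m) \<le> r m - (2 * a - b)" for m
  proof -
    have "f (Suc (Suc (Suc m))) = b * f (Suc (Suc m)) - a\<^sup>2 * f (Suc m)"
      using rec[of "Suc m"] by simp
    then have "r (Suc m) = b - a\<^sup>2 / r m"
      using pos[of m] pos[of "Suc m"] by (simp add: r_def diff_divide_distrib)
    moreover have "2 * a \<le> r m + a\<^sup>2 / r m"
    proof -
      have "0 \<le> (r m - a)\<^sup>2 / r m" using r_pos[of m] by simp
      also have "\<dots> = r m + a\<^sup>2 / r m - 2 * a"
        using r_pos[of m] by (simp add: power2_eq_square field_simps)
      finally show ?thesis by simp
    qed
    ultimately show ?thesis by linarith
  qed
  have "r m \<le> r 0 - real m * (2 * a - b)" for m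
  proof (induction m)
    case (Suc m)
    then show ?case using step[of m] by (simp add: algebra_simps)
  qed simp
  moreover obtain m where "r 0 < real m * (2 * a - b)"
    using reals_Archimedean3[of "2 * a - b"] b by auto
  ultimately show False using r_pos[of m] by (smt (verit))
qed

text \<open>Infinitely many almost disjoint events of equal probability are null.\<close>

lemma stationary_pairwise_null_imp_null:
  assumes X: "stationary_process M X"
    and null: "\<And>s t. s < t \<Longrightarrow> \<P>(\<omega> in M. X s \<omega> \<and> X t \<omega>) = 0"
  shows "\<P>(\<omega> in M. X 0 \<omega>) = 0"
proof (rule ccontr)
  have BP: "binary_process M X" using X by (simp add: stationary_process_def)
  interpret prob_space M using BP by (simp add: binary_process_def)
  have [measurable]: "Measurable.pred M (X m)" for m using BP by (rule binary_process_pred)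
  let ?\<rho> = "\<P>(\<omega> in M. X 0 \<omega>)"
  assume "?\<rho> \<noteq> 0"
  then have pos: "0 < ?\<rho>" using measure_nonneg[of M "{\<omega> \<in> space M. X 0 \<omega>}"] by linarith
  define E where "E i = {\<omega> \<in> space M. X (int i) \<omega>}" for i :: nat
  have E: "E i \<in> events" for i unfolding E_def by measurable
  have prob_E: "prob (E i) = ?\<rho>" for i unfolding E_def by (rule stationary_single[OF X])
  have "prob (\<Union>i<n. E i) = real n * ?\<rho>" for n
  proof (induction n)
    case (Suc n)
    let ?U = "\<Union>i<n. E i"
    have U: "?U \<in> events" using E by auto
    have "prob (E n \<inter> ?U) \<le> 0"
    proof -
      have "prob (\<Union>i<n. E i \<inter> E n) \<le> (\<Sum>i<n. prob (E i \<inter> E n))"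
        using E by (intro measure_UNION_le) auto
      also have "\<dots> = 0"
      proof (intro sum.neutral ballI)
        fix i assume "i \<in> {..<n}"
        then have "\<P>(\<omega> in M. X (int i) \<omega> \<and> X (int n) \<omega>) = 0" by (intro null) simp
        moreover have "E i \<inter> E n = {\<omega> \<in> space M. X (int i) \<omega> \<and> X (int n) \<omega>}" by (auto simp: E_def)
        ultimately show "prob (E i \<inter> E n) = 0" by simp
      qed
      also have "(\<Union>i<n. E i \<inter> E n) = E n \<inter> ?U" by auto
      finally show ?thesis .
    qed
    then have zero: "prob (E n \<inter> ?U) = 0" by (simp add: measure_le_0_iff)
    have "(\<Union>i<Suc n. E i) = ?U \<union> (E n - ?U)" by (auto simp: lessThan_Suc)
    then have "prob (\<Union>i<Suc n. E i) = prob ?U + prob (E n - ?U)"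
      using U E finite_measure_Union[of ?U "E n - ?U"] by auto
    also have "prob (E n - ?U) = prob (E n)"
      using finite_measure_Diff'[OF E U] zero by simp
    finally show ?case using Suc prob_E by (simp add: algebra_simps)
  qed simp
  then have "real n * ?\<rho> \<le> 1" for n using prob_le_1 by metis
  moreover obtain n where "1 < real n * ?\<rho>" using reals_Archimedean3[OF pos] by blast
  ultimately show False by (meson not_less)
qed

text \<open>For \<open>x = A 0 s\<close>, \<open>y = A s t\<close> and \<open>z = A 0 t\<close> the hypothesis compares the product formula for the points
  0, \<open>s\<close> and \<open>t\<close> with the minor of \<open>A\<close> on them. The difference of the two sides is
  \<open>\<bar>\<rho> * z - x * y\<bar>\<^sup>2 / \<rho>\<close>.\<close>

lemma complex_triple_identity:
  fixes x y z :: complex and \<rho> :: real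
  assumes \<rho>: "\<rho> \<noteq> 0"
    and det: "complex_of_real ((\<rho>\<^sup>2 - (cmod x)\<^sup>2) * (\<rho>\<^sup>2 - (cmod y)\<^sup>2) / \<rho>) =
      complex_of_real \<rho> * (complex_of_real \<rho> * complex_of_real \<rho> - y * cnj y) -
      x * (cnj x * complex_of_real \<rho> - y * cnj z) + z * (cnj x * cnj y - complex_of_real \<rho> * cnj z)"
  shows "complex_of_real \<rho> * z = x * y"
proof -
  let ?r = "complex_of_real \<rho>"
  have "?r * complex_of_real ((\<rho>\<^sup>2 - (cmod x)\<^sup>2) * (\<rho>\<^sup>2 - (cmod y)\<^sup>2) / \<rho>) =
      complex_of_real ((\<rho>\<^sup>2 - (cmod x)\<^sup>2) * (\<rho>\<^sup>2 - (cmod y)\<^sup>2))"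
    using \<rho> by (simp only: of_real_mult[symmetric]) simp
  also have "\<dots> = (complex_of_real (\<rho>\<^sup>2) - x * cnj x) * (complex_of_real (\<rho>\<^sup>2) - y * cnj y)"
    by (simp only: of_real_mult of_real_diff complex_norm_square)
  finally have "(?r * z - x * y) * cnj (?r * z - x * y) = 0"
    unfolding det by (simp add: algebra_simps power2_eq_square)
  then have "?r * z - x * y = 0" by (simp only: mult_eq_0_iff complex_cnj_zero_iff disj_absorb)
  then show ?thesis by simp
qed

text \<open>Minors of order two express the renewal probabilities through \<open>B k = \<bar>A 0 k\<bar> / \<rho>\<close>, and minors of
  order three make \<open>B\<close> multiplicative; hence \<open>B k = \<alpha> ^ k\<close>. It remains to bound the density. Positive
  semidefiniteness of the matrix \<open>1 - A\<close> would do so, but the renewal structure gives it directly: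
  first renewal probabilities are nonnegative, so their recurrence must have real characteristic
  roots, which means \<open>2 * \<alpha> \<le> 1 + \<alpha>\<^sup>2 - \<rho> * (1 - \<alpha>\<^sup>2)\<close>.\<close>

theorem determinantal_renewal_parameters:
  assumes X: "renewal_process M X" and det: "determinantal_process M X A"
    and pos: "\<P>(\<omega> in M. X 0 \<omega>) \<noteq> 0"
  defines "\<rho> \<equiv> \<P>(\<omega> in M. X 0 \<omega>)"
  obtains \<alpha> where "0 \<le> \<alpha>" "\<alpha> < 1" "\<rho> \<le> rung_density \<alpha>"
    "\<And>S. finite S \<Longrightarrow> inclusion_prob M X S = geometric_gap_product \<rho> \<alpha> S"
proof -
  have st: "stationary_process M X" using X by (simp add: renewal_process_def)
  then have BP: "binary_process M X" by (simp add: stationary_process_def)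
  interpret prob_space M using BP by (simp add: binary_process_def)
  define u where "u k = \<P>(\<omega> in M. X 0 \<omega> \<and> X (int k) \<omega>) / \<rho>" for k
  have \<rho>: "0 < \<rho>" "\<rho> \<le> 1"
    using pos measure_nonneg[of M "{\<omega> \<in> space M. X 0 \<omega>}"] unfolding \<rho>_def by (linarith, intro prob_le_1)
  have incl: "inclusion_prob M X S = gap_product \<rho> u S" if "finite S" for S
    unfolding u_def \<rho>_def by (rule product_formula_if_renewal[OF X pos that])
  note det = det[unfolded determinantal_process_def, THEN conjunct2]
  have herm: "A l k = cnj (A k l)" for k l by (rule det[THEN conjunct1, rule_format])
  have minor: "complex_of_real (gap_product \<rho> u S) = principal_minor A S" if "finite S" for S
    unfolding incl[OF that, symmetric] by (rule det[THEN conjunct2, rule_format, OF that])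
  have diag: "A s s = complex_of_real \<rho>" for s
    using minor[of "{s}"] by simp
  have pair: "\<rho> * u (nat (t - s)) = \<rho>\<^sup>2 - (cmod (A s t))\<^sup>2" if st: "s < t" for s t
  proof -
    have "gap_product \<rho> u (insert t {s}) = gap_product \<rho> u {s} * u (nat (t - Max {s}))"
      using st by (intro gap_product_insert_greatest) auto
    then have gap: "gap_product \<rho> u {s, t} = \<rho> * u (nat (t - s))" by (simp add: insert_commute)
    have "complex_of_real (\<rho> * u (nat (t - s))) = complex_of_real \<rho> * complex_of_real \<rho> - A s t * cnj (A s t)"
      using minor[of "{s, t}"] principal_minor_pair[OF st, of A] herm[of t s] unfolding gap diag by simp
    also have "\<dots> = complex_of_real (\<rho>\<^sup>2 - (cmod (A s t))\<^sup>2)"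
      by (simp add: complex_norm_square[symmetric] power2_eq_square)
    finally show ?thesis by (simp only: of_real_eq_iff)
  qed
  define B where "B k = cmod (A 0 (int k)) / \<rho>" for k
  have cmod_A: "cmod (A s t) = \<rho> * B (nat (t - s))" if st: "s < t" for s t
  proof -
    have "(cmod (A s t))\<^sup>2 = (cmod (A 0 (t - s)))\<^sup>2"
      using pair[OF st] pair[of 0 "t - s"] st by simp
    then have "cmod (A s t) = cmod (A 0 (t - s))" by (simp add: power2_eq_iff_nonneg)
    then show ?thesis using \<rho> st by (simp add: B_def)
  qed
  have mult: "B (m + n) = B m * B n" if mn: "1 \<le> m" "1 \<le> n" for m n
  proof -
    define s t where "s = int m" and "t = int (m + n)"
    have st: "0 < s" "s < t" "nat (t - s) = n" "nat s = m" using mn by (simp_all add: s_def t_def)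
    have t: "nat t = m + n" unfolding t_def by (rule nat_int)
    have "gap_product \<rho> u (insert t {0, s}) = gap_product \<rho> u {0, s} * u (nat (t - Max {0, s}))"
      using st by (intro gap_product_insert_greatest) auto
    moreover have "gap_product \<rho> u (insert s {0}) = gap_product \<rho> u {0} * u (nat (s - Max {0}))"
      using st by (intro gap_product_insert_greatest) auto
    moreover have "insert t {0, s} = {0, s, t}" "insert s {0} = {0, s}" "Max {0, s} = s" using st by auto
    ultimately have "gap_product \<rho> u {0, s, t} = \<rho> * u m * u n" using st by simp
    also have "\<dots> = (\<rho> * u (nat (s - 0))) * (\<rho> * u (nat (t - s))) / \<rho>"
      using \<rho> st by simp
    also have "\<dots> = (\<rho>\<^sup>2 - (cmod (A 0 s))\<^sup>2) * (\<rho>\<^sup>2 - (cmod (A s t))\<^sup>2) / \<rho>"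
      unfolding pair[OF st(1)] pair[OF st(2)] ..
    finally have gap: "gap_product \<rho> u {0, s, t} = (\<rho>\<^sup>2 - (cmod (A 0 s))\<^sup>2) * (\<rho>\<^sup>2 - (cmod (A s t))\<^sup>2) / \<rho>" .
    have "complex_of_real \<rho> * A 0 t = A 0 s * A s t"
    proof (rule complex_triple_identity)
      show "complex_of_real ((\<rho>\<^sup>2 - (cmod (A 0 s))\<^sup>2) * (\<rho>\<^sup>2 - (cmod (A s t))\<^sup>2) / \<rho>) =
        complex_of_real \<rho> * (complex_of_real \<rho> * complex_of_real \<rho> - A s t * cnj (A s t)) -
        A 0 s * (cnj (A 0 s) * complex_of_real \<rho> - A s t * cnj (A 0 t)) +
        A 0 t * (cnj (A 0 s) * cnj (A s t) - complex_of_real \<rho> * cnj (A 0 t))"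
        using minor[of "{0, s, t}"]
        unfolding gap principal_minor_triple[OF st(1,2)] diag herm[of s 0] herm[of t 0] herm[of t s] by simp
    qed (use \<rho> in simp)
    then have "cmod (complex_of_real \<rho> * A 0 t) = cmod (A 0 s * A s t)" by simp
    then have "\<rho> * (\<rho> * B (m + n)) = (\<rho> * B m) * (\<rho> * B n)"
      using cmod_A[of 0 t] cmod_A[of 0 s] cmod_A[of s t] st t \<rho> by (simp add: norm_mult)
    then show ?thesis using \<rho> by simp
  qed
  define \<alpha> where "\<alpha> = B 1"
  have \<alpha>_nonneg: "0 \<le> \<alpha>" using \<rho> by (simp add: \<alpha>_def B_def)
  have B: "B (Suc k) = \<alpha> ^ Suc k" for k
  proof (induction k)
    case (Suc k)
    then show ?case using mult[of "Suc k" 1] by (simp add: \<alpha>_def)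
  qed (simp add: \<alpha>_def)
  have u: "u n = \<rho> * (1 - \<alpha> ^ (2 * n))" if n: "1 \<le> n" for n
  proof -
    have "\<rho> * u n = \<rho>\<^sup>2 - (\<rho> * B n)\<^sup>2"
      using pair[of 0 "int n"] cmod_A[of 0 "int n"] n by simp
    also have "\<dots> = \<rho> * (\<rho> * (1 - (B n)\<^sup>2))" by (simp add: power2_eq_square algebra_simps)
    finally have "u n = \<rho> * (1 - (B n)\<^sup>2)" using \<rho> by simp
    moreover have "B n = \<alpha> ^ n" using B[of "n - 1"] n by simp
    ultimately show ?thesis by (simp add: power_mult[symmetric] mult.commute)
  qed
  have u_nonneg: "0 \<le> u k" for k using \<rho> by (simp add: u_def)
  have "0 \<le> \<rho> * (1 - \<alpha>\<^sup>2)" using u[of 1] u_nonneg[of 1] by (simp add: power2_eq_square)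
  then have "\<alpha>\<^sup>2 \<le> 1" using \<rho> by (simp add: zero_le_mult_iff)
  then have "\<alpha> \<le> 1" by (simp add: power2_le_iff_abs_le abs_le_square_iff power_le_one_iff \<alpha>_nonneg)
  moreover have "\<alpha> \<noteq> 1"
  proof
    assume 1: "\<alpha> = 1"
    have "\<P>(\<omega> in M. X s \<omega> \<and> X t \<omega>) = 0" if "s < t" for s t
    proof -
      have "u (nat (t - s)) = 0" using u[of "nat (t - s)"] that 1 by simp
      then show ?thesis using stationary_pair[OF st, of s t] that \<rho> by (simp add: u_def)
    qed
    from stationary_pairwise_null_imp_null[OF st this] pos show False by simp
  qed
  ultimately have \<alpha>_less: "\<alpha> < 1" by simp
  \<comment> \<open>For \<open>\<alpha> = 0\<close> the bound says \<open>\<rho> \<le> 1\<close> only; the argument with ratios requires \<open>\<alpha> > 0\<close>.\<close>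
  have "\<rho> \<le> rung_density \<alpha>"
  proof (cases "\<alpha> = 0")
    case True
    then show ?thesis using \<rho> by simp
  next
    case False
    then have \<alpha>: "0 < \<alpha>" using \<alpha>_nonneg by simp
    have sq: "\<alpha>\<^sup>2 < 1" using \<alpha> \<alpha>_less by (simp add: power_less_one_iff)
    let ?f = "first_renewal_prob M X"
    have u0: "u 0 = 1" using pos by (simp add: u_def \<rho>_def)
    have eq: "u n = (\<Sum>k=1..n. ?f k * u (n - k))" if "1 \<le> n" for n
      unfolding u_def \<rho>_def using X pos that by (rule renewal_equation)
    have f1: "?f 1 = \<rho> * (1 - \<alpha>\<^sup>2)"
      by (rule first_renewal_recurrence(1)[of u, OF u0 u eq])
    have f2: "?f 2 = (1 + \<alpha>\<^sup>2 - \<rho> * (1 - \<alpha>\<^sup>2)) * ?f 1"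
      by (rule first_renewal_recurrence(2)[of u, OF u0 u eq])
    have f3: "?f (m + 2) = (1 + \<alpha>\<^sup>2 - \<rho> * (1 - \<alpha>\<^sup>2)) * ?f (m + 1) - \<alpha>\<^sup>2 * ?f m" if "1 \<le> m" for m
      by (rule first_renewal_recurrence(3)[of u \<rho> \<alpha> ?f, OF u0 u eq that])
    have "2 * \<alpha> \<le> 1 + \<alpha>\<^sup>2 - \<rho> * (1 - \<alpha>\<^sup>2)"
    proof (rule nonneg_recurrence_real_roots[OF \<alpha>, of ?f])
      show "0 < ?f 1" unfolding f1 using \<rho> sq by simp
      show "0 \<le> ?f m" for m by (simp add: first_renewal_prob_def)
    qed (fact f2, fact f3)
    then have "\<rho> * ((1 - \<alpha>) * (1 + \<alpha>)) \<le> (1 - \<alpha>) * (1 - \<alpha>)"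
      by (simp add: power2_eq_square algebra_simps)
    then have "(1 - \<alpha>) * (\<rho> * (1 + \<alpha>)) \<le> (1 - \<alpha>) * (1 - \<alpha>)" by (simp add: algebra_simps)
    then have "\<rho> * (1 + \<alpha>) \<le> 1 - \<alpha>" using \<alpha>_less by (simp only: mult_le_cancel_left_pos diff_gt_0_iff_gt)
    then show ?thesis using \<alpha> by (simp add: pos_le_divide_eq)
  qed
  moreover have "inclusion_prob M X S = geometric_gap_product \<rho> \<alpha> S" if "finite S" for S
    unfolding incl[OF that] using that u by (rule gap_product_cong)
  ultimately show thesis by (rule that[OF \<alpha>_nonneg \<alpha>_less])
qed

lemma distr_pair_snd_prob:
  assumes "prob_space P" "prob_space B"
  shows "distr (P \<Otimes>\<^sub>M B) B snd = B"
proof (rule measure_eqI)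
  interpret P: prob_space P by fact
  interpret B: prob_space B by fact
  fix E assume "E \<in> sets (distr (P \<Otimes>\<^sub>M B) B snd)"
  then have E: "E \<in> sets B" by simp
  then have "emeasure (distr (P \<Otimes>\<^sub>M B) B snd) E = emeasure (P \<Otimes>\<^sub>M B) (space P \<times> E)"
    by (auto simp: emeasure_distr space_pair_measure dest: sets.sets_into_space intro!: arg_cong2[where f = emeasure])
  with E show "emeasure (distr (P \<Otimes>\<^sub>M B) B snd) E = emeasure B E"
    by (simp add: B.emeasure_pair_measure_Times P.emeasure_space_1)
qed simp

text \<open>A product space carries the random tree and the independent coin tosses. For \<open>\<alpha> = 0\<close> any
  distribution of the edge set will do, and the empty set is taken.\<close>

theorem thinned_ladder_model_exists:
  assumes \<alpha>: "0 \<le> \<alpha>" "\<alpha> < 1"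
  shows "\<exists>(M :: (ladder_vertex edge set \<times> (int \<Rightarrow> bool)) measure) T Y. thinned_ladder_model \<alpha> p M T Y"
proof -
  define P where "P = (if \<alpha> = 0 then return edge_sets_algebra {} else ladder_tree_measure (ladder_conductance \<alpha>))"
  have P: "prob_space P" "sets P = sets edge_sets_algebra"
  proof -
    have "prob_space P \<and> sets P = sets edge_sets_algebra"
    proof (cases "\<alpha> = 0")
      case True
      have "{} \<in> space edge_sets_algebra" by (simp add: edge_sets_algebra_eq)
      then show ?thesis using True by (simp add: P_def prob_space_return)
    next
      case False
      then interpret ladder_parameter \<alpha> using \<alpha> by unfold_locales auto
      show ?thesis
        using is_ladder_tree_limitD(1,3)[OF is_ladder_tree_limit_ladder_tree_measure] False
        by (simp add: P_def edge_sets_algebra_eq)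
    qed
    then show "prob_space P" "sets P = sets edge_sets_algebra" by auto
  qed
  define b where "b = measure_pmf (bernoulli_pmf p)"
  define B where "B = PiM (UNIV :: int set) (\<lambda>_. b)"
  have b: "prob_space b" "sets b = sets (count_space UNIV)" by (simp_all add: b_def measure_pmf.prob_space_axioms)
  interpret B: product_prob_space "\<lambda>_. b" "UNIV :: int set"
    by (rule product_prob_spaceI) (rule b(1))
  have B: "prob_space B" unfolding B_def by (rule B.prob_space_axioms)
  have sets_B: "sets B = sets (seq_algebra UNIV)"
    unfolding B_def by (rule sets_PiM_cong) (simp_all add: b)
  define M where "M = P \<Otimes>\<^sub>M B"
  define Y where "Y m \<omega> = snd \<omega> m" for m :: int and \<omega> :: "ladder_vertex edge set \<times> (int \<Rightarrow> bool)"
  have M: "prob_space M" unfolding M_def using P(1) B by (rule prob_space_pair)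
  interpret M: prob_space M by (rule M)
  have fst: "distr M P fst = P" unfolding M_def by (rule prob_space.distr_pair_fst[OF B])
  have snd: "distr M B snd = B" unfolding M_def by (rule distr_pair_snd_prob[OF P(1) B])
  have fst_measurable: "fst \<in> measurable M P" and snd_measurable: "snd \<in> measurable M B"
    by (simp_all add: M_def)
  have Y_measurable: "Y m \<in> measurable M (count_space UNIV)" for m
  proof -
    have "(\<lambda>x. x m) \<in> measurable B b" unfolding B_def by (rule measurable_component_singleton) simp
    then have "(\<lambda>\<omega>. snd \<omega> m) \<in> measurable M b" using snd_measurable by (rule measurable_compose[rotated])
    then show ?thesis unfolding Y_def measurable_cong_sets[OF refl b(2)] by simp
  qed
  have Y_distr: "distr M (count_space UNIV) (Y m) = b" for m
  proof -
    have comp: "(\<lambda>x. x m) \<in> measurable B b" unfolding B_def by (rule measurable_component_singleton) simp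
    have "distr M (count_space UNIV) (Y m) = distr M b ((\<lambda>x. x m) \<circ> snd)"
      by (rule distr_cong) (simp_all add: b(2) Y_def)
    also have "\<dots> = distr (distr M B snd) b (\<lambda>x. x m)"
      by (rule distr_distr[OF comp snd_measurable, symmetric])
    also have "\<dots> = distr B b (\<lambda>x. x m)" by (simp only: snd)
    also have "\<dots> = b" unfolding B_def using B.PiM_component[of m] by simp
    finally show ?thesis .
  qed
  have indep_Y: "M.indep_vars (\<lambda>_. count_space UNIV) Y UNIV"
  proof (subst M.indep_vars_iff_distr_eq_PiM)
    have "distr M (seq_algebra UNIV) (\<lambda>\<omega>. \<lambda>i\<in>UNIV. Y i \<omega>) = distr M B snd"
      by (rule distr_cong) (simp_all add: sets_B Y_def restrict_def)
    also have "\<dots> = (\<Pi>\<^sub>M i\<in>UNIV. distr M (count_space UNIV) (Y i))"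
      unfolding snd Y_distr by (simp only: B_def)
    finally show "distr M (seq_algebra UNIV) (\<lambda>\<omega>. \<lambda>i\<in>UNIV. Y i \<omega>) =
        (\<Pi>\<^sub>M i\<in>UNIV. distr M (count_space UNIV) (Y i))" .
  qed (use Y_measurable in auto)
  have "binary_process P (rung_process \<alpha> (\<lambda>F. F))"
    using P(1) \<alpha>(1) by (rule binary_process_rung_process) (simp add: measurable_ident_sets[OF P(2)])
  then have rungs: "(\<lambda>F m. rung_process \<alpha> (\<lambda>F. F) m F) \<in> measurable P (seq_algebra UNIV)"
    by (rule binary_process_measurable_UNIV)
  define R where "R F = (\<lambda>m. rung_process \<alpha> (\<lambda>F. F) m F)" for F
  have R: "R \<in> measurable P (seq_algebra UNIV)" using rungs unfolding R_def .
  have ident: "(\<lambda>x. x) \<in> measurable B (seq_algebra UNIV)"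
    by (rule measurable_ident_sets[OF sets_B])
  have indep: "M.indep_var (seq_algebra UNIV) (\<lambda>\<omega>. R (fst \<omega>)) (seq_algebra UNIV) snd"
  proof (subst M.indep_var_distribution_eq, intro conjI)
    show "(\<lambda>\<omega>. R (fst \<omega>)) \<in> measurable M (seq_algebra UNIV)"
      using fst_measurable R by (rule measurable_compose)
    show "snd \<in> measurable M (seq_algebra UNIV)"
      using snd_measurable ident by (rule measurable_compose)
    have X: "distr M (seq_algebra UNIV) (\<lambda>\<omega>. R (fst \<omega>)) = distr P (seq_algebra UNIV) R"
      using distr_distr[OF R fst_measurable] by (simp only: fst o_def)
    have Y: "distr M (seq_algebra UNIV) snd = distr B (seq_algebra UNIV) (\<lambda>x. x)"
      using distr_distr[OF ident snd_measurable] by (simp only: snd o_def)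
    interpret BD: prob_space "distr B (seq_algebra UNIV) (\<lambda>x. x)"
      using ident by (rule prob_space.prob_space_distr[OF B])
    have "distr P (seq_algebra UNIV) R \<Otimes>\<^sub>M distr B (seq_algebra UNIV) (\<lambda>x. x) =
        distr (P \<Otimes>\<^sub>M B) (seq_algebra UNIV \<Otimes>\<^sub>M seq_algebra UNIV) (\<lambda>(x, y). (R x, y))"
      using R ident by (rule pair_measure_distr) unfold_locales
    then show "distr M (seq_algebra UNIV) (\<lambda>\<omega>. R (fst \<omega>)) \<Otimes>\<^sub>M distr M (seq_algebra UNIV) snd =
        distr M (seq_algebra UNIV \<Otimes>\<^sub>M seq_algebra UNIV) (\<lambda>\<omega>. (R (fst \<omega>), snd \<omega>))"
      unfolding X Y by (simp only: M_def case_prod_unfold)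
  qed
  have RX: "(\<lambda>\<omega>. R (fst \<omega>)) = (\<lambda>\<omega> m. rung_process \<alpha> fst m \<omega>)"
    by (simp add: fun_eq_iff rung_process_def R_def)
  have SY: "snd = (\<lambda>\<omega> m. Y m \<omega>)" by (simp add: fun_eq_iff Y_def)
  have indep': "M.indep_var (seq_algebra UNIV) (\<lambda>\<omega> m. rung_process \<alpha> fst m \<omega>)
      (seq_algebra UNIV) (\<lambda>\<omega> m. Y m \<omega>)"
    by (rule indep[unfolded RX SY])
  have T: "fst \<in> measurable M edge_sets_algebra"
    using fst_measurable unfolding measurable_cong_sets[OF refl P(2)] .
  have "distr M edge_sets_algebra fst = distr M P fst"
    by (rule distr_cong) (simp_all add: P(2))
  then have "distr M edge_sets_algebra fst = ladder_tree_measure (ladder_conductance \<alpha>)" if "0 < \<alpha>"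
    using that fst by (simp add: P_def)
  then have "thinned_ladder_model \<alpha> p M fst Y"
    unfolding thinned_ladder_model_def
    using M T indep_Y indep' Y_distr by (simp add: b_def)
  then show ?thesis by blast
qed

text \<open>With \<open>p\<close> the quotient of the densities, the given process and the thinned rung process have the
  same inclusion probabilities. A process of density 0 is thinned with \<open>p = 0\<close>.\<close>

theorem determinantal_renewal_is_thinned_ladder:
  assumes det: "determinantal_process N Z A" and ren: "renewal_process N Z"
  shows "\<exists>(\<alpha>::real) (p::real) (M::(ladder_vertex edge set \<times> (int \<Rightarrow> bool)) measure) T Y.
    0 \<le> \<alpha> \<and> \<alpha> < 1 \<and> 0 \<le> p \<and> p \<le> 1 \<and> thinned_ladder_model \<alpha> p M T Y \<and>
    process_law N Z = process_law M (thinned_process (rung_process \<alpha> T) Y)"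
proof -
  have st: "stationary_process N Z" using ren by (simp add: renewal_process_def)
  then have BP: "binary_process N Z" by (simp add: stationary_process_def)
  interpret prob_space N using BP by (simp add: binary_process_def)
  have [measurable]: "Measurable.pred N (Z m)" for m using BP by (rule binary_process_pred)
  let ?\<rho> = "\<P>(\<omega> in N. Z 0 \<omega>)"
  obtain \<alpha> where \<alpha>: "0 \<le> \<alpha>" "\<alpha> < 1" "?\<rho> \<le> rung_density \<alpha>"
    and incl: "\<And>S. finite S \<Longrightarrow> inclusion_prob N Z S = geometric_gap_product ?\<rho> \<alpha> S"
  proof (cases "?\<rho> = 0")
    case False
    from ren det False show thesis by (rule determinantal_renewal_parameters) (rule that)
  next
    case True
    have "inclusion_prob N Z S = geometric_gap_product ?\<rho> 0 S" for S
    proof (cases "S = {}")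
      case True
      then show ?thesis by (simp add: prob_space)
    next
      case False
      then obtain s where "s \<in> S" by blast
      then have "inclusion_prob N Z S \<le> \<P>(\<omega> in N. Z s \<omega>)"
        by (intro finite_measure_mono) auto
      then have "inclusion_prob N Z S = 0"
        using stationary_single[OF st, of s] True by (simp add: measure_le_0_iff)
      then show ?thesis using True False by (simp add: gap_product_def)
    qed
    then show thesis using that[of 0] True by simp
  qed
  define p where "p = ?\<rho> / rung_density \<alpha>"
  have rd: "0 < rung_density \<alpha>" using \<alpha> by simp
  have div: "0 \<le> x / r \<and> x / r \<le> 1 \<and> x / r * r = x" if "0 < r" "0 \<le> x" "x \<le> r" for x r :: real
    using that by simp
  have p: "0 \<le> p" "p \<le> 1" "p * rung_density \<alpha> = ?\<rho>"
    using div[OF rd measure_nonneg \<alpha>(3)] unfolding p_def by blast+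
  obtain M :: "(ladder_vertex edge set \<times> (int \<Rightarrow> bool)) measure" and T Y
    where model: "thinned_ladder_model \<alpha> p M T Y"
    using thinned_ladder_model_exists[OF \<alpha>(1,2)] by blast
  have "process_law N Z = process_law M (thinned_process (rung_process \<alpha> T) Y)"
  proof (rule process_law_eqI[OF BP binary_process_thinned[OF model \<alpha>(1)]])
    fix S :: "int set" assume S: "finite S"
    show "inclusion_prob N Z S = inclusion_prob M (thinned_process (rung_process \<alpha> T) Y) S"
      unfolding incl[OF S] inclusion_prob_thinned[OF model \<alpha>(1,2) p(1,2) S] p(3) ..
  qed
  with \<alpha> p model show ?thesis by blast
qed

theorem theorem1p3:
  "(\<forall>(\<alpha>::real) (p::real) (M::'a measure) T Y.
      0 \<le> \<alpha> \<and> \<alpha> < 1 \<and> 0 \<le> p \<and> p \<le> 1 \<and> thinned_ladder_model \<alpha> p M T Y \<longrightarrow>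
      (let X = rung_process \<alpha> T;
           f = ladder_symbol \<alpha>;
           A = (\<lambda>k l. fourier_coeff f (l - k))
       in (0 < \<alpha> \<longrightarrow> 0 < ladder_conductance \<alpha>) \<and>
          determinantal_process M X A \<and> fourier_transform_of A f \<and>
          (\<forall>k. fourier_coeff f k = complex_of_real ((1 - \<alpha>) / (1 + \<alpha>) * \<alpha> ^ nat \<bar>k\<bar>)) \<and>
          renewal_process M X \<and>
          (\<forall>m::nat. 1 \<le> m \<longrightarrow>
             \<P>(\<omega> in M. next_renewal X \<omega> = enat m \<bar> X 0 \<omega>) = (1 - \<alpha>)\<^sup>2 * real m * \<alpha> ^ (m - 1)) \<and>
          determinantal_process M (thinned_process X Y) (\<lambda>k l. complex_of_real p * A k l) \<and>
          fourier_transform_of (\<lambda>k l. complex_of_real p * A k l) (thinned_ladder_symbol \<alpha> p)))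
   \<and>
   (\<forall>(N::'b measure) Z.
      stationary_process N Z \<and> (\<exists>A. determinantal_process N Z A) \<and> renewal_process N Z \<longrightarrow>
      (\<exists>(\<alpha>::real) (p::real)
          (M::(ladder_vertex edge set \<times> (int \<Rightarrow> bool)) measure) T Y.
         0 \<le> \<alpha> \<and> \<alpha> < 1 \<and> 0 \<le> p \<and> p \<le> 1 \<and> thinned_ladder_model \<alpha> p M T Y \<and>
         process_law N Z = process_law M (thinned_process (rung_process \<alpha> T) Y)))"
proof (intro conjI allI impI, goal_cases)
  case (1 \<alpha> p M T Y)
  then have \<alpha>: "0 \<le> \<alpha>" "\<alpha> < 1" and p: "0 \<le> p" "p \<le> 1" and model: "thinned_ladder_model \<alpha> p M T Y"
    by blast+
  note props = ladder_process_properties[OF \<alpha> p model]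
  show ?case
    unfolding Let_def
    by (intro conjI allI impI props fourier_coeff_ladder_symbol[OF \<alpha>])
next
  case (2 N Z)
  then obtain A where "determinantal_process N Z A" "renewal_process N Z" by blast
  then show ?case by (rule determinantal_renewal_is_thinned_ladder)
qed

end
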